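(* Let $S$ be a locally compact Hausdorff space with countable base and let $d$ be a metric on $S$ inducing its topology. There exists a unique Polish topology on $\mathbb{D}_{\mathrm{loc}}(S)$, called the local Skorokhod topology, such that a sequence $(x^k)_{k\in\mathbb{N}}$ in $\mathbb{D}_{\mathrm{loc}}(S)$ converges to $x\in\mathbb{D}_{\mathrm{loc}}(S)$ for this topology if and only if there exists a sequence $(\lambda^k)_{k\in\mathbb{N}}$ in $\Lambda$ such that: - either $\xi(x)<\infty$ and $\{x_s\}_{s<\xi(x)}\Subset S$, and then: $\lambda^k_{\xi(x)}\le\xi(x^k)$ for $k$ large enough and, as $k\to\infty$, $$\sup_{s<\xi(x)}d(x_s,x^k_{\lambda^k_s})\to0,\qquad x^k_{\lambda^k_{\xi(x)}}\to\Delta,\qquad \|\log\dot\lambda^k\|_{\xi(x)}\to0;$$ - or $\xi(x)=\infty$ or $\{x_s\}_{s<\xi(x)}\not\Subset S$, and then: for all $t<\xi(x)$, for $k$ large enough $\lambda^k_t<\xi(x^k)$ and, as $k\to\infty$, $$\sup_{s\le t}d(x_s,x^k_{\lambda^k_s})\to0,\qquad \|\log\dot\lambda^k\|_t\to0.$$ The local Skorokhod topology does not depend on the metric $d$, but only on the topology of $S$. Moreover the Borel $\sigma$-algebra $\mathcal{B}(\mathbb{D}_{\mathrm{loc}}(S))$ coincides with the $\sigma$-algebra $\mathcal{F}$.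
   Context: $\Delta\notin S$ is a point and $S^\Delta=S\cup\{\Delta\}$ is the one-point compactification of $S$ if $S$ is not compact, and the topological sum $S\sqcup\{\Delta\}$ ($\Delta$ isolated) if $S$ is compact. $C\Subset A$ means that $C\subset A$ is contained in a compact subset of $A$. $\mathbb{D}_{\mathrm{exp}}(S)$ is the set of maps $x:[0,T_{\max})\to S$, $0\le T_{\max}\le\infty$, that are right-continuous on $[0,T_{\max})$ and have left limits $x_{t-}\in S$ at each $t\in(0,T_{\max})$; write $\xi(x):=T_{\max}$ and set $x_t:=\Delta$ for $t\ge\xi(x)$, so that $\mathbb{D}_{\mathrm{exp}}(S)\subset(S^\Delta)^{\mathbb{R}_+}$. $\mathbb{D}_{\mathrm{loc}}(S)$ is the set of $x\in\mathbb{D}_{\mathrm{exp}}(S)$ such that if $\xi(x)\in(0,\infty)$ and $\{x_s\}_{s<\xi(x)}\Subset S$ then $x_{\xi(x)-}$ exists (in $S$). $X$ is the canonical process and $\mathcal{F}:=\sigma(X_s,\,0\le s<\infty)$. $\Lambda$ is the set of increasing bijections $\lambda:\mathbb{R}_+\to\mathbb{R}_+$ with $\lambda$ and $\lambda^{-1}$ locally Lipschitz; $\dot\lambda$ is the density of $\mathrm{d}\lambda$ with respect to Lebesgue measure and $\|\log\dot\lambda\|_t:=\operatorname{ess\,sup}_{0\le s\le t}|\log\dot\lambda_s|=\sup_{0\le s_1<s_2\le t}\left|\log\frac{\lambda_{s_2}-\lambda_{s_1}}{s_2-s_1}\right|$. Suprema over the empty set are $0$. Convergence to $\Delta$ is in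 $S^\Delta$. *)

theory Defs
  imports "HOL-Analysis.Analysis" "HOL-Probability.Essential_Supremum"
begin

text \<open>
  The state space is an abstract topology \<open>S\<close>, and its extension by a cemetery point \<open>\<Delta>\<close> is
  \<^const>\<open>Alexandroff_compactification\<close>, with \<^const>\<open>None\<close> for \<open>\<Delta>\<close>. If \<open>S\<close> is compact, then
  \<open>{None}\<close> is open in that space (its complement is the image of a closed compact set), so it is
  the topological sum of \<open>S\<close> and an isolated point.

  A path is an element of \<open>{0..} \<rightarrow>\<^sub>E topspace (Alexandroff_compactification S)\<close>. The life time
  takes values in the extended reals; it is \<open>\<infinity>\<close> for a path that never hits \<open>\<Delta>\<close>.
\<close>

definition lifetime :: "(real \<Rightarrow> 'a option) \<Rightarrow> ereal" where
  "lifetime x = (INF t\<in>{t. 0 \<le> t \<and> x t = None}. ereal t)"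

definition trajectory :: "(real \<Rightarrow> 'a option) \<Rightarrow> 'a set" where
  "trajectory x = {the (x s) | s. 0 \<le> s \<and> ereal s < lifetime x}"

definition compactly_contained :: "'a topology \<Rightarrow> 'a set \<Rightarrow> bool" where
  "compactly_contained S C \<longleftrightarrow> (\<exists>K. compactin S K \<and> C \<subseteq> K)"

definition D_exp :: "'a topology \<Rightarrow> (real \<Rightarrow> 'a option) set" where
  "D_exp S = {x \<in> {0..} \<rightarrow>\<^sub>E topspace (Alexandroff_compactification S).
     (\<forall>t\<ge>0. lifetime x \<le> ereal t \<longrightarrow> x t = None) \<and>
     (\<forall>t\<ge>0. ereal t < lifetime x \<longrightarrow> limitin S (\<lambda>s. the (x s)) (the (x t)) (at_right t)) \<and>
     (\<forall>t>0. ereal t < lifetime x \<longrightarrow> (\<exists>y. limitin S (\<lambda>s. the (x s)) y (at_left t)))}"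

definition D_loc :: "'a topology \<Rightarrow> (real \<Rightarrow> 'a option) set" where
  "D_loc S = {x \<in> D_exp S.
     0 < lifetime x \<and> lifetime x < \<infinity> \<and> compactly_contained S (trajectory x) \<longrightarrow>
       (\<exists>y. limitin S (\<lambda>s. the (x s)) y (at_left (real_of_ereal (lifetime x))))}"

definition Borel_sets :: "'b topology \<Rightarrow> 'b set set" where
  "Borel_sets T = sigma_sets (topspace T) {U. openin T U}"

definition canonical_sigma_algebra :: "'a topology \<Rightarrow> (real \<Rightarrow> 'a option) set set" where
  "canonical_sigma_algebra S = sigma_sets (D_loc S)
     {{x \<in> D_loc S. x s \<in> B} | s B. 0 \<le> s \<and> B \<in> Borel_sets (Alexandroff_compactification S)}"

text \<open>Only the values on \<open>{0..}\<close> of a time change are relevant; \<^const>\<open>local_lipschitz\<close> expects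
  a family of functions, here a constant one.\<close>

definition time_changes :: "(real \<Rightarrow> real) set" where
  "time_changes = {l. bij_betw l {0..} {0..} \<and> strict_mono_on {0..} l \<and>
     local_lipschitz {0::real} {0..} (\<lambda>_. l) \<and>
     local_lipschitz {0::real} {0..} (\<lambda>_. inv_into {0..} l)}"

text \<open>The Stieltjes measure of a time change is extended by \<open>0\<close> to the negative half-line. Suprema
  are taken in \<^typ>\<open>ennreal\<close>, where the supremum over the empty set is \<open>0\<close>.\<close>

definition time_change_measure :: "(real \<Rightarrow> real) \<Rightarrow> real measure" where
  "time_change_measure l = interval_measure (\<lambda>s. l (max 0 s))"

definition time_change_density :: "(real \<Rightarrow> real) \<Rightarrow> real \<Rightarrow> real" where
  "time_change_density l s = enn2real (RN_deriv lborel (time_change_measure l) s)"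

definition log_density_norm :: "(real \<Rightarrow> real) \<Rightarrow> real \<Rightarrow> ennreal" where
  "log_density_norm l t =
     esssup (restrict_space lborel {0..t}) (\<lambda>s. ennreal \<bar>ln (time_change_density l s)\<bar>)"

text \<open>Distances to \<open>\<Delta>\<close> are unspecified (\<open>the None\<close>); in both cases below the conditions on the
  life times exclude them from the suprema for large \<open>k\<close>.\<close>

definition local_Skorokhod_convergent ::
  "'a topology \<Rightarrow> ('a \<Rightarrow> 'a \<Rightarrow> real) \<Rightarrow> (nat \<Rightarrow> real \<Rightarrow> 'a option) \<Rightarrow> (real \<Rightarrow> 'a option) \<Rightarrow> bool"
  where
  "local_Skorokhod_convergent S d xs x \<longleftrightarrow>
    (\<exists>l. (\<forall>k. l k \<in> time_changes) \<and>
      (if lifetime x < \<infinity> \<and> compactly_contained S (trajectory x)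
       then let T = real_of_ereal (lifetime x) in
         (\<forall>\<^sub>F k in sequentially. ereal (l k T) \<le> lifetime (xs k)) \<and>
         (\<lambda>k. SUP s\<in>{0..<T}. ennreal (d (the (x s)) (the (xs k (l k s))))) \<longlonglongrightarrow> 0 \<and>
         limitin (Alexandroff_compactification S) (\<lambda>k. xs k (l k T)) None sequentially \<and>
         (\<lambda>k. log_density_norm (l k) T) \<longlonglongrightarrow> 0
       else \<forall>t\<ge>0. ereal t < lifetime x \<longrightarrow>
         (\<forall>\<^sub>F k in sequentially. ereal (l k t) < lifetime (xs k)) \<and>
         (\<lambda>k. SUP s\<in>{0..t}. ennreal (d (the (x s)) (the (xs k (l k s))))) \<longlonglongrightarrow> 0 \<and>
         (\<lambda>k. log_density_norm (l k) t) \<longlonglongrightarrow> 0))"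

definition Polish_space :: "'b topology \<Rightarrow> bool" where
  "Polish_space T \<longleftrightarrow> completely_metrizable_space T \<and> separable_space T"

definition is_local_Skorokhod_topology ::
  "'a topology \<Rightarrow> ('a \<Rightarrow> 'a \<Rightarrow> real) \<Rightarrow> (real \<Rightarrow> 'a option) topology \<Rightarrow> bool" where
  "is_local_Skorokhod_topology S d T \<longleftrightarrow>
     topspace T = D_loc S \<and> Polish_space T \<and>
     (\<forall>xs x. (\<forall>k. xs k \<in> D_loc S) \<and> x \<in> D_loc S \<longrightarrow>
        (limitin T xs x sequentially \<longleftrightarrow> local_Skorokhod_convergent S d xs x))"

definition local_Skorokhod_topology ::
  "'a topology \<Rightarrow> ('a \<Rightarrow> 'a \<Rightarrow> real) \<Rightarrow> (real \<Rightarrow> 'a option) topology" where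
  "local_Skorokhod_topology S d = (THE T. is_local_Skorokhod_topology S d T)"

definition metric_induces :: "('a \<Rightarrow> 'a \<Rightarrow> real) \<Rightarrow> 'a topology \<Rightarrow> bool" where
  "metric_induces d S \<longleftrightarrow> Metric_space (topspace S) d \<and> Metric_space.mtopology (topspace S) d = S"

text \<open>The essential supremum equals the supremum over the slopes of the time change
  (\<open>log_density_norm_eq_SUP\<close>). In particular the junk values \<open>enn2real \<infinity> = 0\<close> and \<open>ln 0 = 0\<close> in
  \<^const>\<open>log_density_norm\<close> only occur on null sets.\<close>

definition mono_continuous :: "(real \<Rightarrow> real) \<Rightarrow> bool" where
  "mono_continuous F \<longleftrightarrow> mono F \<and> continuous_on UNIV F"

lemma emeasure_interval_measure_cont: assumes "mono_continuous F" "a \<le> b" shows "emeasure (interval_measure F) {a<..b} = ennreal (F b - F a)"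
  using assms unfolding mono_continuous_def
  by (intro emeasure_interval_measure_Ioc)
     (auto simp: monoD continuous_on_eq_continuous_within intro: continuous_within_subset)

lemma interval_measure_eqI:
  assumes F: "mono_continuous F" and M: "sets M = sets borel"
    and eq: "\<And>a b. a \<le> b \<Longrightarrow> emeasure M {a<..b} = ennreal (F b - F a)"
  shows "M = interval_measure F"
proof (rule measure_eqI_generator_eq[where E="range (\<lambda>(a,b). {a<..b::real})" and \<Omega>=UNIV and A="\<lambda>n. {-real n<..real n}"])
  show "Int_stable (range (\<lambda>(a, b). {a<..b::real}))"
    by (auto simp: Int_stable_def)
  show "sets M = sigma_sets UNIV (range (\<lambda>(a, b). {a<..b}))"
    using M by (simp add: borel_sigma_sets_Ioc)
  show "sets (interval_measure F) = sigma_sets UNIV (range (\<lambda>(a, b). {a<..b}))"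
    by (simp add: borel_sigma_sets_Ioc)
  fix X assume "X \<in> range (\<lambda>(a, b). {a<..b::real})"
  then obtain a b where X: "X = {a<..b}" by auto
  show "emeasure M X = emeasure (interval_measure F) X"
    using eq[of a b] emeasure_interval_measure_cont[OF F, of a b] X by (cases "a \<le> b") auto
next
  show "(\<Union>i. {- real i<..real i}) = UNIV"
  proof (safe; simp)
    fix x :: real
    obtain n where "\<bar>x\<bar> < real n" using reals_Archimedean2 by blast
    then show "\<exists>n. - real n < x \<and> x \<le> real n" by (intro exI[of _ n]) auto
  qed
  show "emeasure M {- real i<..real i} \<noteq> \<infinity>" for i using eq[of "-real i" "real i"] by simp
qed auto

lemma interval_measure_add:
  assumes F: "mono_continuous F" and G: "mono_continuous G" and A: "A \<in> sets borel"
  shows "emeasure (interval_measure (\<lambda>x. F x + G x)) A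
    = emeasure (interval_measure F) A + emeasure (interval_measure G) A"
proof -
  define M where "M = measure_of UNIV (sets borel)
     (\<lambda>A. emeasure (interval_measure F) A + emeasure (interval_measure G) A)"
  have sM: "sets M = sets borel" unfolding M_def by (simp add: sets.sigma_sets_eq[of borel, simplified])
  have eM: "emeasure M A = emeasure (interval_measure F) A + emeasure (interval_measure G) A"
    if "A \<in> sets borel" for A
    unfolding M_def
  proof (rule emeasure_measure_of_sigma)
    show "sigma_algebra UNIV (sets borel)" using sets.sigma_algebra_axioms[of borel] by simp
    show "countably_additive (sets borel) (\<lambda>A. emeasure (interval_measure F) A + emeasure (interval_measure G) A)"
      by (auto simp: countably_additive_def suminf_add[symmetric] suminf_emeasure)
  qed (auto simp: positive_def that)
  have "M = interval_measure (\<lambda>x. F x + G x)"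
  proof (rule interval_measure_eqI)
    show "mono_continuous (\<lambda>x. F x + G x)" using F G by (auto simp: mono_continuous_def mono_def intro!: continuous_intros add_mono)
    fix a b :: real assume "a \<le> b"
    then show "emeasure M {a<..b} = ennreal (F b + G b - (F a + G a))"
      using F G by (subst eM) (auto simp: emeasure_interval_measure_cont mono_continuous_def mono_def ennreal_plus[symmetric] algebra_simps simp del: ennreal_plus)
  qed (rule sM)
  then show ?thesis using eM[OF A] by simp
qed

lemma interval_measure_local_mono:
  assumes F: "mono_continuous F" and G: "mono_continuous G" and A: "A \<in> sets borel" "A \<subseteq> {a<..b}" and ab: "a \<le> b"
    and le: "\<And>r s. a \<le> r \<Longrightarrow> r \<le> s \<Longrightarrow> s \<le> b \<Longrightarrow> G s - G r \<le> F s - F r"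
  shows "emeasure (interval_measure G) A \<le> emeasure (interval_measure F) A"
proof -
  define c where "c x = max a (min b x)" for x
  have c: "a \<le> c x" "c x \<le> b" for x using ab by (auto simp: c_def)
  have cmn: "x \<le> y \<Longrightarrow> c x \<le> c y" for x y by (auto simp: c_def)
  have cc: "continuous_on UNIV c" unfolding c_def by (intro continuous_intros)
  have cFc: "mono_continuous (\<lambda>x. H (c x))" if "mono_continuous H" for H
    using that cmn unfolding mono_continuous_def mono_def
    by (auto intro: continuous_on_compose2[OF _ cc])
  have rest: "mono_continuous (\<lambda>x. H x - H (c x))" if "mono_continuous H" for H
  proof -
    have "H x - H (c x) \<le> H y - H (c y)" if "x \<le> y" for x y
    proof -
      have "mono H" using \<open>mono_continuous H\<close> by (simp add: mono_continuous_def)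
      have "H a \<le> H b" "H x \<le> H y" using monoD[OF \<open>mono H\<close>] ab that by auto
      moreover have "x \<le> a \<Longrightarrow> H x \<le> H a" "y \<le> a \<Longrightarrow> H y \<le> H a" "a \<le> y \<Longrightarrow> H a \<le> H y" "b \<le> y \<Longrightarrow> H b \<le> H y"
         "x \<le> b \<Longrightarrow> H x \<le> H b" using monoD[OF \<open>mono H\<close>] by auto
      ultimately show ?thesis using that ab unfolding c_def max_def min_def by (auto split: if_splits)
    qed
    then show ?thesis using that cFc[OF that] unfolding mono_continuous_def mono_def by (auto intro!: continuous_intros)
  qed
  have dif: "mono_continuous (\<lambda>x. F (c x) - G (c x))"
    using cFc[OF F] cFc[OF G] le[OF c(1) cmn c(2)] unfolding mono_continuous_def mono_def
    by (auto intro!: continuous_intros simp: algebra_simps)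
  have zero: "emeasure (interval_measure (\<lambda>x. G x - G (c x))) A = 0"
  proof -
    have "emeasure (interval_measure (\<lambda>x. G x - G (c x))) A \<le> emeasure (interval_measure (\<lambda>x. G x - G (c x))) {a<..b}"
      using A by (intro emeasure_mono) auto
    also have "\<dots> = 0" using ab by (subst emeasure_interval_measure_cont[OF rest[OF G]]) (auto simp: c_def)
    finally show ?thesis by simp
  qed
  have "emeasure (interval_measure G) A = emeasure (interval_measure (\<lambda>x. G (c x))) A"
    using interval_measure_add[OF cFc[OF G] rest[OF G] A(1)] zero by simp
  also have "\<dots> \<le> emeasure (interval_measure (\<lambda>x. F (c x))) A"
    using interval_measure_add[OF cFc[OF G] dif A(1)] by simp
  also have "\<dots> \<le> emeasure (interval_measure F) A"
    using interval_measure_add[OF cFc[OF F] rest[OF F] A(1)] by simp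
  finally show ?thesis .
qed

lemma interval_measure_scale:
  assumes c: "0 \<le> c" and A: "A \<in> sets borel"
  shows "emeasure (interval_measure (\<lambda>x. c * x)) A = ennreal c * emeasure lborel A"
proof -
  have "density lborel (\<lambda>_. ennreal c) = interval_measure (\<lambda>x. c * x)"
    using c by (intro interval_measure_eqI)
      (auto simp: mono_continuous_def mono_def mult_left_mono emeasure_density_const ennreal_mult[symmetric] right_diff_distrib intro!: continuous_intros)
  then show ?thesis using A by (metis emeasure_density_const sets_lborel)
qed

lemma mono_continuous_scale: "0 \<le> c \<Longrightarrow> mono_continuous (\<lambda>x. c * x)"
  by (auto simp: mono_continuous_def mono_def mult_left_mono intro!: continuous_intros)

context
  fixes l assumes l: "l \<in> time_changes"
begin

lemma time_change_0: "l 0 = 0"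
proof -
  have b: "bij_betw l {0..} {0..}" and m: "strict_mono_on {0..} l" using l by (auto simp: time_changes_def)
  obtain s where s: "s \<ge> 0" "l s = 0" using b unfolding bij_betw_def by (metis atLeast_iff imageE order_refl)
  have "l 0 \<ge> 0" using b by (auto simp: bij_betw_def)
  moreover have "l 0 \<le> l s" using s m by (meson atLeast_iff order_refl strict_mono_on_leD)
  ultimately show ?thesis using s by simp
qed

lemma time_change_less: "0 \<le> r \<Longrightarrow> r < s \<Longrightarrow> l r < l s"
  using l by (auto simp: time_changes_def strict_mono_on_def)

lemma mono_continuous_time_change: "mono_continuous (\<lambda>s. l (max 0 s))"
proof -
  have "local_lipschitz {0::real} {0..} (\<lambda>_. l)" using l by (auto simp: time_changes_def)
  from local_lipschitz_continuous_on[OF this] have "continuous_on {0..} l" by auto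
  then have "continuous_on UNIV (\<lambda>s. l (max 0 s))"
    by (rule continuous_on_compose2) (auto intro!: continuous_intros)
  moreover have "mono (\<lambda>s. l (max 0 s))"
    by (auto simp: mono_def max_def le_less time_change_less)
  ultimately show ?thesis by (simp add: mono_continuous_def)
qed

lemma time_change_slope_upper: "\<exists>L\<ge>0. \<forall>r s. 0 \<le> r \<longrightarrow> r \<le> s \<longrightarrow> s \<le> t \<longrightarrow> l s - l r \<le> L * (s - r)"
proof -
  have "local_lipschitz {0::real} {0..} (\<lambda>_. l)" using l by (auto simp: time_changes_def)
  then have ll: "local_lipschitz {0::real} {0..t} (\<lambda>_. l)" by (rule local_lipschitz_subset) auto
  obtain L where L: "L-lipschitz_on {0..t} l"
    using local_lipschitz_compact_implies_lipschitz[OF ll compact_Icc] by auto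
  have "l s - l r \<le> L * (s - r)" if "0 \<le> r" "r \<le> s" "s \<le> t" for r s
    using lipschitz_onD[OF L, of s r] that by (auto simp: dist_real_def)
  then show ?thesis using lipschitz_on_nonneg[OF L] by blast
qed

lemma time_change_slope_lower: "\<exists>m>0. \<forall>r s. 0 \<le> r \<longrightarrow> r \<le> s \<longrightarrow> s \<le> t \<longrightarrow> m * (s - r) \<le> l s - l r"
proof -
  have b: "bij_betw l {0..} {0..}" using l by (auto simp: time_changes_def)
  let ?i = "inv_into {0..} l"
  have "local_lipschitz {0::real} {0..} (\<lambda>_. ?i)" using l by (auto simp: time_changes_def)
  then have ll: "local_lipschitz {0::real} {0..l t} (\<lambda>_. ?i)" by (rule local_lipschitz_subset) auto
  obtain L where L: "L-lipschitz_on {0..l t} ?i"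
    using local_lipschitz_compact_implies_lipschitz[OF ll compact_Icc] by auto
  have L0: "0 \<le> L" using lipschitz_on_nonneg[OF L] .
  have "1 / (L+1) * (s - r) \<le> l s - l r" if "0 \<le> r" "r \<le> s" "s \<le> t" for r s
  proof -
    have i: "?i (l r) = r" "?i (l s) = s" using b that by (auto simp: bij_betw_def inv_into_f_f)
    have ll: "0 \<le> l r" "l r \<le> l s" "l s \<le> l t"
      using b that time_change_less[of r s] time_change_less[of s t] by (auto simp: bij_betw_def le_less)
    have "s - r \<le> L * (l s - l r)"
      using lipschitz_onD[OF L, of "l s" "l r"] that ll by (auto simp: dist_real_def i)
    also have "\<dots> \<le> (L+1) * (l s - l r)" using ll L0 by (intro mult_right_mono) auto
    finally show ?thesis using L0 by (simp add: field_simps)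
  qed
  then show ?thesis using L0 by (intro exI[of _ "1/(L+1)"]) auto
qed

lemma time_change_measure_le:
  assumes M: "0 \<le> M" "\<forall>r s. 0 \<le> r \<longrightarrow> r \<le> s \<longrightarrow> s \<le> t \<longrightarrow> l s - l r \<le> M * (s - r)"
    and A: "A \<in> sets borel" "A \<subseteq> {0<..t}"
  shows "emeasure (time_change_measure l) A \<le> ennreal M * emeasure lborel A"
proof (cases "0 \<le> t")
  case True
  have "emeasure (interval_measure (\<lambda>s. l (max 0 s))) A \<le> emeasure (interval_measure (\<lambda>x. M * x)) A"
    using M by (intro interval_measure_local_mono[OF mono_continuous_scale[OF M(1)] mono_continuous_time_change A True]) (auto simp: algebra_simps max_def)
  then show ?thesis by (simp add: time_change_measure_def interval_measure_scale M A)
qed (use A in auto)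

lemma time_change_measure_ge:
  assumes M: "0 \<le> M" "\<forall>r s. 0 \<le> r \<longrightarrow> r \<le> s \<longrightarrow> s \<le> t \<longrightarrow> M * (s - r) \<le> l s - l r"
    and A: "A \<in> sets borel" "A \<subseteq> {0<..t}"
  shows "ennreal M * emeasure lborel A \<le> emeasure (time_change_measure l) A"
proof (cases "0 \<le> t")
  case True
  have "emeasure (interval_measure (\<lambda>x. M * x)) A \<le> emeasure (interval_measure (\<lambda>s. l (max 0 s))) A"
    using M by (intro interval_measure_local_mono[OF mono_continuous_time_change mono_continuous_scale[OF M(1)] A True]) (auto simp: algebra_simps max_def)
  then show ?thesis by (simp add: time_change_measure_def interval_measure_scale M A)
qed (use A in auto)

lemma time_change_measure_atMost_0: "A \<in> sets borel \<Longrightarrow> A \<subseteq> {..0} \<Longrightarrow> emeasure (time_change_measure l) A = 0"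
proof -
  assume A: "A \<in> sets borel" "A \<subseteq> {..0}"
  have *: "emeasure (time_change_measure l) {-real n<..0} = 0" for n
    unfolding time_change_measure_def by (subst emeasure_interval_measure_cont[OF mono_continuous_time_change]) auto
  have "(\<Union>n. {-real n<..0}) = {..0}"
  proof (safe; simp)
    fix x :: real
    obtain n where "\<bar>x\<bar> < real n" using reals_Archimedean2 by blast
    then show "\<exists>n. - real n < x" by (intro exI[of _ n]) auto
  qed
  moreover have "emeasure (time_change_measure l) (\<Union>n. {-real n<..0}) = 0"
    using * by (intro emeasure_UN_eq_0) (auto simp: time_change_measure_def)
  ultimately have "emeasure (time_change_measure l) {..0} = 0" by simp
  then show ?thesis using A by (metis emeasure_mono le_zero_eq sets_interval_measure time_change_measure_def atMost_borel)
qed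

lemma absolutely_continuous_time_change: "absolutely_continuous lborel (time_change_measure l)"
  unfolding absolutely_continuous_def
proof
  fix A :: "real set" assume "A \<in> null_sets lborel"
  then have A: "A \<in> sets borel" "emeasure lborel A = 0" by (auto simp: null_sets_def)
  have *: "emeasure (time_change_measure l) (A \<inter> {0<..real n}) = 0" for n
  proof -
    obtain L where L: "L \<ge> 0" "\<forall>r s. 0 \<le> r \<longrightarrow> r \<le> s \<longrightarrow> s \<le> real n \<longrightarrow> l s - l r \<le> L * (s - r)"
      using time_change_slope_upper by blast
    have "emeasure (time_change_measure l) (A \<inter> {0<..real n}) \<le> ennreal L * emeasure lborel (A \<inter> {0<..real n})"
      using A by (intro time_change_measure_le[OF L]) auto
    also have "emeasure lborel (A \<inter> {0<..real n}) = 0"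
      using A by (metis emeasure_mono inf_le1 le_zero_eq sets_lborel)
    finally show ?thesis by simp
  qed
  have 1: "emeasure (time_change_measure l) (\<Union>n. A \<inter> {0<..real n}) = 0"
    using * A by (intro emeasure_UN_eq_0) (auto simp: time_change_measure_def)
  have 2: "emeasure (time_change_measure l) (A \<inter> {..0}) = 0" using A by (intro time_change_measure_atMost_0) auto
  have eq: "A = (\<Union>n. A \<inter> {0<..real n}) \<union> (A \<inter> {..0})"
    using real_arch_simple by force
  have "emeasure (time_change_measure l) A = 0" using 1 2 A
    by (subst eq, subst emeasure_Un_null_set) (auto simp: null_sets_def time_change_measure_def)
  then show "A \<in> null_sets (time_change_measure l)" using A by (auto simp: null_sets_def time_change_measure_def)
qed

lemma emeasure_time_change_measure: "A \<in> sets borel \<Longrightarrow> emeasure (time_change_measure l) A = (\<integral>\<^sup>+x\<in>A. RN_deriv lborel (time_change_measure l) x \<partial>lborel)"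
proof -
  assume A: "A \<in> sets borel"
  have "density lborel (RN_deriv lborel (time_change_measure l)) = (time_change_measure l)" using absolutely_continuous_time_change by (intro sigma_finite_measure.density_RN_deriv[OF sigma_finite_lborel]) (auto simp: time_change_measure_def)
  then show ?thesis using A by (metis emeasure_density borel_measurable_RN_deriv sets_lborel)
qed

lemma AE_time_change_density_le:
  assumes M: "0 \<le> M" "\<forall>r s. 0 \<le> r \<longrightarrow> r \<le> s \<longrightarrow> s \<le> t \<longrightarrow> l s - l r \<le> M * (s - r)"
  shows "AE s in lborel. s \<in> {0<..t} \<longrightarrow> RN_deriv lborel (time_change_measure l) s \<le> ennreal M"
proof -
  let ?A = "{s\<in>{0<..t}. ennreal M < RN_deriv lborel (time_change_measure l) s}"
  have [measurable]: "?A \<in> sets borel" by measurable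
  have fin: "emeasure lborel ?A < \<infinity>"
    by (rule le_less_trans[OF emeasure_mono[of _ "{0..t}"]]) (auto simp: emeasure_lborel_Icc_eq)
  have m2: "ennreal M * emeasure lborel ?A < top"
    using fin by (auto simp: ennreal_mult_less_top)
  have m1: "(\<integral>\<^sup>+x. ennreal M * indicator ?A x \<partial>lborel) = ennreal M * emeasure lborel ?A"
    by (rule nn_integral_cmult_indicator) simp
  have Mfin: "(\<integral>\<^sup>+x. ennreal M * indicator ?A x \<partial>lborel) < top" "ennreal M * emeasure lborel ?A < top"
    using m2 unfolding m1 by blast+
  have "(\<integral>\<^sup>+x. (RN_deriv lborel (time_change_measure l) x - ennreal M) * indicator ?A x \<partial>lborel)
     = (\<integral>\<^sup>+x. RN_deriv lborel (time_change_measure l) x * indicator ?A x - ennreal M * indicator ?A x \<partial>lborel)"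
    by (intro nn_integral_cong) (auto simp: indicator_def)
  also have "\<dots> = (\<integral>\<^sup>+x. RN_deriv lborel (time_change_measure l) x * indicator ?A x \<partial>lborel) - (\<integral>\<^sup>+x. ennreal M * indicator ?A x \<partial>lborel)"
    using Mfin by (intro nn_integral_diff) (auto simp: indicator_def)
  also have "\<dots> = emeasure (time_change_measure l) ?A - ennreal M * emeasure lborel ?A"
    by (subst emeasure_time_change_measure) (auto simp: nn_integral_cmult)
  also have "\<dots> = 0"
  proof -
    have "emeasure (time_change_measure l) ?A \<le> ennreal M * emeasure lborel ?A" by (intro time_change_measure_le[OF M]) auto
    moreover from this have "emeasure (time_change_measure l) ?A < top" using Mfin(2) by (rule le_less_trans)
    ultimately show ?thesis by (simp only: diff_eq_0_ennreal)
  qed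
  finally have "AE x in lborel. (RN_deriv lborel (time_change_measure l) x - ennreal M) * indicator ?A x = 0"
    by (subst (asm) nn_integral_0_iff_AE) auto
  then show ?thesis
  proof eventually_elim
    fix x assume "(RN_deriv lborel (time_change_measure l) x - ennreal M) * indicator ?A x = 0"
    then show "x \<in> {0<..t} \<longrightarrow> RN_deriv lborel (time_change_measure l) x \<le> ennreal M"
      by (cases "ennreal M < RN_deriv lborel (time_change_measure l) x") (auto simp: indicator_def ennreal_minus_eq_0 not_less split: if_splits)
  qed
qed

lemma AE_time_change_density_ge:
  assumes M: "0 \<le> M" "\<forall>r s. 0 \<le> r \<longrightarrow> r \<le> s \<longrightarrow> s \<le> t \<longrightarrow> M * (s - r) \<le> l s - l r"
  shows "AE s in lborel. s \<in> {0<..t} \<longrightarrow> ennreal M \<le> RN_deriv lborel (time_change_measure l) s"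
proof -
  let ?A = "{s\<in>{0<..t}. RN_deriv lborel (time_change_measure l) s < ennreal M}"
  have [measurable]: "?A \<in> sets borel" by measurable
  have fin: "emeasure lborel ?A < \<infinity>"
    by (rule le_less_trans[OF emeasure_mono[of _ "{0..t}"]]) (auto simp: emeasure_lborel_Icc_eq)
  have Mfin: "ennreal M * emeasure lborel ?A < top"
    using fin by (auto simp: ennreal_mult_less_top)
  have Nfin: "(\<integral>\<^sup>+x. RN_deriv lborel (time_change_measure l) x * indicator ?A x \<partial>lborel) < \<infinity>"
  proof (rule le_less_trans)
    show "(\<integral>\<^sup>+x. RN_deriv lborel (time_change_measure l) x * indicator ?A x \<partial>lborel) \<le> (\<integral>\<^sup>+x. ennreal M * indicator ?A x \<partial>lborel)"
      by (intro nn_integral_mono) (auto simp: indicator_def)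
    show "\<dots> < \<infinity>" using fin by (auto simp: nn_integral_cmult ennreal_mult_less_top)
  qed
  have "(\<integral>\<^sup>+x. (ennreal M - RN_deriv lborel (time_change_measure l) x) * indicator ?A x \<partial>lborel)
     = (\<integral>\<^sup>+x. ennreal M * indicator ?A x - RN_deriv lborel (time_change_measure l) x * indicator ?A x \<partial>lborel)"
    by (intro nn_integral_cong) (auto simp: indicator_def)
  also have "\<dots> = (\<integral>\<^sup>+x. ennreal M * indicator ?A x \<partial>lborel) - (\<integral>\<^sup>+x. RN_deriv lborel (time_change_measure l) x * indicator ?A x \<partial>lborel)"
    using Nfin by (intro nn_integral_diff) (auto simp: indicator_def)
  also have "\<dots> = ennreal M * emeasure lborel ?A - emeasure (time_change_measure l) ?A"
    by (subst emeasure_time_change_measure) (auto simp: nn_integral_cmult)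
  also have "\<dots> = 0"
  proof -
    have "ennreal M * emeasure lborel ?A \<le> emeasure (time_change_measure l) ?A" by (intro time_change_measure_ge[OF M]) auto
    then show ?thesis using Mfin by (simp only: diff_eq_0_ennreal)
  qed
  finally have "AE x in lborel. (ennreal M - RN_deriv lborel (time_change_measure l) x) * indicator ?A x = 0"
    by (subst (asm) nn_integral_0_iff_AE) auto
  then show ?thesis
  proof eventually_elim
    fix x assume "(ennreal M - RN_deriv lborel (time_change_measure l) x) * indicator ?A x = 0"
    then show "x \<in> {0<..t} \<longrightarrow> ennreal M \<le> RN_deriv lborel (time_change_measure l) x"
      by (cases "RN_deriv lborel (time_change_measure l) x < ennreal M") (auto simp: indicator_def ennreal_minus_eq_0 not_less split: if_splits)
  qed
qed

lemma time_change_slope_bounds: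
  assumes c: "0 \<le> a" "a \<le> b" "0 \<le> r" "r \<le> s"
    and ae: "AE x in lborel. x \<in> {r<..s} \<longrightarrow> ennreal a \<le> RN_deriv lborel (time_change_measure l) x \<and> RN_deriv lborel (time_change_measure l) x \<le> ennreal b"
  shows "a * (s - r) \<le> l s - l r" "l s - l r \<le> b * (s - r)"
proof -
  have Nrs: "emeasure (time_change_measure l) {r<..s} = ennreal (l s - l r)"
    using c unfolding time_change_measure_def by (subst emeasure_interval_measure_cont[OF mono_continuous_time_change]) auto
  have ge: "0 \<le> l s - l r" using time_change_less[of r s] c by (cases "r = s") auto
  have "ennreal (a * (s - r)) = (\<integral>\<^sup>+x\<in>{r<..s}. ennreal a \<partial>lborel)"
    using c by (simp add: nn_integral_cmult ennreal_mult)
  also have "\<dots> \<le> (\<integral>\<^sup>+x\<in>{r<..s}. RN_deriv lborel (time_change_measure l) x \<partial>lborel)"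
    using ae by (intro nn_integral_mono_AE) (auto simp: indicator_def elim!: eventually_mono)
  also have "\<dots> = ennreal (l s - l r)" using emeasure_time_change_measure[of "{r<..s}"] Nrs by simp
  finally show "a * (s - r) \<le> l s - l r" using ge by simp
  have "ennreal (l s - l r) = (\<integral>\<^sup>+x\<in>{r<..s}. RN_deriv lborel (time_change_measure l) x \<partial>lborel)" using emeasure_time_change_measure[of "{r<..s}"] Nrs by simp
  also have "\<dots> \<le> (\<integral>\<^sup>+x\<in>{r<..s}. ennreal b \<partial>lborel)"
    using ae by (intro nn_integral_mono_AE) (auto simp: indicator_def elim!: eventually_mono)
  also have "\<dots> = ennreal (b * (s - r))"
    using c by (simp add: nn_integral_cmult ennreal_mult)
  finally show "l s - l r \<le> b * (s - r)" using c by (simp add: ennreal_le_iff)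
qed

lemma abs_ln_le_iff_exp: "0 < u \<Longrightarrow> \<bar>ln u\<bar> \<le> c \<longleftrightarrow> exp (-c) \<le> u \<and> u \<le> exp (c::real)"
  by (metis abs_le_iff exp_le_cancel_iff exp_ln minus_le_iff)

lemma log_density_norm_le_iff:
  assumes c: "0 \<le> c"
  shows "log_density_norm l t \<le> ennreal c \<longleftrightarrow>
    (AE s in lborel. s \<in> {0<..t} \<longrightarrow> ennreal (exp (-c)) \<le> RN_deriv lborel (time_change_measure l) s \<and> RN_deriv lborel (time_change_measure l) s \<le> ennreal (exp c))"
proof -
  let ?M = "restrict_space lborel {0..t}"
  let ?g = "\<lambda>s. ennreal \<bar>ln (time_change_density l s)\<bar>"
  have m: "?g \<in> borel_measurable ?M"
    unfolding time_change_density_def by (intro measurable_restrict_space1) measurable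
  have "log_density_norm l t \<le> ennreal c \<longleftrightarrow> (AE s in ?M. ?g s \<le> ennreal c)"
    unfolding log_density_norm_def
    using esssup_AE[of ?g ?M] esssup_I[OF m, of "ennreal c"]
    by (auto elim: eventually_mono order_trans)
  also have "\<dots> \<longleftrightarrow> (AE s in lborel. s \<in> {0..t} \<longrightarrow> \<bar>ln (enn2real (RN_deriv lborel (time_change_measure l) s))\<bar> \<le> c)"
    using c by (subst AE_restrict_space_iff) (auto simp: time_change_density_def ennreal_le_iff)
  also have "\<dots> \<longleftrightarrow> (AE s in lborel. s \<in> {0<..t} \<longrightarrow> ennreal (exp (-c)) \<le> RN_deriv lborel (time_change_measure l) s \<and> RN_deriv lborel (time_change_measure l) s \<le> ennreal (exp c))"
  proof -
    obtain M where M: "0 \<le> M" "\<forall>r s. 0 \<le> r \<longrightarrow> r \<le> s \<longrightarrow> s \<le> t \<longrightarrow> l s - l r \<le> M * (s - r)" using time_change_slope_upper by blast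
    obtain a where a: "0 < a" "\<forall>r s. 0 \<le> r \<longrightarrow> r \<le> s \<longrightarrow> s \<le> t \<longrightarrow> a * (s - r) \<le> l s - l r" using time_change_slope_lower by blast
    have ae: "AE s in lborel. s \<noteq> (0::real)" by (rule AE_lborel_singleton)
    have "AE s in lborel. (s \<in> {0..t} \<longrightarrow> \<bar>ln (enn2real (RN_deriv lborel (time_change_measure l) s))\<bar> \<le> c) \<longleftrightarrow>
        (s \<in> {0<..t} \<longrightarrow> ennreal (exp (-c)) \<le> RN_deriv lborel (time_change_measure l) s \<and> RN_deriv lborel (time_change_measure l) s \<le> ennreal (exp c))"
      using ae AE_time_change_density_le[OF M] AE_time_change_density_ge[OF less_imp_le[OF a(1)] a(2)]
    proof eventually_elim
      fix s :: real assume s: "s \<noteq> 0" "s \<in> {0<..t} \<longrightarrow> RN_deriv lborel (time_change_measure l) s \<le> ennreal M" "s \<in> {0<..t} \<longrightarrow> ennreal a \<le> RN_deriv lborel (time_change_measure l) s"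
      show "(s \<in> {0..t} \<longrightarrow> \<bar>ln (enn2real (RN_deriv lborel (time_change_measure l) s))\<bar> \<le> c) \<longleftrightarrow>
        (s \<in> {0<..t} \<longrightarrow> ennreal (exp (-c)) \<le> RN_deriv lborel (time_change_measure l) s \<and> RN_deriv lborel (time_change_measure l) s \<le> ennreal (exp c))"
      proof (cases "s \<in> {0<..t}")
        case True
        then have fs: "ennreal a \<le> RN_deriv lborel (time_change_measure l) s" "RN_deriv lborel (time_change_measure l) s \<le> ennreal M" using s by auto
        then obtain u where u: "RN_deriv lborel (time_change_measure l) s = ennreal u" "0 \<le> u"
          by (metis ennreal_cases ennreal_less_top not_less top.extremum_uniqueI infinity_ennreal_def neq_top_trans ennreal_neq_top)
        have "0 < u" using fs a u by auto
        then show ?thesis using True u abs_ln_le_iff_exp[of u c] by (auto simp: ennreal_le_iff)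
      qed (use s in auto)
    qed
    then show ?thesis by (intro iffI) (auto elim: eventually_elim2)
  qed
  finally show ?thesis .
qed

lemma SUP_slope_le_iff:
  assumes c: "0 \<le> c"
  shows "(SUP (r, s)\<in>{(r, s). 0 \<le> r \<and> r < s \<and> s \<le> t}. ennreal \<bar>ln ((l s - l r) / (s - r))\<bar>) \<le> ennreal c \<longleftrightarrow>
    (\<forall>r s. 0 \<le> r \<longrightarrow> r \<le> s \<longrightarrow> s \<le> t \<longrightarrow> exp (-c) * (s - r) \<le> l s - l r \<and> l s - l r \<le> exp c * (s - r))"
proof -
  have 1: "ennreal \<bar>ln ((l s - l r) / (s - r))\<bar> \<le> ennreal c \<longleftrightarrow>
     exp (-c) * (s - r) \<le> l s - l r \<and> l s - l r \<le> exp c * (s - r)" if "0 \<le> r" "r < s" for r s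
    using time_change_less[OF that] that c
    by (simp only: ennreal_le_iff[OF c]) (subst abs_ln_le_iff_exp, auto simp: divide_simps)
  have "(SUP (r, s)\<in>{(r, s). 0 \<le> r \<and> r < s \<and> s \<le> t}. ennreal \<bar>ln ((l s - l r) / (s - r))\<bar>) \<le> ennreal c \<longleftrightarrow>
    (\<forall>r s. 0 \<le> r \<longrightarrow> r < s \<longrightarrow> s \<le> t \<longrightarrow> ennreal \<bar>ln ((l s - l r) / (s - r))\<bar> \<le> ennreal c)"
    by (auto simp: SUP_le_iff)
  also have "\<dots> \<longleftrightarrow> (\<forall>r s. 0 \<le> r \<longrightarrow> r < s \<longrightarrow> s \<le> t \<longrightarrow> exp (-c) * (s - r) \<le> l s - l r \<and> l s - l r \<le> exp c * (s - r))"
    using 1 by blast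
  also have "\<dots> \<longleftrightarrow> (\<forall>r s. 0 \<le> r \<longrightarrow> r \<le> s \<longrightarrow> s \<le> t \<longrightarrow> exp (-c) * (s - r) \<le> l s - l r \<and> l s - l r \<le> exp c * (s - r))"
    by (metis cancel_comm_monoid_add_class.diff_cancel mult_zero_right order_le_less order_refl)
  finally show ?thesis .
qed

lemma log_density_norm_eq_SUP:
  "log_density_norm l t =
     (SUP (r, s)\<in>{(r, s). 0 \<le> r \<and> r < s \<and> s \<le> t}. ennreal \<bar>ln ((l s - l r) / (s - r))\<bar>)" (is "?L = ?R")
proof -
  have iff: "?L \<le> ennreal c \<longleftrightarrow> ?R \<le> ennreal c" if c: "0 \<le> c" for c
    unfolding log_density_norm_le_iff[OF c] SUP_slope_le_iff[OF c]
  proof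
    assume ae: "AE s in lborel. s \<in> {0<..t} \<longrightarrow> ennreal (exp (-c)) \<le> RN_deriv lborel (time_change_measure l) s \<and> RN_deriv lborel (time_change_measure l) s \<le> ennreal (exp c)"
    show "\<forall>r s. 0 \<le> r \<longrightarrow> r \<le> s \<longrightarrow> s \<le> t \<longrightarrow> exp (-c) * (s - r) \<le> l s - l r \<and> l s - l r \<le> exp c * (s - r)"
    proof (intro allI impI)
      fix r s assume rs: "0 \<le> r" "r \<le> s" "s \<le> t"
      have "AE x in lborel. x \<in> {r<..s} \<longrightarrow> ennreal (exp (-c)) \<le> RN_deriv lborel (time_change_measure l) x \<and> RN_deriv lborel (time_change_measure l) x \<le> ennreal (exp c)"
        using ae by eventually_elim (use rs in auto)
      from time_change_slope_bounds[OF _ _ rs(1,2) this] c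
      show "exp (-c) * (s - r) \<le> l s - l r \<and> l s - l r \<le> exp c * (s - r)" by auto
    qed
  next
    assume *: "\<forall>r s. 0 \<le> r \<longrightarrow> r \<le> s \<longrightarrow> s \<le> t \<longrightarrow> exp (-c) * (s - r) \<le> l s - l r \<and> l s - l r \<le> exp c * (s - r)"
    have "AE s in lborel. s \<in> {0<..t} \<longrightarrow> RN_deriv lborel (time_change_measure l) s \<le> ennreal (exp c)"
      using * by (intro AE_time_change_density_le) auto
    moreover have "AE s in lborel. s \<in> {0<..t} \<longrightarrow> ennreal (exp (-c)) \<le> RN_deriv lborel (time_change_measure l) s"
      using * by (intro AE_time_change_density_ge) auto
    ultimately show "AE s in lborel. s \<in> {0<..t} \<longrightarrow> ennreal (exp (-c)) \<le> RN_deriv lborel (time_change_measure l) s \<and> RN_deriv lborel (time_change_measure l) s \<le> ennreal (exp c)"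
      by eventually_elim auto
  qed
  have le: "a \<le> b" if "\<And>c. 0 \<le> c \<Longrightarrow> a \<le> ennreal c \<longleftrightarrow> b \<le> ennreal c" for a b
    using that by (cases b) auto
  show ?thesis
    by (intro antisym le) (simp_all only: iff)
qed

end

end

theory Submission
  imports Defs
begin

text \<open>
  The topology is that of an explicit metric. Choose a metric \<open>d\<close> for \<open>S\<close> together with a \<open>1\<close>-Lipschitz
  function \<open>g \<ge> 0\<close> with compact sublevel sets. Two paths \<open>x\<close>, \<open>y\<close> are \<open>e\<close>-close if for some time
  change \<open>l\<close> with slopes in \<open>[exp (-e), exp e]\<close> and some time \<open>t\<close> one has \<open>d (x s) (y (l s)) \<le> e\<close> for
  \<open>s < t\<close>, while at the stopping times \<open>t\<close> (for \<open>x\<close>) and \<open>l t\<close> (for \<open>y\<close>) the path is dead, or \<open>g\<close> or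
  the time is at least about \<open>1 / e\<close>. The infimum of these \<open>e\<close> satisfies the triangle inequality: two
  time changes are composed up to the earlier of their stopping times, where the comparison that is
  still running transfers the bound to the third path.

  For completeness, stop each path of a fast Cauchy sequence when it first exceeds a threshold size.
  The infinite compositions of the time changes converge, and in the common time scale so obtained the
  paths converge uniformly up to the limits of the stopping times. Separability and the measurability
  of open sets both follow by approximating a path by step paths on the grid \<open>\<int> / n\<close> with values in a
  countable dense set.
\<close>

section \<open>Time changes with controlled slopes\<close>

text \<open>Convergence has two cases: for death inside a compact set the approximating paths must
  approach \<Delta> at the corresponding time, while for escape or infinite life only earlier times
  are compared. The condition at the stopping time merges them: before the death of a confined path
  its reciprocal size is bounded below, so a good comparison lasts exactly up to the death; any
  other path reaches arbitrarily small reciprocal sizes alive, and the comparison may stop there.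
  Sizes enter as 1 / (1 + g) and 1 / (1 + s) because these move by at most e under an e-close
  comparison, although the time s itself may be displaced by a multiple of s. Hence errors add
  exactly. Logarithms of slopes add under composition and, unlike displacements, keep limits of time
  changes bijective, as completeness needs. The metric of the statement need not be complete; it may
  be replaced because x stays in a compact set up to the times that matter, and two metrics are
  uniformly comparable near a compact set. Uniqueness holds since metrizable topologies are
  determined by their convergent sequences.\<close>

text \<open>The bound is required on the whole half-line, so that infinitely many time changes can be composed.
  A bound up to time \<open>t\<close> is enough by \<open>time_change_log_slopes_le\<close>.\<close>

definition log_slopes_le :: "real \<Rightarrow> (real \<Rightarrow> real) \<Rightarrow> bool" where
  "log_slopes_le e l \<longleftrightarrow> l 0 = 0 \<and>
     (\<forall>r s. 0 \<le> r \<longrightarrow> r \<le> s \<longrightarrow> exp (-e) * (s - r) \<le> l s - l r \<and> l s - l r \<le> exp e * (s - r))"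

lemma log_slopes_leD:
  assumes "log_slopes_le e l"
  shows "l 0 = 0"
    and "\<And>r s. 0 \<le> r \<Longrightarrow> r \<le> s \<Longrightarrow> exp (-e) * (s - r) \<le> l s - l r"
    and "\<And>r s. 0 \<le> r \<Longrightarrow> r \<le> s \<Longrightarrow> l s - l r \<le> exp e * (s - r)"
  using assms by (auto simp: log_slopes_le_def)

lemma log_slopes_le_mono:
  assumes "log_slopes_le e l" "e \<le> e'"
  shows "log_slopes_le e' l"
  unfolding log_slopes_le_def
proof (intro conjI allI impI)
  fix r s :: real assume rs: "0 \<le> r" "r \<le> s"
  have "exp (-e') * (s - r) \<le> exp (-e) * (s - r)" "exp e * (s - r) \<le> exp e' * (s - r)"
    using assms(2) rs by (auto intro!: mult_right_mono)
  then show "exp (-e') * (s - r) \<le> l s - l r" "l s - l r \<le> exp e' * (s - r)"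
    using log_slopes_leD(2,3)[OF assms(1) rs] by linarith+
qed (use assms in \<open>auto simp: log_slopes_le_def\<close>)

lemma log_slopes_le_id: "0 \<le> e \<Longrightarrow> log_slopes_le e (\<lambda>s. s)"
  
  using mult_right_mono[of "exp (-e)" 1] mult_right_mono[of 1 "exp e"] by (simp add: log_slopes_le_def)

lemma log_slopes_le_strict_mono:
  assumes "log_slopes_le e l" "0 \<le> r" "r < s"
  shows "l r < l s"
  using log_slopes_leD(2)[OF assms(1,2), of s] assms(3)
  by (smt (verit) exp_gt_zero mult_pos_pos)

lemma log_slopes_le_less_iff:
  assumes "log_slopes_le e l" "0 \<le> r" "0 \<le> s"
  shows "l r < l s \<longleftrightarrow> r < s" and "l r \<le> l s \<longleftrightarrow> r \<le> s"
  using log_slopes_le_strict_mono[OF assms(1)] assms(2,3)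
  by (smt (verit, best))+

lemma log_slopes_le_nonneg: "log_slopes_le e l \<Longrightarrow> 0 \<le> s \<Longrightarrow> 0 \<le> l s"
  using log_slopes_le_less_iff(2)[of e l 0 s] log_slopes_leD(1)[of e l] by simp

lemma log_slopes_le_upper: "log_slopes_le e l \<Longrightarrow> 0 \<le> s \<Longrightarrow> l s \<le> exp e * s"
  using log_slopes_leD(3)[of e l 0 s] log_slopes_leD(1)[of e l] by simp

lemma log_slopes_le_lower: "log_slopes_le e l \<Longrightarrow> 0 \<le> s \<Longrightarrow> exp (-e) * s \<le> l s"
  using log_slopes_leD(2)[of e l 0 s] log_slopes_leD(1)[of e l] by simp

lemma log_slopes_le_dist:
  assumes "log_slopes_le e l" "0 \<le> s"
  shows "\<bar>l s - s\<bar> \<le> (exp e - 1) * s"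
proof -
  \<comment> \<open>Adding \<open>1 + e \<le> exp e\<close> and \<open>1 - e \<le> exp (-e)\<close>
    gives exp e + exp (-e) \<ge> 2: the lower slope deviates from 1 no more than the upper one, so
    one constant serves both sides.\<close>
  have "1 - exp (-e) \<le> exp e - 1"
    using exp_ge_add_one_self[of e] exp_ge_add_one_self[of "-e"] by linarith
  then have "(1 - exp (-e)) * s \<le> (exp e - 1) * s" using assms(2) by (rule mult_right_mono)
  then show ?thesis
    using log_slopes_le_upper[OF assms] log_slopes_le_lower[OF assms] by (simp add: algebra_simps abs_le_iff)
qed

lemma log_slopes_le_lipschitz:
  assumes "log_slopes_le e l"
  shows "(exp e)-lipschitz_on {0..} l"
proof (rule lipschitz_onI)
  fix r s :: real assume "r \<in> {0..}" "s \<in> {0..}"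
  then show "dist (l r) (l s) \<le> exp e * dist r s"
    using log_slopes_leD(3)[OF assms, of r s] log_slopes_leD(3)[OF assms, of s r]
      log_slopes_le_less_iff(2)[OF assms, of r s] log_slopes_le_less_iff(2)[OF assms, of s r]
    by (cases "r \<le> s") (auto simp: dist_real_def abs_if)
qed simp

lemma log_slopes_le_continuous: "log_slopes_le e l \<Longrightarrow> continuous_on {0..} l"
  using lipschitz_on_continuous_on log_slopes_le_lipschitz by blast

text \<open>The lower slope bound forces \<open>l\<close> to reach any level u by time exp e * u, so
  the intermediate value theorem gives surjectivity.\<close>

lemma log_slopes_le_bij:
  assumes "log_slopes_le e l"
  shows "bij_betw l {0..} {0..}"
  unfolding bij_betw_def
proof
  show "inj_on l {0..}"
  proof (rule inj_onI)
    fix r s assume "r \<in> {0..}" "s \<in> {0..}" "l r = l s"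
    then show "r = s" using log_slopes_le_less_iff(2)[OF assms, of r s] log_slopes_le_less_iff(2)[OF assms, of s r] by simp
  qed
  show "l ` {0..} = {0..}"
  proof (intro equalityI subsetI)
    fix u :: real assume u: "u \<in> {0..}"
    have "u \<le> l (exp e * u)"
      using log_slopes_le_lower[OF assms, of "exp e * u"] u by (simp add: exp_minus field_simps)
    moreover have "l 0 \<le> u" using log_slopes_leD(1)[OF assms] u by simp
    ultimately obtain s where "0 \<le> s" "l s = u"
      using IVT'[of l 0 u "exp e * u"] continuous_on_subset[OF log_slopes_le_continuous[OF assms], of "{0..exp e * u}"] u
      by auto
    then show "u \<in> l ` {0..}" by auto
  qed (use log_slopes_le_nonneg[OF assms] in auto)
qed

text \<open>The interval [exp (-e), exp e] is invariant under reciprocals, so inverting costs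
  nothing; this is what makes the path metric symmetric.\<close>

lemma log_slopes_le_inverse:
  assumes "log_slopes_le e l"
  obtains m where "log_slopes_le e m" "\<And>s. 0 \<le> s \<Longrightarrow> m (l s) = s" "\<And>s. 0 \<le> s \<Longrightarrow> l (m s) = s"
proof
  let ?m = "inv_into {0..} l"
  note b = log_slopes_le_bij[OF assms]
  show ml: "?m (l s) = s" if "0 \<le> s" for s using bij_betw_inv_into_left[OF b] that by simp
  show lm: "l (?m s) = s" if "0 \<le> s" for s using bij_betw_inv_into_right[OF b] that by simp
  have pos: "0 \<le> ?m s" if "0 \<le> s" for s using b that by (metis atLeast_iff bij_betw_def inv_into_into)
  show "log_slopes_le e ?m"
    unfolding log_slopes_le_def
  proof (intro conjI allI impI)
    show "?m 0 = 0" using ml[of 0] log_slopes_leD(1)[OF assms] by simp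
    fix r s :: real assume rs: "0 \<le> r" "r \<le> s"
    then have s: "0 \<le> s" by simp
    have le: "?m r \<le> ?m s" using log_slopes_le_less_iff(2)[OF assms pos pos] rs lm s by simp
    have "exp (-e) * (?m s - ?m r) \<le> s - r" "s - r \<le> exp e * (?m s - ?m r)"
      using log_slopes_leD(2,3)[OF assms pos[OF rs(1)] le] lm rs s by auto
    then show "exp (-e) * (s - r) \<le> ?m s - ?m r" "?m s - ?m r \<le> exp e * (s - r)"
      by (auto simp: exp_minus field_simps)
  qed
qed

text \<open>Slopes multiply, so their logarithmic bounds add. A sum without any constant factor is
  what the triangle inequality needs.\<close>

lemma log_slopes_le_compose:
  assumes "log_slopes_le e l" "log_slopes_le e' m"
  shows "log_slopes_le (e + e') (\<lambda>s. m (l s))"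
  unfolding log_slopes_le_def
proof (intro conjI allI impI)
  show "m (l 0) = 0" using assms by (simp add: log_slopes_le_def)
  fix r s :: real assume rs: "0 \<le> r" "r \<le> s"
  have lrs: "0 \<le> l r" "l r \<le> l s"
    using log_slopes_le_nonneg[OF assms(1)] log_slopes_le_less_iff(2)[OF assms(1)] rs by auto
  have "exp (-e') * (exp (-e) * (s - r)) \<le> exp (-e') * (l s - l r)"
    using log_slopes_leD(2)[OF assms(1) rs] by simp
  also have "\<dots> \<le> m (l s) - m (l r)" using log_slopes_leD(2)[OF assms(2) lrs] .
  finally show "exp (- (e + e')) * (s - r) \<le> m (l s) - m (l r)" by (simp add: exp_add[of "-e" "-e'", simplified] algebra_simps)
  have "m (l s) - m (l r) \<le> exp e' * (l s - l r)" using log_slopes_leD(3)[OF assms(2) lrs] .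
  also have "\<dots> \<le> exp e' * (exp e * (s - r))"
    using log_slopes_leD(3)[OF assms(1) rs] by simp
  finally show "m (l s) - m (l r) \<le> exp (e + e') * (s - r)" by (simp add: exp_add field_simps)
qed

text \<open>The bounds are closed conditions, and the lower one keeps a pointwise limit strictly
  increasing and onto.\<close>

lemma log_slopes_le_limit:
  assumes "\<And>n. log_slopes_le e (l n)" "\<And>s. 0 \<le> s \<Longrightarrow> (\<lambda>n. l n s) \<longlonglongrightarrow> m s"
  shows "log_slopes_le e m"
  unfolding log_slopes_le_def
proof (intro conjI allI impI)
  have "(\<lambda>n. 0) \<longlonglongrightarrow> m 0" using assms(2)[of 0] by (simp add: log_slopes_leD(1)[OF assms(1)])
  then show "m 0 = 0" by (simp add: LIMSEQ_const_iff)
  fix r s :: real assume rs: "0 \<le> r" "r \<le> s"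
  then have lim: "(\<lambda>n. l n s - l n r) \<longlonglongrightarrow> m s - m r" by (intro tendsto_diff assms(2)) auto
  show "exp (-e) * (s - r) \<le> m s - m r"
    by (rule LIMSEQ_le_const[OF lim]) (use log_slopes_leD(2)[OF assms(1) rs] in auto)
  show "m s - m r \<le> exp e * (s - r)"
    by (rule LIMSEQ_le_const2[OF lim]) (use log_slopes_leD(3)[OF assms(1) rs] in auto)
qed

text \<open>The slope of a chord across u is a weighted mean of the slope of a chord ending at u and
  of m. This serves both to forget a time change after a given time and to append a new piece to
  one.\<close>

lemma log_slopes_le_extend:
  assumes u: "0 \<le> u" and l0: "l 0 = 0"
    and l: "\<And>r s. 0 \<le> r \<Longrightarrow> r \<le> s \<Longrightarrow> s \<le> u \<Longrightarrow> exp (-e) * (s - r) \<le> l s - l r \<and> l s - l r \<le> exp e * (s - r)"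
    and m: "exp (-e) \<le> m" "m \<le> exp e"
  shows "log_slopes_le e (\<lambda>s. if s \<le> u then l s else l u + m * (s - u))"
  unfolding log_slopes_le_def
proof (intro conjI allI impI)
  fix r s :: real assume rs: "0 \<le> r" "r \<le> s"
  have lin: "exp (-e) * x \<le> m * x" "m * x \<le> exp e * x" if "0 \<le> x" for x
    using m that by (auto intro: mult_right_mono)
  consider "s \<le> u" | "r \<le> u" "u < s" | "u < r" by linarith
  then show "exp (-e) * (s - r) \<le> (if s \<le> u then l s else l u + m * (s - u)) - (if r \<le> u then l r else l u + m * (r - u))"
    "(if s \<le> u then l s else l u + m * (s - u)) - (if r \<le> u then l r else l u + m * (r - u)) \<le> exp e * (s - r)"
  proof (atomize (full), cases)
    case 1
    then show "exp (- e) * (s - r) \<le> (if s \<le> u then l s else l u + m * (s - u)) - (if r \<le> u then l r else l u + m * (r - u)) \<and>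
      (if s \<le> u then l s else l u + m * (s - u)) - (if r \<le> u then l r else l u + m * (r - u)) \<le> exp e * (s - r)"
      using l rs by auto
  next
    case 2
    then show "exp (- e) * (s - r) \<le> (if s \<le> u then l s else l u + m * (s - u)) - (if r \<le> u then l r else l u + m * (r - u)) \<and>
      (if s \<le> u then l s else l u + m * (s - u)) - (if r \<le> u then l r else l u + m * (r - u)) \<le> exp e * (s - r)"
      using l[of r u] lin[of "s - u"] rs by (auto simp: algebra_simps)
  next
    case 3
    then show "exp (- e) * (s - r) \<le> (if s \<le> u then l s else l u + m * (s - u)) - (if r \<le> u then l r else l u + m * (r - u)) \<and>
      (if s \<le> u then l s else l u + m * (s - u)) - (if r \<le> u then l r else l u + m * (r - u)) \<le> exp e * (s - r)"
      using lin[of "s - r"] rs by (auto simp: algebra_simps)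
  qed
qed (use u l0 in auto)

section \<open>Relation to the time changes and the norm of the statement\<close>

lemma log_density_norm_slopes:
  assumes "l \<in> time_changes" "0 \<le> c"
  shows "log_density_norm l t \<le> ennreal c \<longleftrightarrow>
    (\<forall>r s. 0 \<le> r \<longrightarrow> r \<le> s \<longrightarrow> s \<le> t \<longrightarrow> exp (-c) * (s - r) \<le> l s - l r \<and> l s - l r \<le> exp c * (s - r))"
  unfolding log_density_norm_eq_SUP[OF assms(1)] SUP_slope_le_iff[OF assms] ..

lemma lipschitz_imp_local_lipschitz_const:
  assumes "L-lipschitz_on X f"
  shows "local_lipschitz T X (\<lambda>_::real. f)"
  unfolding local_lipschitz_def
proof (intro ballI)
  fix x :: 'a and t :: real
  have "\<forall>u\<in>cball t 1 \<inter> T. L-lipschitz_on (cball x 1 \<inter> X) f"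
    using assms by (auto intro: lipschitz_on_subset)
  then show "\<exists>u>0. \<exists>L. \<forall>t\<in>cball t u \<inter> T. L-lipschitz_on (cball x u \<inter> X) f"
    by (intro exI[of _ 1]) auto
qed

lemma log_slopes_le_time_changes:
  assumes l: "log_slopes_le e l"
  shows "l \<in> time_changes"
proof -
  obtain m where m: "log_slopes_le e m" "\<And>s. 0 \<le> s \<Longrightarrow> m (l s) = s" "\<And>s. 0 \<le> s \<Longrightarrow> l (m s) = s"
    using log_slopes_le_inverse[OF l] by blast
  have eq: "inv_into {0..} l s = m s" if "0 \<le> s" for s
    using bij_betw_inv_into_left[OF log_slopes_le_bij[OF l], of "m s"] m(3)[OF that] log_slopes_le_nonneg[OF m(1) that] by simp
  have "(exp e)-lipschitz_on {0..} (inv_into {0..} l)"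
    using log_slopes_le_lipschitz[OF m(1)] eq by (metis atLeast_iff lipschitz_on_transform)
  then show ?thesis
    unfolding time_changes_def
    using log_slopes_le_bij[OF l] log_slopes_le_strict_mono[OF l] log_slopes_le_lipschitz[OF l]
    by (auto simp: strict_mono_on_def intro!: lipschitz_imp_local_lipschitz_const)
qed

lemma log_slopes_le_log_density_norm:
  assumes "log_slopes_le e l" "0 \<le> e"
  shows "log_density_norm l t \<le> ennreal e"
  using log_slopes_leD(2,3)[OF assms(1)] log_density_norm_slopes[OF log_slopes_le_time_changes[OF assms(1)] assms(2)]
  by blast

lemma time_change_log_slopes_le:
  assumes l: "l \<in> time_changes" and e: "0 \<le> e" and t: "0 \<le> t" and n: "log_density_norm l t \<le> ennreal e"
  obtains m where "log_slopes_le e m" "\<And>s. s \<le> t \<Longrightarrow> m s = l s"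
proof
  show "log_slopes_le e (\<lambda>s. if s \<le> t then l s else l t + 1 * (s - t))"
    using log_density_norm_slopes[OF l e, of t] n time_change_0[OF l] e t
    by (intro log_slopes_le_extend) auto
qed simp

section \<open>Reciprocal times under a time change\<close>

lemma inverse_one_plus_dist:
  fixes a b :: real assumes "0 \<le> a" "0 \<le> b"
  shows "\<bar>1 / (1 + a) - 1 / (1 + b)\<bar> \<le> \<bar>a - b\<bar>"
proof -
  have "1 / (1 + a) - 1 / (1 + b) = (b - a) / ((1 + a) * (1 + b))" using assms by (simp add: field_simps)
  moreover have "1 \<le> (1 + a) * (1 + b)" using assms by (simp add: algebra_simps)
  ultimately have "\<bar>1 / (1 + a) - 1 / (1 + b)\<bar> = \<bar>a - b\<bar> / ((1 + a) * (1 + b))" using assms by (simp add: abs_minus_commute)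
  also have "\<dots> \<le> \<bar>a - b\<bar> / 1" using \<open>1 \<le> _\<close> by (intro divide_left_mono) auto
  finally show ?thesis by simp
qed

text \<open>A time change may displace s by a multiple of s, but only by a factor between exp (-e)
  and exp e, and 1 / (1 + s) varies under such a factor by at most 1 - exp (-e) \<le> e. Hence the
  bound is uniform in s.\<close>

lemma log_slopes_le_inverse_one_plus:
  assumes l: "log_slopes_le e l" and s: "0 \<le> s"
  shows "\<bar>1 / (1 + l s) - 1 / (1 + s)\<bar> \<le> e"
proof -
  have *: "1 / (1 + a) - 1 / (1 + b) \<le> e" if "0 \<le> a" "0 \<le> b" "exp (-e) * b \<le> a" for a b :: real
  proof (cases "b \<le> a")
    case False
    have "1 / (1 + a) - 1 / (1 + b) = (b - a) / ((1 + a) * (1 + b))" using that by (simp add: field_simps)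
    also have "\<dots> \<le> (b - a) / (1 * b)"
      using that False by (intro divide_left_mono mult_mono mult_pos_pos) auto
    also have "\<dots> \<le> 1 - exp (-e)" using that False by (simp add: field_simps)
    also have "\<dots> \<le> e" using exp_ge_add_one_self[of "-e"] by simp
    finally show ?thesis .
  next
    case True
    then have "1 / (1 + a) \<le> 1 / (1 + b)" using that by (intro divide_left_mono) auto
    moreover have "0 \<le> e"
    proof -
      have "exp (-e) \<le> exp e" using log_slopes_leD(2,3)[OF l, of 0 1] by (simp del: exp_le_cancel_iff)
      then show ?thesis by simp
    qed
    ultimately show ?thesis by simp
  qed
  have "exp (-e) * l s \<le> s" using log_slopes_le_upper[OF l s] by (simp add: exp_minus field_simps)
  then show ?thesis
    using *[of "l s" s] *[of s "l s"] log_slopes_le_nonneg[OF l s] log_slopes_le_lower[OF l s] s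
    by (simp add: abs_le_iff)
qed

section \<open>Paths in a proper metric space\<close>

lemma lifetime_nonneg: "0 \<le> lifetime x"
  unfolding lifetime_def by (auto intro!: INF_greatest)

lemma D_exp_None_iff:
  assumes "x \<in> D_exp S" "0 \<le> t"
  shows "x t = None \<longleftrightarrow> lifetime x \<le> ereal t"
proof
  show "x t = None \<Longrightarrow> lifetime x \<le> ereal t"
    unfolding lifetime_def using assms(2) by (auto intro!: INF_lower2[of t])
qed (use assms in \<open>auto simp: D_exp_def\<close>)

lemma D_exp_Some_topspace:
  assumes "x \<in> D_exp S" "0 \<le> t" "x t = Some a"
  shows "a \<in> topspace S"
proof -
  have "x t \<in> topspace (Alexandroff_compactification S)" using assms(1,2) by (auto simp: D_exp_def PiE_def Pi_def)
  then show ?thesis using assms(3) by auto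
qed

lemma D_exp_None_mono:
  assumes "x \<in> D_exp S" "0 \<le> r" "r \<le> s" "x r = None"
  shows "x s = None"
  using D_exp_None_iff[OF assms(1)] assms(2-4) by (metis ereal_less_eq(3) order_trans)

lemma D_loc_D_exp: "x \<in> D_loc S \<Longrightarrow> x \<in> D_exp S"
  by (simp add: D_loc_def)

text \<open>The restriction makes the path \<open>undefined\<close> at negative times, as the
  extensional function space in \<open>D_exp\<close> demands.\<close>

definition killed_path :: "ereal \<Rightarrow> (real \<Rightarrow> 'a) \<Rightarrow> real \<Rightarrow> 'a option" where
  "killed_path T f = (\<lambda>t\<in>{0..}. if ereal t < T then Some (f t) else None)"

lemma killed_path_eq: "0 \<le> t \<Longrightarrow> killed_path T f t = (if ereal t < T then Some (f t) else None)"
  by (simp add: killed_path_def)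

lemma lifetime_killed_path:
  assumes "0 \<le> T"
  shows "lifetime (killed_path T f) = T"
proof (rule antisym)
  show "T \<le> lifetime (killed_path T f)"
    unfolding lifetime_def by (rule INF_greatest) (auto simp: killed_path_eq split: if_splits)
  show "lifetime (killed_path T f) \<le> T"
  proof (cases T)
    case (real t)
    then show ?thesis using assms unfolding lifetime_def by (intro INF_lower2[of t]) (auto simp: killed_path_eq)
  qed (use assms in auto)
qed

text \<open>\<open>g\<close> is an exhaustion function: a subset of S is relatively compact exactly
  when \<open>g\<close> is bounded on it. Its Lipschitz constant 1 turns closeness of paths into
  closeness of heights without loss, and it makes \<open>d\<close>-bounded sets relatively
  compact.\<close>

locale proper_metric =
  fixes S :: "'a topology" and d :: "'a \<Rightarrow> 'a \<Rightarrow> real" and g :: "'a \<Rightarrow> real"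
  assumes metric: "metric_induces d S"
    and height_nonneg: "\<And>a. a \<in> topspace S \<Longrightarrow> 0 \<le> g a"
    and height_Lipschitz: "\<And>a b. a \<in> topspace S \<Longrightarrow> b \<in> topspace S \<Longrightarrow> \<bar>g a - g b\<bar> \<le> d a b"
    and compactin_sublevel: "\<And>B. compactin S {a \<in> topspace S. g a \<le> B}"
begin

sublocale M: Metric_space "topspace S" d
  using metric by (simp add: metric_induces_def)

lemma mtopology_eq: "M.mtopology = S"
  using metric by (simp add: metric_induces_def)

lemmas limitin_S = M.limitin_metric[unfolded mtopology_eq]

lemma compactin_height_bound:
  assumes "compactin S K"
  obtains B where "\<And>a. a \<in> K \<Longrightarrow> a \<in> topspace S \<and> g a \<le> B"
proof -
  have "M.mbounded K" using M.compactin_imp_mbounded assms by (simp add: mtopology_eq)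
  then obtain x B where xB: "K \<subseteq> M.mcball x B" by (auto simp: M.mbounded_def)
  show ?thesis
  proof (rule that)
    fix a assume "a \<in> K"
    then have "a \<in> M.mcball x B" using xB by auto
    then show "a \<in> topspace S \<and> g a \<le> g x + B" using height_Lipschitz[of a x] M.commute[of a x] by auto
  qed
qed

lemma compactly_contained_iff:
  "compactly_contained S C \<longleftrightarrow> C \<subseteq> topspace S \<and> (\<exists>B. \<forall>a\<in>C. g a \<le> B)"
proof
  assume "compactly_contained S C"
  then obtain K where K: "compactin S K" "C \<subseteq> K" by (auto simp: compactly_contained_def)
  then show "C \<subseteq> topspace S \<and> (\<exists>B. \<forall>a\<in>C. g a \<le> B)" using compactin_height_bound[OF K(1)] by (metis subset_eq)
next
  assume "C \<subseteq> topspace S \<and> (\<exists>B. \<forall>a\<in>C. g a \<le> B)"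
  then show "compactly_contained S C"
    unfolding compactly_contained_def using compactin_sublevel by blast
qed

text \<open>A Cauchy sequence is bounded, so \<open>g\<close> is bounded along it and it lies in a
  compact sublevel set, where a subsequence converges.\<close>

lemma mcomplete: "M.mcomplete"
  unfolding M.mcomplete_def
proof (intro allI impI)
  fix \<sigma> assume \<sigma>: "M.MCauchy \<sigma>"
  then have "M.mbounded (range \<sigma>)" by (rule M.MCauchy_imp_mbounded)
  then obtain x B where xB: "range \<sigma> \<subseteq> M.mcball x B" by (auto simp: M.mbounded_def)
  let ?K = "{a \<in> topspace S. g a \<le> g x + B}"
  have "range \<sigma> \<subseteq> ?K"
  proof
    fix a assume "a \<in> range \<sigma>"
    then have "a \<in> M.mcball x B" using xB by auto
    then show "a \<in> ?K" using height_Lipschitz[of a x] M.commute[of a x] by auto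
  qed
  moreover have "compactin M.mtopology ?K" using compactin_sublevel by (simp add: mtopology_eq)
  ultimately obtain l r where "strict_mono (r::nat\<Rightarrow>nat)" "limitin M.mtopology (\<sigma> \<circ> r) l sequentially"
    unfolding M.compactin_sequentially by blast
  then show "\<exists>x. limitin M.mtopology \<sigma> x sequentially"
    using M.MCauchy_convergent_subsequence[OF \<sigma>] by blast
qed

text \<open>Both values are required to be points of S, so the relation itself records that the
  paths are still alive where they are compared, and \<open>d\<close> is never applied to
  \<open>the None\<close>.\<close>

definition near :: "real \<Rightarrow> 'a option \<Rightarrow> 'a option \<Rightarrow> bool" where
  "near e p q \<longleftrightarrow> (\<exists>a\<in>topspace S. \<exists>b\<in>topspace S. p = Some a \<and> q = Some b \<and> d a b \<le> e)"

lemma near_sym: "near e p q \<Longrightarrow> near e q p"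
  by (auto simp: near_def M.commute)

lemma near_trans: "near e p q \<Longrightarrow> near e' q r \<Longrightarrow> near (e + e') p r"
  unfolding near_def using M.triangle by force

lemma near_mono: "near e p q \<Longrightarrow> e \<le> e' \<Longrightarrow> near e' p q"
  by (force simp: near_def)

lemma near_not_None: "near e p q \<Longrightarrow> p \<noteq> None \<and> q \<noteq> None"
  by (auto simp: near_def)

lemma near_dist: "near e p q \<Longrightarrow> d (the p) (the q) \<le> e"
  by (auto simp: near_def)

lemma near_height: "near e (Some a) (Some b) \<Longrightarrow> g b \<le> g a + e"
  using height_Lipschitz by (force simp: near_def)

lemma nearI: "x \<in> D_exp S \<Longrightarrow> y \<in> D_exp S \<Longrightarrow> 0 \<le> s \<Longrightarrow> 0 \<le> r \<Longrightarrow> x s \<noteq> None \<Longrightarrow> y r \<noteq> None \<Longrightarrow>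
    d (the (x s)) (the (y r)) \<le> e \<Longrightarrow> near e (x s) (y r)"
  using D_exp_Some_topspace by (fastforce simp: near_def)

text \<open>This also says that x is alive before t. Where x is dead at t > 0, it is the condition
  under which the left limit at t exists: t is then the life time and the trajectory is relatively
  compact.\<close>

definition bounded_before :: "(real \<Rightarrow> 'a option) \<Rightarrow> real \<Rightarrow> bool" where
  "bounded_before x t \<longleftrightarrow> (\<exists>B. \<forall>s\<in>{0..<t}. \<exists>a. x s = Some a \<and> g a \<le> B)"

lemma trajectory_eq:
  assumes "x \<in> D_exp S"
  shows "trajectory x = {a. \<exists>s\<ge>0. x s = Some a}"
  unfolding trajectory_def using D_exp_None_iff[OF assms] by (force simp: not_le[symmetric])

lemma trajectory_subset: "x \<in> D_exp S \<Longrightarrow> trajectory x \<subseteq> topspace S"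
  using D_exp_Some_topspace by (fastforce simp: trajectory_eq)

lemma bounded_before_lifetime:
  assumes x: "x \<in> D_exp S" and T: "lifetime x = ereal T"
  shows "compactly_contained S (trajectory x) \<longleftrightarrow> bounded_before x T"
proof -
  have *: "x s \<noteq> None \<longleftrightarrow> s < T" if "0 \<le> s" for s using D_exp_None_iff[OF x that] T by auto
  have "(\<forall>a\<in>trajectory x. g a \<le> B) \<longleftrightarrow> (\<forall>s\<in>{0..<T}. \<exists>a. x s = Some a \<and> g a \<le> B)" for B
  proof
    assume "\<forall>a\<in>trajectory x. g a \<le> B"
    then show "\<forall>s\<in>{0..<T}. \<exists>a. x s = Some a \<and> g a \<le> B" using * by (force simp: trajectory_eq[OF x])
  next
    assume B: "\<forall>s\<in>{0..<T}. \<exists>a. x s = Some a \<and> g a \<le> B"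
    show "\<forall>a\<in>trajectory x. g a \<le> B"
    proof
      fix a assume "a \<in> trajectory x"
      then obtain s where s: "0 \<le> s" "x s = Some a" by (auto simp: trajectory_eq[OF x])
      then have "s < T" using *[of s] by simp
      then show "g a \<le> B" using B s by force
    qed
  qed
  then have "(\<exists>B. \<forall>a\<in>trajectory x. g a \<le> B) \<longleftrightarrow> bounded_before x T"
    by (simp add: bounded_before_def)
  then show ?thesis using trajectory_subset[OF x] by (auto simp: compactly_contained_iff)
qed

lemma D_exp_right:
  assumes x: "x \<in> D_exp S" and t: "0 \<le> t" "x t \<noteq> None" and e: "0 < e"
  obtains \<delta> where "0 < \<delta>" "\<And>s. t \<le> s \<Longrightarrow> s < t + \<delta> \<Longrightarrow> near e (x t) (x s)"
proof -
  have lt: "ereal t < lifetime x" using D_exp_None_iff[OF x t(1)] t(2) by auto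
  then have "limitin S (\<lambda>s. the (x s)) (the (x t)) (at_right t)" using x t by (auto simp: D_exp_def)
  then have "\<forall>\<^sub>F s in at_right t. the (x s) \<in> topspace S \<and> d (the (x s)) (the (x t)) < e"
    and xt: "the (x t) \<in> topspace S"
    using e by (auto simp: limitin_S)
  moreover have "\<forall>\<^sub>F s in at_right t. ereal s < lifetime x"
  proof (cases "lifetime x")
    case (real T)
    then show ?thesis using lt eventually_at_right_less[of t] by (auto simp: eventually_at_right_field)
  qed (use lt in auto)
  ultimately have "\<forall>\<^sub>F s in at_right t. the (x s) \<in> topspace S \<and> d (the (x s)) (the (x t)) < e \<and> ereal s < lifetime x"
    by (auto elim: eventually_elim2)
  then obtain b where b: "t < b" "\<And>s. t < s \<Longrightarrow> s < b \<Longrightarrow> the (x s) \<in> topspace S \<and> d (the (x s)) (the (x t)) < e \<and> ereal s < lifetime x"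
    by (auto simp: eventually_at_right_field)
  show ?thesis
  proof (rule that[of "b - t"])
    fix s assume s: "t \<le> s" "s < t + (b - t)"
    show "near e (x t) (x s)"
    proof (cases "s = t")
      case True then show ?thesis using t xt e by (auto simp: near_def)
    next
      case False
      then have "the (x s) \<in> topspace S \<and> d (the (x s)) (the (x t)) < e \<and> ereal s < lifetime x" using b s by auto
      moreover from this have "x s \<noteq> None" using D_exp_None_iff[OF x, of s] t s by auto
      ultimately show ?thesis using t xt by (force simp: near_def M.commute)
    qed
  qed (use b in auto)
qed

text \<open>If x is dead at t but alive and bounded before, then t is the life time, and the
  defining condition of \<open>D_loc\<close> supplies the left limit that \<open>D_exp\<close>
  supplies at living times.\<close>

lemma D_loc_left:
  assumes x: "x \<in> D_loc S" and t: "0 < t" "x t \<noteq> None \<or> bounded_before x t" and e: "0 < e"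
  obtains \<delta> where "0 < \<delta>" "\<delta> \<le> t" "\<And>r s. t - \<delta> \<le> r \<Longrightarrow> r < t \<Longrightarrow> t - \<delta> \<le> s \<Longrightarrow> s < t \<Longrightarrow> near e (x r) (x s)"
proof -
  have x': "x \<in> D_exp S" using x by (rule D_loc_D_exp)
  have alive: "x s \<noteq> None" if "0 \<le> s" "s < t" for s
    using t(2) that D_exp_None_mono[OF x', of s t] by (force simp: bounded_before_def)
  obtain y where y: "limitin S (\<lambda>s. the (x s)) y (at_left t)"
  proof (cases "x t = None")
    case False
    then have "ereal t < lifetime x" using D_exp_None_iff[OF x', of t] t by auto
    then show ?thesis using that x' t by (auto simp: D_exp_def)
  next
    case True
    have T: "lifetime x = ereal t"
    proof (rule antisym)
      show "lifetime x \<le> ereal t" using True D_exp_None_iff[OF x', of t] t by simp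
      show "ereal t \<le> lifetime x"
      proof (rule ccontr)
        assume "\<not> ereal t \<le> lifetime x"
        then have "lifetime x < ereal t" by simp
        then obtain s where s: "lifetime x = ereal s" using lifetime_nonneg[of x] by (cases "lifetime x") auto
        then have "0 \<le> s" "s < t" using \<open>lifetime x < ereal t\<close> lifetime_nonneg[of x] by auto
        then show False using alive[of s] D_exp_None_iff[OF x', of s] s by auto
      qed
    qed
    then have "\<exists>y. limitin S (\<lambda>s. the (x s)) y (at_left t)"
      using x t True bounded_before_lifetime[OF x' T] by (auto simp: D_loc_def)
    then show ?thesis using that by blast
  qed
  then have "\<forall>\<^sub>F s in at_left t. the (x s) \<in> topspace S \<and> d (the (x s)) y < e / 2" and yS: "y \<in> topspace S"
    using e half_gt_zero[OF e] unfolding limitin_S by blast+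
  then obtain b where b: "b < t" "\<And>s. b < s \<Longrightarrow> s < t \<Longrightarrow> the (x s) \<in> topspace S \<and> d (the (x s)) y < e / 2"
    by (auto simp: eventually_at_left_field)
  \<comment> \<open>Halving t - b puts the closed end t - \<delta> strictly beyond b; the minimum
    with t keeps all times nonnegative, where x is known to be alive.\<close>
  show ?thesis
  proof (rule that[of "min t ((t - b) / 2)"])
    fix r s assume "t - min t ((t - b) / 2) \<le> r" "r < t" "t - min t ((t - b) / 2) \<le> s" "s < t"
    then have "b < r" "b < s" "0 \<le> r" "0 \<le> s" "r < t" "s < t" using b(1) by (auto simp: min_def field_simps split: if_splits)
    then have "the (x r) \<in> topspace S \<and> d (the (x r)) y < e / 2" "the (x s) \<in> topspace S \<and> d (the (x s)) y < e / 2" "x r \<noteq> None" "x s \<noteq> None"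
      using b alive by auto
    then show "near e (x r) (x s)"
      using M.triangle''[of "the (x r)" y "the (x s)"] M.triangle'[of "the (x r)" y "the (x s)"] M.commute yS by (force simp: near_def)
  qed (use b t in auto)
qed

text \<open>The supremum of the times \<open>u\<close> with \<open>P u\<close> is attained by the left limits and equals \<open>t\<close> by
  right-continuity.\<close>

lemma cadlag_induct:
  assumes x: "x \<in> D_loc S" and e: "0 < e" and t: "0 \<le> t"
    and alive: "x t \<noteq> None \<or> bounded_before x t"
    and P0: "P 0"
    and step: "\<And>u v. 0 \<le> u \<Longrightarrow> u < v \<Longrightarrow> v \<le> t \<Longrightarrow> P u \<Longrightarrow>
      (\<And>r s. u \<le> r \<Longrightarrow> r < v \<Longrightarrow> u \<le> s \<Longrightarrow> s < v \<Longrightarrow> near e (x r) (x s)) \<Longrightarrow> P v"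
  shows "P t"
proof -
  have x': "x \<in> D_exp S" using x by (rule D_loc_D_exp)
  have al: "x s \<noteq> None" if "0 \<le> s" "s < t" for s
    using alive that D_exp_None_mono[OF x', of s t] by (force simp: bounded_before_def)
  define A where "A = {u. 0 \<le> u \<and> u \<le> t \<and> P u}"
  define m where "m = Sup A"
  have A0: "0 \<in> A" using P0 t by (auto simp: A_def)
  have bdd: "bdd_above A" by (auto simp: A_def bdd_above_def)
  have m0: "0 \<le> m" unfolding m_def using cSup_upper[OF A0 bdd] .
  have mt: "m \<le> t" unfolding m_def using A0 by (intro cSup_least) (auto simp: A_def)
  have Pm: "P m"
  proof (rule ccontr)
    assume nP: "\<not> P m"
    then have mpos: "0 < m" using P0 m0 by (cases "m = 0") auto
    have "x m \<noteq> None \<or> bounded_before x m" using alive al[of m] mt m0 by (cases "m = t") auto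
    then obtain \<delta> where \<delta>: "0 < \<delta>" "\<delta> \<le> m" "\<And>r s. m - \<delta> \<le> r \<Longrightarrow> r < m \<Longrightarrow> m - \<delta> \<le> s \<Longrightarrow> s < m \<Longrightarrow> near e (x r) (x s)"
      using D_loc_left[OF x mpos _ e] by blast
    have "m - \<delta> < Sup A" using \<delta> by (simp add: m_def)
    then obtain u where u: "u \<in> A" "m - \<delta> < u" using less_cSup_iff[of A] A0 bdd by auto
    then have "u \<le> m" unfolding m_def using bdd cSup_upper by blast
    moreover have "u \<noteq> m" using u nP by (auto simp: A_def)
    ultimately have "P m" using u \<delta> mt by (intro step[of u m]) (auto simp: A_def)
    then show False using nP by simp
  qed
  have "m = t"
  proof (rule ccontr)
    assume "m \<noteq> t"
    then have lt: "m < t" using mt by simp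
    obtain \<delta> where \<delta>: "0 < \<delta>" "\<And>s. m \<le> s \<Longrightarrow> s < m + \<delta> \<Longrightarrow> near (e/2) (x m) (x s)"
      using D_exp_right[OF x' m0 al[OF m0 lt], of "e/2"] e by auto
    let ?v = "min (m + \<delta>) t"
    have "P ?v"
    proof (rule step[OF m0 _ _ Pm])
      fix r s assume "m \<le> r" "r < ?v" "m \<le> s" "s < ?v"
      then have "near (e/2) (x r) (x m)" "near (e/2) (x m) (x s)" using \<delta> by (auto intro: near_sym)
      then show "near e (x r) (x s)" using near_trans by fastforce
    qed (use lt \<delta> in auto)
    then have "?v \<in> A" using m0 lt \<delta> by (auto simp: A_def)
    then have "?v \<le> m" unfolding m_def using bdd cSup_upper by blast
    then show False using lt \<delta> by auto
  qed
  then show ?thesis using Pm by simp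
qed

text \<open>On a piece of oscillation at most 1 the height exceeds its initial value by at most 1.
  \<open>cadlag_induct\<close> replaces the finite partition into such pieces.\<close>

lemma bounded_before_alive:
  assumes x: "x \<in> D_loc S" and t: "0 \<le> t" "x t \<noteq> None"
  shows "bounded_before x t"
proof (rule cadlag_induct[OF x zero_less_one t(1)])
  show "x t \<noteq> None \<or> bounded_before x t" using t by simp
  show "bounded_before x 0" by (auto simp: bounded_before_def)
  fix u v assume uv: "u < v" "bounded_before x u" and osc: "\<And>r s. u \<le> r \<Longrightarrow> r < v \<Longrightarrow> u \<le> s \<Longrightarrow> s < v \<Longrightarrow> near 1 (x r) (x s)"
  obtain B where B: "\<forall>s\<in>{0..<u}. \<exists>a. x s = Some a \<and> g a \<le> B" using uv by (auto simp: bounded_before_def)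
  have "near 1 (x u) (x u)" using osc uv by auto
  then obtain a where a: "x u = Some a" by (auto simp: near_def)
  have "\<exists>b. x s = Some b \<and> g b \<le> max B (g a + 1)" if "s \<in> {0..<v}" for s
  proof (cases "s < u")
    case True then show ?thesis using B that by fastforce
  next
    case False
    then have w: "near 1 (Some a) (x s)" using osc[of u s] uv that a by auto
    then obtain b where "x s = Some b" by (auto simp: near_def)
    then show ?thesis using near_height w by force
  qed
  then show "bounded_before x v" unfolding bounded_before_def by blast
qed

text \<open>The Cauchy criterion at t: completeness gives a limit along one sequence increasing to
  t, and the oscillation bound extends it to all times before t.\<close>

lemma left_limit_exists:
  fixes t :: real
  assumes t: "0 < t" and f: "\<And>s. 0 \<le> s \<Longrightarrow> s < t \<Longrightarrow> f s \<in> topspace S"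
    and osc: "\<And>e. 0 < e \<Longrightarrow> \<exists>\<delta>>0. \<forall>r s. 0 \<le> r \<longrightarrow> t - \<delta> < r \<longrightarrow> r < t \<longrightarrow> 0 \<le> s \<longrightarrow> t - \<delta> < s \<longrightarrow> s < t \<longrightarrow> d (f r) (f s) < e"
  shows "\<exists>y. limitin S f y (at_left t)"
proof -
  define u where "u n = t - t / real (Suc n)" for n
  have u: "0 \<le> u n" "u n < t" for n
    using t by (auto simp: u_def field_simps)
  have "(\<lambda>n. t * inverse (real (Suc n))) \<longlonglongrightarrow> t * 0"
    by (intro tendsto_mult tendsto_const LIMSEQ_inverse_real_of_nat)
  then have lim: "(\<lambda>n. t / real (Suc n)) \<longlonglongrightarrow> 0" by (simp add: field_simps)
  have near: "\<forall>\<^sub>F n in sequentially. t - \<delta> < u n" if "0 < \<delta>" for \<delta>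
    using order_tendstoD(2)[OF lim that] by eventually_elim (simp add: u_def)
  have "M.MCauchy (\<lambda>n. f (u n))"
    unfolding M.MCauchy_def
  proof (intro conjI allI impI)
    show "range (\<lambda>n. f (u n)) \<subseteq> topspace S" using f u by auto
    fix e :: real assume "0 < e"
    from osc[OF this] obtain \<delta> where "0 < \<delta>" "\<And>r s. 0 \<le> r \<Longrightarrow> t - \<delta> < r \<Longrightarrow> r < t \<Longrightarrow> 0 \<le> s \<Longrightarrow> t - \<delta> < s \<Longrightarrow> s < t \<Longrightarrow> d (f r) (f s) < e" by blast
    then show "\<exists>N. \<forall>n n'. N \<le> n \<longrightarrow> N \<le> n' \<longrightarrow> d (f (u n)) (f (u n')) < e"
      using near[OF \<open>0 < \<delta>\<close>] u unfolding eventually_sequentially by meson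
  qed
  then obtain y where y: "limitin M.mtopology (\<lambda>n. f (u n)) y sequentially" using mcomplete by (auto simp: M.mcomplete_def)
  have "limitin S f y (at_left t)"
    unfolding limitin_S
  proof (intro conjI allI impI)
    show yS: "y \<in> topspace S" using y by (simp add: M.limitin_metric)
    fix e :: real assume e: "0 < e"
    then obtain \<delta> where \<delta>: "0 < \<delta>" "\<And>r s. 0 \<le> r \<Longrightarrow> t - \<delta> < r \<Longrightarrow> r < t \<Longrightarrow> 0 \<le> s \<Longrightarrow> t - \<delta> < s \<Longrightarrow> s < t \<Longrightarrow> d (f r) (f s) < e/2"
      using osc[of "e/2"] by auto
    have "\<forall>\<^sub>F n in sequentially. f (u n) \<in> topspace S \<and> d (f (u n)) y < e/2" using y half_gt_zero[OF e] unfolding M.limitin_metric by blast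
    with near[OF \<delta>(1)] have "\<forall>\<^sub>F n in sequentially. t - \<delta> < u n \<and> d (f (u n)) y < e/2" by eventually_elim auto
    then obtain n where n: "t - \<delta> < u n" "d (f (u n)) y < e/2" by (auto simp: eventually_sequentially)
    have "f s \<in> topspace S \<and> d (f s) y < e" if "max 0 (t - \<delta>) < s" "s < t" for s
      using M.triangle[of "f s" "f (u n)" y] \<delta>(2)[of s "u n"] n u[of n] that f yS by force
    then show "\<forall>\<^sub>F s in at_left t. f s \<in> topspace S \<and> d (f s) y < e"
      using t \<delta> unfolding eventually_at_left_field by (intro exI[of _ "max 0 (t - \<delta>)"]) auto
  qed
  then show ?thesis by blast
qed

text \<open>At the killing time itself the oscillation condition is asked only when the heights stay
  bounded, because \<open>D_loc\<close> demands no left limit of a path that explodes there.\<close>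

lemma killed_path_D_loc:
  assumes T: "0 \<le> T"
    and f: "\<And>s. 0 \<le> s \<Longrightarrow> ereal s < T \<Longrightarrow> f s \<in> topspace S"
    and right: "\<And>t e. 0 \<le> t \<Longrightarrow> ereal t < T \<Longrightarrow> 0 < e \<Longrightarrow>
      \<exists>\<delta>>0. \<forall>s. t < s \<longrightarrow> s < t + \<delta> \<longrightarrow> ereal s < T \<longrightarrow> d (f s) (f t) < e"
    and left: "\<And>t e. 0 < t \<Longrightarrow> ereal t < T \<or> ereal t = T \<and> (\<exists>B. \<forall>s. 0 \<le> s \<longrightarrow> s < t \<longrightarrow> g (f s) \<le> B) \<Longrightarrow> 0 < e \<Longrightarrow>
      \<exists>\<delta>>0. \<forall>r s. 0 \<le> r \<longrightarrow> t - \<delta> < r \<longrightarrow> r < t \<longrightarrow> 0 \<le> s \<longrightarrow> t - \<delta> < s \<longrightarrow> s < t \<longrightarrow> d (f r) (f s) < e"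
  shows "killed_path T f \<in> D_loc S"
proof -
  let ?x = "killed_path T f"
  note life = lifetime_killed_path[OF T, of f]
  have the_x: "the (?x s) = f s" if "0 \<le> s" "ereal s < T" for s using that by (simp add: killed_path_eq)
  have lim_left: "\<exists>y. limitin S (\<lambda>s. the (?x s)) y (at_left t)"
    if t: "0 < t" "ereal t < T \<or> ereal t = T \<and> (\<exists>B. \<forall>s. 0 \<le> s \<longrightarrow> s < t \<longrightarrow> g (f s) \<le> B)" for t
  proof -
    have lt: "ereal s < T" if "s < t" for s using t that ereal_less_le less_trans less_ereal.simps(1) by metis
    have "\<exists>y. limitin S f y (at_left t)"
      by (rule left_limit_exists[OF t(1)]) (use f lt left[OF t] in auto)
    then obtain y where "limitin S f y (at_left t)" by blast
    moreover have "\<forall>\<^sub>F s in at_left t. f s = the (?x s)"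
      unfolding eventually_at_left_field using t the_x lt by (intro exI[of _ 0]) auto
    ultimately have "limitin S (\<lambda>s. the (?x s)) y (at_left t)"
      by (rule limitin_transform_eventually[rotated])
    then show ?thesis by blast
  qed
  have "?x \<in> D_exp S"
    unfolding D_exp_def
  proof (intro CollectI conjI allI impI)
    show "?x \<in> {0..} \<rightarrow>\<^sub>E topspace (Alexandroff_compactification S)"
      using f by (auto simp: killed_path_def)
    show "?x t = None" if "0 \<le> t" "lifetime ?x \<le> ereal t" for t using that by (auto simp: life killed_path_eq)
    show "\<exists>y. limitin S (\<lambda>s. the (?x s)) y (at_left t)" if "0 < t" "ereal t < lifetime ?x" for t
      using lim_left that by (simp add: life)
    fix t :: real assume t: "0 \<le> t" "ereal t < lifetime ?x"
    then have tT: "ereal t < T" by (simp add: life)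
    obtain b where b: "t < b" "ereal b \<le> T" using tT by (cases T) (auto intro: that[of "t + 1"] that)
    have bT: "ereal s < T" if "s < b" for s using that b by (metis ereal_less(2) less_ereal.simps(1) less_le_trans)
    show "limitin S (\<lambda>s. the (?x s)) (the (?x t)) (at_right t)"
      unfolding limitin_S the_x[OF t(1) tT]
    proof (intro conjI allI impI)
      show "f t \<in> topspace S" using f t tT by auto
      fix e :: real assume "0 < e"
      then obtain \<delta> where \<delta>: "0 < \<delta>" "\<And>s. t < s \<Longrightarrow> s < t + \<delta> \<Longrightarrow> ereal s < T \<Longrightarrow> d (f s) (f t) < e"
        using right[OF t(1) tT] by blast
      show "\<forall>\<^sub>F s in at_right t. the (?x s) \<in> topspace S \<and> d (the (?x s)) (f t) < e"
        unfolding eventually_at_right_field using b(1) \<delta> bT f t the_x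
        by (intro exI[of _ "min b (t + \<delta>)"]) auto
    qed
  qed
  moreover have "\<exists>y. limitin S (\<lambda>s. the (?x s)) y (at_left (real_of_ereal T))"
    if T': "0 < T" "T < \<infinity>" "compactly_contained S (trajectory ?x)"
  proof -
    obtain t where t: "T = ereal t" "0 < t" using T' by (cases T) auto
    have "bounded_before ?x t" using T' bounded_before_lifetime[OF \<open>?x \<in> D_exp S\<close>] life t by auto
    then have "\<exists>B. \<forall>s. 0 \<le> s \<longrightarrow> s < t \<longrightarrow> g (f s) \<le> B" using t by (force simp: bounded_before_def killed_path_eq)
    then show ?thesis using lim_left[of t] t by auto
  qed
  ultimately show ?thesis by (auto simp: D_loc_def life)
qed

end

section \<open>The metric on path space\<close>

lemma exp_minus_one_le:
  fixes e :: real assumes "0 \<le> e" "e \<le> 1" shows "exp e - 1 \<le> 2 * e"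
proof -
  have "e\<^sup>2 \<le> e" using assms by (simp add: power2_eq_square mult_left_le)
  then show ?thesis using exp_bound[OF assms] by simp
qed

lemma log_slopes_le_dist':
  assumes "log_slopes_le e l" "0 \<le> e" "e \<le> 1" "0 \<le> s"
  shows "\<bar>l s - s\<bar> \<le> 2 * e * s"
  using log_slopes_le_dist[OF assms(1,4)] mult_right_mono[OF exp_minus_one_le[OF assms(2,3)] assms(4)] by linarith

context proper_metric begin

text \<open>The reciprocal size of the point \<open>(x t, t)\<close> of space-time, with value \<open>0\<close> at \<open>\<Delta>\<close>.\<close>

definition cut :: "(real \<Rightarrow> 'a option) \<Rightarrow> real \<Rightarrow> real" where
  "cut x t = (case x t of None \<Rightarrow> 0 | Some a \<Rightarrow> min (1 / (1 + g a)) (1 / (1 + t)))"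

lemma cut_nonneg: "x \<in> D_exp S \<Longrightarrow> 0 \<le> t \<Longrightarrow> 0 \<le> cut x t"
  using D_exp_Some_topspace[of x S t] height_nonneg by (auto simp: cut_def split: option.split)

lemma cut_le_time: "0 \<le> t \<Longrightarrow> cut x t \<le> 1 / (1 + t)"
  by (auto simp: cut_def split: option.split)

lemma cut_None: "x t = None \<Longrightarrow> cut x t = 0"
  by (simp add: cut_def)

lemma cut_diff:
  assumes "near e (x s) (y r)" "0 \<le> s" "0 \<le> r" "\<bar>1 / (1 + s) - 1 / (1 + r)\<bar> \<le> e"
  shows "\<bar>cut x s - cut y r\<bar> \<le> e"
proof -
  obtain a b where ab: "a \<in> topspace S" "b \<in> topspace S" "x s = Some a" "y r = Some b" "d a b \<le> e"
    using assms(1) by (auto simp: near_def)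
  have "\<bar>1 / (1 + g a) - 1 / (1 + g b)\<bar> \<le> e"
    using inverse_one_plus_dist[OF height_nonneg height_nonneg, OF ab(1,2)] height_Lipschitz[OF ab(1,2)] ab(5) by linarith
  moreover have "\<bar>min p p' - min q q'\<bar> \<le> e" if "\<bar>p - q\<bar> \<le> e" "\<bar>p' - q'\<bar> \<le> e" for p p' q q' :: real
    using that by linarith
  ultimately show ?thesis using assms(4) ab(3,4) by (simp add: cut_def)
qed

text \<open>Closeness e of the values and of the logarithmic slopes moves each of the two
  reciprocals by at most e, hence also their minimum. Thresholds on \<open>cut\<close> can thus be
  carried from one path to another.\<close>

lemma cut_near:
  assumes "near e (x s) (y (l s))" "log_slopes_le e l" "0 \<le> s"
  shows "\<bar>cut x s - cut y (l s)\<bar> \<le> e"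
  using assms log_slopes_le_inverse_one_plus[OF assms(2,3)]
  by (intro cut_diff) (auto simp: log_slopes_le_nonneg abs_minus_commute)

lemma cut_lower:
  assumes x: "x \<in> D_exp S" and b: "bounded_before x t"
  obtains \<beta> where "0 < \<beta>" "\<And>s. 0 \<le> s \<Longrightarrow> s < t \<Longrightarrow> \<beta> \<le> cut x s"
proof -
  obtain B where B: "\<And>s. 0 \<le> s \<Longrightarrow> s < t \<Longrightarrow> \<exists>a. x s = Some a \<and> g a \<le> B" using b unfolding bounded_before_def by (meson atLeastLessThan_iff)
  let ?m = "max 0 (max B t)"
  show ?thesis
  proof (rule that[of "1 / (1 + ?m)"])
    fix s assume s: "0 \<le> s" "s < t"
    obtain a where a: "x s = Some a" "g a \<le> B" using B[OF s] by blast
    have "0 \<le> g a" using D_exp_Some_topspace[OF x s(1) a(1)] height_nonneg by blast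
    then have "1 / (1 + ?m) \<le> 1 / (1 + g a)" using a by (intro divide_left_mono mult_pos_pos) auto
    moreover have "1 / (1 + ?m) \<le> 1 / (1 + s)" using s by (intro divide_left_mono mult_pos_pos) auto
    ultimately show "1 / (1 + ?m) \<le> cut x s" using a by (simp add: cut_def)
  qed (simp add: add_pos_nonneg)
qed

text \<open>Right-continuity carries a bound on \<open>cut\<close> down to an infimum of times, so
  that the first time below a threshold itself satisfies the threshold.\<close>

lemma cut_right_le:
  assumes x: "x \<in> D_exp S" and t: "0 \<le> t" and c: "0 \<le> c"
    and ex: "\<And>\<delta>. 0 < \<delta> \<Longrightarrow> \<exists>s. t \<le> s \<and> s < t + \<delta> \<and> cut x s \<le> c"
  shows "cut x t \<le> c"
proof (cases "x t = None")
  case False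
  show ?thesis
  proof (rule field_le_epsilon)
    fix e :: real assume e: "0 < e"
    obtain \<delta> where \<delta>: "0 < \<delta>" "\<And>s. t \<le> s \<Longrightarrow> s < t + \<delta> \<Longrightarrow> near e (x t) (x s)"
      using D_exp_right[OF x t False e] by blast
    obtain s where s: "t \<le> s" "s < t + min \<delta> e" "cut x s \<le> c" using ex[of "min \<delta> e"] \<delta> e by auto
    have "\<bar>1 / (1 + t) - 1 / (1 + s)\<bar> \<le> e" using inverse_one_plus_dist[of t s] s t by auto
    then have "\<bar>cut x t - cut x s\<bar> \<le> e" using s t \<delta>(2)[of s] by (intro cut_diff) auto
    then show "cut x t \<le> c + e" using s by linarith
  qed
qed (use c in \<open>simp add: cut_None\<close>)

text \<open>Nothing is compared at t itself, where either path may be dead; bounding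
  \<open>cut\<close> on both sides keeps the relation symmetric.\<close>

definition witness :: "real \<Rightarrow> (real \<Rightarrow> real) \<Rightarrow> real \<Rightarrow> (real \<Rightarrow> 'a option) \<Rightarrow> (real \<Rightarrow> 'a option) \<Rightarrow> bool" where
  "witness e l t x y \<longleftrightarrow> 0 \<le> t \<and> log_slopes_le e l \<and> (\<forall>s. 0 \<le> s \<longrightarrow> s < t \<longrightarrow> near e (x s) (y (l s))) \<and>
     cut x t \<le> e \<and> cut y (l t) \<le> e"

lemma witnessD:
  assumes "witness e l t x y"
  shows "0 \<le> t" "log_slopes_le e l" "\<And>s. 0 \<le> s \<Longrightarrow> s < t \<Longrightarrow> near e (x s) (y (l s))"
    "cut x t \<le> e" "cut y (l t) \<le> e"
  using assms by (auto simp: witness_def)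

lemma witness_cut:
  assumes x: "x \<in> D_exp S" and y: "y \<in> D_exp S" and w: "witness e l t x y" and s: "0 \<le> s" "s \<le> t"
  shows "\<bar>cut x s - cut y (l s)\<bar> \<le> e"
proof (cases "s = t")
  case True
  then show ?thesis
    using cut_nonneg[OF x s(1)] cut_nonneg[OF y log_slopes_le_nonneg[OF witnessD(2)[OF w] s(1)]]
      witnessD(4,5)[OF w] by auto
next
  case False
  then show ?thesis using s witnessD[OF w] by (intro cut_near) auto
qed

lemma witness_nonneg: "x \<in> D_exp S \<Longrightarrow> witness e l t x y \<Longrightarrow> 0 \<le> e"
  using cut_nonneg[of x t] by (auto simp: witness_def)

lemma witness_mono: "witness e l t x y \<Longrightarrow> e \<le> e' \<Longrightarrow> witness e' l t x y"
  unfolding witness_def using log_slopes_le_mono[of e l e'] near_mono[of e _ _ e'] by (auto intro: order_trans)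

lemma witness_sym:
  assumes "witness e l t x y"
  shows "\<exists>l t. witness e l t y x"
proof -
  note w = witnessD[OF assms]
  obtain m where m: "log_slopes_le e m" "\<And>s. 0 \<le> s \<Longrightarrow> m (l s) = s" "\<And>s. 0 \<le> s \<Longrightarrow> l (m s) = s"
    using log_slopes_le_inverse[OF w(2)] by blast
  have "near e (y s) (x (m s))" if s: "0 \<le> s" "s < l t" for s
  proof -
    have "m s < t"
      using log_slopes_le_less_iff(1)[OF w(2) log_slopes_le_nonneg[OF m(1) s(1)] w(1)] m(3)[OF s(1)] s by simp
    then show ?thesis using w(3)[of "m s"] log_slopes_le_nonneg[OF m(1) s(1)] m(3)[OF s(1)] by (simp add: near_sym)
  qed
  then have "witness e m (l t) y x"
    unfolding witness_def using w m(1) m(2)[OF w(1)] log_slopes_le_nonneg[OF w(2,1)] by simp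
  then show ?thesis by blast
qed

lemma witness_trans:
  assumes x: "x \<in> D_exp S" and y: "y \<in> D_exp S" and z: "z \<in> D_exp S"
    and l: "witness e l t x y" and m: "witness e' m u y z"
  shows "\<exists>k v. witness (e + e') k v x z"
proof -
  note L = witnessD[OF l] and M = witnessD[OF m]
  have e: "0 \<le> e" "0 \<le> e'" using witness_nonneg[OF x l] witness_nonneg[OF y m] by auto
  have slopes: "log_slopes_le (e + e') (\<lambda>s. m (l s))" using log_slopes_le_compose[OF L(2) M(2)] .
  show ?thesis
  proof (cases "l t \<le> u")
    case True
    have "near (e + e') (x s) (z (m (l s)))" if s: "0 \<le> s" "s < t" for s
    proof -
      have "l s < u" using log_slopes_le_less_iff(1)[OF L(2) s(1) L(1)] s True by simp
      then show ?thesis using near_trans[OF L(3)[OF s] M(3)] log_slopes_le_nonneg[OF L(2) s(1)] by blast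
    qed
    moreover have "cut z (m (l t)) \<le> e + e'"
      using witness_cut[OF y z m log_slopes_le_nonneg[OF L(2,1)] True] L(5) by linarith
    ultimately have "witness (e + e') (\<lambda>s. m (l s)) t x z"
      unfolding witness_def using slopes L e by auto
    then show ?thesis by blast
  next
    case False
    obtain l' where l': "log_slopes_le e l'" "\<And>s. 0 \<le> s \<Longrightarrow> l' (l s) = s" "\<And>s. 0 \<le> s \<Longrightarrow> l (l' s) = s"
      using log_slopes_le_inverse[OF L(2)] by blast
    \<comment> \<open>The second comparison stops first; v is its stopping time read in the clock of
      x.\<close>
    define v where "v = l' u"
    have v: "0 \<le> v" "l v = u" using log_slopes_le_nonneg[OF l'(1) M(1)] l'(3)[OF M(1)] by (auto simp: v_def)
    have vt: "v < t" using log_slopes_le_less_iff(1)[OF L(2) v(1) L(1)] v False by simp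
    have "near (e + e') (x s) (z (m (l s)))" if s: "0 \<le> s" "s < v" for s
    proof -
      have "l s < u" using log_slopes_le_less_iff(1)[OF L(2) s(1) v(1)] s v by simp
      then show ?thesis using near_trans[OF L(3)[OF s(1)] M(3)] log_slopes_le_nonneg[OF L(2) s(1)] s vt by auto
    qed
    moreover have "cut x v \<le> e + e'"
      using witness_cut[OF x y l v(1)] vt M(4) v(2) by auto
    ultimately have "witness (e + e') (\<lambda>s. m (l s)) v x z"
      unfolding witness_def using slopes v M(5) e by auto
    then show ?thesis by blast
  qed
qed

text \<open>The identity works with the stopping time 1 / e, where elapsed time alone makes
  \<open>cut\<close> small, or with the life time if x has died by then.\<close>

lemma witness_refl:
  assumes x: "x \<in> D_exp S" and e: "0 < e"
  shows "\<exists>l t. witness e l t x x"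
proof -
  have "\<exists>t\<ge>0. (\<forall>s. 0 \<le> s \<longrightarrow> s < t \<longrightarrow> x s \<noteq> None) \<and> cut x t \<le> e"
  proof (cases "x (1 / e) = None")
    case False
    have "x s \<noteq> None" if "0 \<le> s" "s < 1 / e" for s
      using False D_exp_None_mono[OF x that(1) less_imp_le[OF that(2)]] by metis
    moreover have "cut x (1 / e) \<le> 1 / (1 + 1 / e)" using e by (intro cut_le_time) auto
    moreover have "1 / (1 + 1 / e) \<le> e" using e by (simp add: field_simps)
    ultimately show ?thesis using e by (intro exI[of _ "1 / e"]) auto
  next
    case True
    then have "lifetime x \<le> ereal (1 / e)" using D_exp_None_iff[OF x, of "1/e"] e by simp
    then obtain T where T: "lifetime x = ereal T" "0 \<le> T" using lifetime_nonneg[of x] by (cases "lifetime x") auto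
    then have "x T = None" "\<And>s. 0 \<le> s \<Longrightarrow> s < T \<Longrightarrow> x s \<noteq> None" using D_exp_None_iff[OF x] by auto
    then show ?thesis using T e by (intro exI[of _ T]) (auto simp: cut_None)
  qed
  then obtain t where t: "0 \<le> t" "\<And>s. 0 \<le> s \<Longrightarrow> s < t \<Longrightarrow> x s \<noteq> None" "cut x t \<le> e" by blast
  have "near e (x s) (x s)" if "0 \<le> s" "s < t" for s
    using t(2)[OF that] D_exp_Some_topspace[OF x that(1)] e by (force simp: near_def)
  then have "witness e (\<lambda>s. s) t x x" unfolding witness_def using t e log_slopes_le_id by auto
  then show ?thesis by blast
qed

text \<open>Stopping at once costs at most 1, since cuts at time 0 never exceed 1. Thus the infimum
  in \<open>path_dist\<close> is taken over a nonempty set.\<close>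

lemma witness_one: "witness 1 (\<lambda>s. s) 0 x y"
  using cut_le_time[of 0 x] cut_le_time[of 0 y] by (simp add: witness_def log_slopes_le_id)

text \<open>Before t the cut of x has a positive lower bound, and a witness below it cannot stop
  there. The bound depends on x and t alone, so it is uniform in the other path.\<close>

lemma witness_covers:
  assumes x: "x \<in> D_exp S" and b: "bounded_before x t"
  obtains \<beta> where "0 < \<beta>" "\<And>e l u y. witness e l u x y \<Longrightarrow> e < \<beta> \<Longrightarrow> t \<le> u"
proof -
  obtain \<beta> where "0 < \<beta>" "\<And>s. 0 \<le> s \<Longrightarrow> s < t \<Longrightarrow> \<beta> \<le> cut x s" using cut_lower[OF x b] by blast
  then show ?thesis using that witnessD(1,4) by (metis leD le_less_trans not_le_imp_less)
qed

text \<open>The set of living times is open on the right; the extra room puts t strictly inside a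
  comparison, which leaves out its stopping time.\<close>

lemma alive_extend:
  assumes x: "x \<in> D_loc S" and t: "0 \<le> t" "x t \<noteq> None"
  obtains t' where "t < t'" "x t' \<noteq> None" "bounded_before x t'"
proof -
  obtain \<delta> where \<delta>: "0 < \<delta>" "\<And>r. t \<le> r \<Longrightarrow> r < t + \<delta> \<Longrightarrow> near 1 (x t) (x r)"
    using D_exp_right[OF D_loc_D_exp[OF x] t zero_less_one] by blast
  show ?thesis
  proof (rule that[of "t + \<delta> / 2"])
    show al: "x (t + \<delta> / 2) \<noteq> None" using near_not_None[OF \<delta>(2)[of "t + \<delta>/2"]] \<delta>(1) by auto
    show "bounded_before x (t + \<delta> / 2)" using bounded_before_alive[OF x _ al] t \<delta> by simp
  qed (use \<delta> in auto)
qed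

lemma witness_follow:
  assumes x: "x \<in> D_loc S" and t: "x t \<noteq> None" and r: "0 \<le> r" "r < t" and c: "0 < c"
  obtains e where "0 < e" "\<And>l u y. witness e l u x y \<Longrightarrow> \<bar>l r - r\<bar> \<le> c \<and> near c (x r) (y (l r))"
proof -
  obtain \<beta> where \<beta>: "0 < \<beta>" "\<And>e l u y. witness e l u x y \<Longrightarrow> e < \<beta> \<Longrightarrow> t \<le> u"
    using witness_covers[OF D_loc_D_exp[OF x] bounded_before_alive[OF x _ t]] r by auto
  \<comment> \<open>The bound 1 serves the linear estimate of the displacement,
    \<open>\<beta> / 2\<close> makes the comparison last up to t, c controls the values, and c / (2
    * r + 1) makes the displacement 2 * e * r at most c.\<close>
  define e where "e = min (min 1 (\<beta> / 2)) (min c (c / (2 * r + 1)))"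
  have e: "0 < e" "e \<le> 1" "e < \<beta>" "e \<le> c" "e \<le> c / (2 * r + 1)"
    using \<beta> c r by (auto simp: e_def)
  show ?thesis
  proof (rule that[OF e(1)])
    fix l u y assume lu: "witness e l u x y"
    have "near e (x r) (y (l r))" using witnessD(3)[OF lu r(1)] \<beta>(2)[OF lu e(3)] r by auto
    moreover have "\<bar>l r - r\<bar> \<le> 2 * e * r" using log_slopes_le_dist'[OF witnessD(2)[OF lu]] e r by simp
    moreover have "2 * e * r \<le> e * (2 * r + 1)" using e by (simp add: algebra_simps)
    moreover have "e * (2 * r + 1) \<le> c" using e(5) r by (simp add: field_simps)
    ultimately show "\<bar>l r - r\<bar> \<le> c \<and> near c (x r) (y (l r))" using near_mono e(4) by auto
  qed
qed

text \<open>The image of s may lie to the left of s, across a jump of y. The comparison is therefore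
  made slightly after s, where the image is still at or after s, and right-continuity of both paths
  brings it back.\<close>

lemma witness_imp_eq:
  assumes x: "x \<in> D_loc S" and y: "y \<in> D_loc S"
    and w: "\<And>e. 0 < e \<Longrightarrow> \<exists>l t. witness e l t x y"
    and s: "0 \<le> s" "x s \<noteq> None"
  shows "y s = x s"
proof -
  note x' = D_loc_D_exp[OF x] and y' = D_loc_D_exp[OF y]
  obtain t where t: "s < t" "x t \<noteq> None" using alive_extend[OF x s] by blast
  have approx: "\<exists>u. \<bar>u - r\<bar> \<le> c \<and> near c (x r) (y u)" if r: "s \<le> r" "r < t" and c: "0 < c" for r c
    using witness_follow[OF x t(2) _ r(2) c] w r(1) s(1) by (metis order_trans)
  have ys: "y s \<noteq> None"
  proof -
    \<comment> \<open>A midpoint moved by at most half the gap lands at or after s, and death is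
      absorbing: life of y there gives life at s.\<close>
    let ?r = "(s + t) / 2"
    obtain u where "\<bar>u - ?r\<bar> \<le> (t - s) / 2" "near ((t - s) / 2) (x ?r) (y u)"
      using approx[of ?r "(t - s)/2"] t by auto
    then have "s \<le> u" "y u \<noteq> None" using near_not_None by (auto simp: abs_le_iff field_simps)
    then show ?thesis using D_exp_None_mono[OF y' s(1), of u] by metis
  qed
  have close: "near c (x s) (y s)" if c: "0 < c" for c
  proof -
    obtain \<delta>1 where \<delta>1: "0 < \<delta>1" "\<And>r. s \<le> r \<Longrightarrow> r < s + \<delta>1 \<Longrightarrow> near (c / 3) (x s) (x r)"
      using D_exp_right[OF x' s, of "c/3"] c by auto
    obtain \<delta>2 where \<delta>2: "0 < \<delta>2" "\<And>r. s \<le> r \<Longrightarrow> r < s + \<delta>2 \<Longrightarrow> near (c / 3) (y s) (y r)"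
      using D_exp_right[OF y' s(1) ys, of "c/3"] c by auto
    \<comment> \<open>The image u of s + \<delta> lies in [s, s + 2 * \<delta>], inside the right
      neighbourhood of y, while s + \<delta> is inside that of x and before t.\<close>
    define \<delta> where "\<delta> = min (min \<delta>1 \<delta>2) (t - s) / 3"
    have \<delta>: "0 < \<delta>" "3 * \<delta> \<le> \<delta>1" "3 * \<delta> \<le> \<delta>2" "3 * \<delta> \<le> t - s" using \<delta>1 \<delta>2 t by (auto simp: \<delta>_def)
    obtain u where u: "\<bar>u - (s + \<delta>)\<bar> \<le> min \<delta> (c / 3)" "near (min \<delta> (c / 3)) (x (s + \<delta>)) (y u)"
      using approx[of "s + \<delta>" "min \<delta> (c/3)"] \<delta> c by auto
    have "near (c / 3) (x s) (x (s + \<delta>))" using \<delta>1 \<delta> by auto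
    moreover have "near (c / 3) (x (s + \<delta>)) (y u)" using u(2) by (rule near_mono) simp
    moreover have "near (c / 3) (y u) (y s)" using u(1) \<delta> by (intro near_sym[OF \<delta>2(2)]) (auto simp: abs_le_iff)
    ultimately have "near (c / 3 + c / 3 + c / 3) (x s) (y s)" by (blast intro: near_trans)
    then show ?thesis by simp
  qed
  obtain a b where ab: "x s = Some a" "y s = Some b" "a \<in> topspace S" "b \<in> topspace S"
    using close[OF zero_less_one] by (auto simp: near_def)
  have "d a b \<le> c" if "0 < c" for c using close[OF that] ab by (auto simp: near_def)
  then have "d a b \<le> 0" by (rule field_le_epsilon[of _ 0, simplified])
  then have "a = b" using M.zero[OF ab(3,4)] M.nonneg[of a b] by simp
  then show ?thesis using ab by simp
qed

section \<open>The infimum over witnesses as a metric\<close>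

definition path_dist :: "(real \<Rightarrow> 'a option) \<Rightarrow> (real \<Rightarrow> 'a option) \<Rightarrow> real" where
  "path_dist x y = Inf {e. 0 \<le> e \<and> (\<exists>l t. witness e l t x y)}"

lemma path_dist_le: "0 \<le> e \<Longrightarrow> witness e l t x y \<Longrightarrow> path_dist x y \<le> e"
  unfolding path_dist_def by (intro cInf_lower bdd_belowI[of _ 0]) auto

lemma path_dist_less:
  assumes "path_dist x y < e"
  obtains l t where "witness e l t x y"
proof -
  have "{e. 0 \<le> e \<and> (\<exists>l t. witness e l t x y)} \<noteq> {}" using witness_one[of x y] zero_le_one by blast
  from cInf_lessD[OF this, of e] obtain e' l t where "e' < e" "witness e' l t x y"
    using assms unfolding path_dist_def by blast
  then show ?thesis using that witness_mono less_imp_le by blast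
qed

lemma path_dist_nonneg: "0 \<le> path_dist x y"
  unfolding path_dist_def using witness_one[of x y] zero_le_one
  by (intro cInf_greatest) blast+

sublocale P: Metric_space "D_loc S" path_dist
proof
  fix x y :: "real \<Rightarrow> 'a option"
  show "0 \<le> path_dist x y" by (rule path_dist_nonneg)
  have "{e. 0 \<le> e \<and> (\<exists>l t. witness e l t x y)} = {e. 0 \<le> e \<and> (\<exists>l t. witness e l t y x)}"
    using witness_sym by blast
  then show "path_dist x y = path_dist y x" by (simp add: path_dist_def)
next
  fix x y assume x: "x \<in> D_loc S" and y: "y \<in> D_loc S"
  note x' = D_loc_D_exp[OF x] and y' = D_loc_D_exp[OF y]
  show "path_dist x y = 0 \<longleftrightarrow> x = y"
  proof
    assume "x = y"
    have "path_dist x x \<le> e" if "0 < e" for e using witness_refl[OF x' that] path_dist_le[of e] that by auto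
    then have "path_dist x x \<le> 0" by (rule field_le_epsilon[of _ 0, simplified])
    then show "path_dist x y = 0" using path_dist_nonneg[of x x] \<open>x = y\<close> by simp
  next
    assume 0: "path_dist x y = 0"
    have w: "\<exists>l t. witness e l t x y" "\<exists>l t. witness e l t y x" if "0 < e" for e
      using path_dist_less[of x y e] 0 that witness_sym by metis+
    show "x = y"
    proof
      fix s
      show "x s = y s"
      proof (cases "0 \<le> s")
        case True
        \<comment> \<open>\<open>witness_imp_eq\<close> speaks only of living times of its first
          path; both directions are needed to exclude that one path outlives the other.\<close>
        then show ?thesis
          using witness_imp_eq[OF x y w(1) True] witness_imp_eq[OF y x w(2) True] by metis
      next
        case False
        then have "x s = undefined" "y s = undefined"
          using x' y' by (auto simp: D_exp_def PiE_def extensional_def)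
        then show ?thesis by simp
      qed
    qed
  qed
  fix z assume z: "z \<in> D_loc S"
  show "path_dist x z \<le> path_dist x y + path_dist y z"
  proof (rule field_le_epsilon)
    fix e :: real assume e: "0 < e"
    obtain l t where lt: "witness (path_dist x y + e/2) l t x y" using path_dist_less[of x y "path_dist x y + e/2"] e by auto
    obtain m u where mu: "witness (path_dist y z + e/2) m u y z" using path_dist_less[of y z "path_dist y z + e/2"] e by auto
    obtain k v where "witness (path_dist x y + e/2 + (path_dist y z + e/2)) k v x z"
      using witness_trans[OF x' y' D_loc_D_exp[OF z] lt mu] by blast
    then have "path_dist x z \<le> path_dist x y + e/2 + (path_dist y z + e/2)"
      using path_dist_nonneg[of x y] path_dist_nonneg[of y z] e by (intro path_dist_le) auto
    then show "path_dist x z \<le> path_dist x y + path_dist y z + e" by simp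
  qed
qed

end

section \<open>Comparison with local Skorokhod convergence\<close>

lemma ennreal_tendsto_0_iff:
  fixes f :: "'b \<Rightarrow> ennreal"
  shows "(f \<longlongrightarrow> 0) F \<longleftrightarrow> (\<forall>e>0. \<forall>\<^sub>F k in F. f k \<le> ennreal e)"
proof
  assume "(f \<longlongrightarrow> 0) F"
  then have "\<forall>\<^sub>F k in F. f k < ennreal e" if "0 < e" for e using order_tendstoD(2)[of f 0 F "ennreal e"] that by simp
  then show "\<forall>e>0. \<forall>\<^sub>F k in F. f k \<le> ennreal e" by (blast intro: eventually_mono less_imp_le)
next
  assume *: "\<forall>e>0. \<forall>\<^sub>F k in F. f k \<le> ennreal e"
  show "(f \<longlongrightarrow> 0) F"
  proof (rule order_tendstoI)
    fix a :: ennreal assume "0 < a"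
    then obtain e where e: "0 < e" "ennreal e < a"
      by (metis dense ennreal_cases ennreal_less_zero_iff less_top_ennreal order_less_imp_triv top.not_eq_extremum ennreal_0)
    have "\<forall>\<^sub>F k in F. f k \<le> ennreal e" using * e by blast
    then show "\<forall>\<^sub>F k in F. f k < a" by eventually_elim (rule le_less_trans[OF _ e(2)])
  qed auto
qed

text \<open>\<delta> is a Lebesgue number of the cover of K by d'-balls of radius e / 2. Only a has
  to lie in K, because the whole d-ball around it lies in one ball of the cover.\<close>

lemma metrics_uniform_on_compact:
  assumes d: "metric_induces d S" and d': "metric_induces d' S" and K: "compactin S K" and e: "0 < e"
  obtains \<delta> where "0 < \<delta>" "\<And>a b. a \<in> K \<Longrightarrow> b \<in> topspace S \<Longrightarrow> d a b < \<delta> \<Longrightarrow> d' a b < e"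
proof -
  interpret M: Metric_space "topspace S" d using d by (simp add: metric_induces_def)
  interpret N: Metric_space "topspace S" d' using d' by (simp add: metric_induces_def)
  have M: "M.mtopology = S" and N: "N.mtopology = S" using d d' by (auto simp: metric_induces_def)
  have KS: "K \<subseteq> topspace S" using K compactin_subset_topspace by blast
  let ?C = "{N.mball z (e/2) |z. z \<in> topspace S}"
  have "compactin M.mtopology K" "K \<subseteq> \<Union>?C" using K M KS e by force+
  moreover have "openin M.mtopology U" if "U \<in> ?C" for U using that N.openin_mball M N by force
  ultimately have "\<exists>\<delta>>0. \<forall>a\<in>K. \<exists>U\<in>?C. M.mball a \<delta> \<subseteq> U" by (rule M.lebesgue_number)
  then obtain \<delta> where \<delta>: "0 < \<delta>" "\<And>a. a \<in> K \<Longrightarrow> \<exists>U\<in>?C. M.mball a \<delta> \<subseteq> U" by blast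
  show ?thesis
  proof (rule that[OF \<delta>(1)])
    fix a b assume ab: "a \<in> K" "b \<in> topspace S" "d a b < \<delta>"
    then obtain z where z: "z \<in> topspace S" "M.mball a \<delta> \<subseteq> N.mball z (e/2)" using \<delta>(2) by blast
    have "a \<in> M.mball a \<delta>" "b \<in> M.mball a \<delta>" using ab KS \<delta>(1) by auto
    then have "a \<in> N.mball z (e/2)" "b \<in> N.mball z (e/2)" using z by blast+
    then have "d' z a < e/2" "d' z b < e/2" "a \<in> topspace S" by simp_all
    then show "d' a b < e" using N.triangle''[of a z b] z(1) ab(2) by linarith
  qed
qed

lemma SUP_dist_change_metric:
  assumes d: "metric_induces d S" and d': "metric_induces d' S" and K: "compactin S K"
    and p: "\<And>s. s \<in> I \<Longrightarrow> p s \<in> K" and q: "\<forall>\<^sub>F k in F. \<forall>s\<in>I. q k s \<in> topspace S"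
    and lim: "((\<lambda>k. SUP s\<in>I. ennreal (d (p s) (q k s))) \<longlongrightarrow> 0) F"
  shows "((\<lambda>k. SUP s\<in>I. ennreal (d' (p s) (q k s))) \<longlongrightarrow> 0) F"
  unfolding ennreal_tendsto_0_iff
proof (intro allI impI)
  fix e :: real assume e: "0 < e"
  obtain \<delta> where \<delta>: "0 < \<delta>" "\<And>a b. a \<in> K \<Longrightarrow> b \<in> topspace S \<Longrightarrow> d a b < \<delta> \<Longrightarrow> d' a b < e"
    using metrics_uniform_on_compact[OF d d' K e] by blast
  have "\<forall>\<^sub>F k in F. (SUP s\<in>I. ennreal (d (p s) (q k s))) \<le> ennreal (\<delta> / 2)"
    using lim \<delta>(1) unfolding ennreal_tendsto_0_iff by simp
  with q show "\<forall>\<^sub>F k in F. (SUP s\<in>I. ennreal (d' (p s) (q k s))) \<le> ennreal e"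
  proof eventually_elim
    fix k assume k: "\<forall>s\<in>I. q k s \<in> topspace S" "(SUP s\<in>I. ennreal (d (p s) (q k s))) \<le> ennreal (\<delta> / 2)"
    show "(SUP s\<in>I. ennreal (d' (p s) (q k s))) \<le> ennreal e"
    proof (rule SUP_least)
      fix s assume s: "s \<in> I"
      have "ennreal (d (p s) (q k s)) \<le> ennreal (\<delta> / 2)" using k(2) s by (meson SUP_upper order_trans)
      then have "d (p s) (q k s) < \<delta>" using \<delta>(1) by (simp add: ennreal_le_iff)
      then have "d' (p s) (q k s) < e" using \<delta>(2) p s k(1) by blast
      then show "ennreal (d' (p s) (q k s)) \<le> ennreal e" by (simp add: ennreal_leI less_imp_le)
    qed
  qed
qed

context proper_metric begin

text \<open>The same time changes serve both metrics. Only the values of x have to stay in a compact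
  set, and they do up to the times in question; of the approximating paths it matters only that they
  are alive there.\<close>

lemma local_Skorokhod_convergent_change_metric:
  assumes xs: "\<And>k. xs k \<in> D_loc S" and x: "x \<in> D_loc S"
    and d1: "metric_induces d1 S" and d2: "metric_induces d2 S"
    and c: "local_Skorokhod_convergent S d1 xs x"
  shows "local_Skorokhod_convergent S d2 xs x"
proof -
  note x' = D_loc_D_exp[OF x]
  have in_S: "the (xs k r) \<in> topspace S" if "0 \<le> r" "ereal r < lifetime (xs k)" for k r
  proof -
    have "xs k r \<noteq> None" using D_exp_None_iff[OF D_loc_D_exp[OF xs] that(1)] that(2) by (simp add: not_le)
    then show ?thesis using D_exp_Some_topspace[OF D_loc_D_exp[OF xs] that(1)] by auto
  qed
  obtain l where l: "\<And>k. l k \<in> time_changes" and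
    c: "if lifetime x < \<infinity> \<and> compactly_contained S (trajectory x)
       then let T = real_of_ereal (lifetime x) in
         (\<forall>\<^sub>F k in sequentially. ereal (l k T) \<le> lifetime (xs k)) \<and>
         (\<lambda>k. SUP s\<in>{0..<T}. ennreal (d1 (the (x s)) (the (xs k (l k s))))) \<longlonglongrightarrow> 0 \<and>
         limitin (Alexandroff_compactification S) (\<lambda>k. xs k (l k T)) None sequentially \<and>
         (\<lambda>k. log_density_norm (l k) T) \<longlonglongrightarrow> 0
       else \<forall>t\<ge>0. ereal t < lifetime x \<longrightarrow>
         (\<forall>\<^sub>F k in sequentially. ereal (l k t) < lifetime (xs k)) \<and>
         (\<lambda>k. SUP s\<in>{0..t}. ennreal (d1 (the (x s)) (the (xs k (l k s))))) \<longlonglongrightarrow> 0 \<and>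
         (\<lambda>k. log_density_norm (l k) t) \<longlonglongrightarrow> 0"
    using c unfolding local_Skorokhod_convergent_def by blast
  have l0: "0 \<le> l k s" if "0 \<le> s" for k s
    using time_change_less[OF l, of 0 s k] time_change_0[OF l] that by (cases "s = 0") (auto intro: less_imp_le)
  show ?thesis
    unfolding local_Skorokhod_convergent_def
  proof (intro exI[of _ l] conjI allI l)
    show "if lifetime x < \<infinity> \<and> compactly_contained S (trajectory x)
       then let T = real_of_ereal (lifetime x) in
         (\<forall>\<^sub>F k in sequentially. ereal (l k T) \<le> lifetime (xs k)) \<and>
         (\<lambda>k. SUP s\<in>{0..<T}. ennreal (d2 (the (x s)) (the (xs k (l k s))))) \<longlonglongrightarrow> 0 \<and>
         limitin (Alexandroff_compactification S) (\<lambda>k. xs k (l k T)) None sequentially \<and>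
         (\<lambda>k. log_density_norm (l k) T) \<longlonglongrightarrow> 0
       else \<forall>t\<ge>0. ereal t < lifetime x \<longrightarrow>
         (\<forall>\<^sub>F k in sequentially. ereal (l k t) < lifetime (xs k)) \<and>
         (\<lambda>k. SUP s\<in>{0..t}. ennreal (d2 (the (x s)) (the (xs k (l k s))))) \<longlonglongrightarrow> 0 \<and>
         (\<lambda>k. log_density_norm (l k) t) \<longlonglongrightarrow> 0"
    proof (cases "lifetime x < \<infinity> \<and> compactly_contained S (trajectory x)")
      case True
      then obtain T where T: "lifetime x = ereal T" using lifetime_nonneg[of x] by (cases "lifetime x") auto
      obtain K where K: "compactin S K" "trajectory x \<subseteq> K" using True by (auto simp: compactly_contained_def)
      have c': "\<forall>\<^sub>F k in sequentially. ereal (l k T) \<le> lifetime (xs k)"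
         "(\<lambda>k. SUP s\<in>{0..<T}. ennreal (d1 (the (x s)) (the (xs k (l k s))))) \<longlonglongrightarrow> 0"
         "limitin (Alexandroff_compactification S) (\<lambda>k. xs k (l k T)) None sequentially"
         "(\<lambda>k. log_density_norm (l k) T) \<longlonglongrightarrow> 0"
        using c True T by (auto simp: Let_def)
      have "(\<lambda>k. SUP s\<in>{0..<T}. ennreal (d2 (the (x s)) (the (xs k (l k s))))) \<longlonglongrightarrow> 0"
      proof (rule SUP_dist_change_metric[OF d1 d2 K(1) _ _ c'(2)])
        show "the (x s) \<in> K" if "s \<in> {0..<T}" for s using that K(2) T by (force simp: trajectory_def)
        show "\<forall>\<^sub>F k in sequentially. \<forall>s\<in>{0..<T}. the (xs k (l k s)) \<in> topspace S"
          using c'(1)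
        proof eventually_elim
          fix k assume k: "ereal (l k T) \<le> lifetime (xs k)"
          show "\<forall>s\<in>{0..<T}. the (xs k (l k s)) \<in> topspace S"
          proof
            fix s assume s: "s \<in> {0..<T}"
            then have "ereal (l k s) < ereal (l k T)" using time_change_less[OF l] by auto
            then have "ereal (l k s) < lifetime (xs k)" using k by (rule less_le_trans)
            then show "the (xs k (l k s)) \<in> topspace S" using in_S[OF l0[of s k], of k] s by auto
          qed
        qed
      qed
      then show ?thesis using c' True T by (simp add: Let_def)
    next
      case False
      have "(\<lambda>k. SUP s\<in>{0..t}. ennreal (d2 (the (x s)) (the (xs k (l k s))))) \<longlonglongrightarrow> 0" if t: "0 \<le> t" "ereal t < lifetime x" for t
      proof -
        have c': "\<forall>\<^sub>F k in sequentially. ereal (l k t) < lifetime (xs k)"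
          "(\<lambda>k. SUP s\<in>{0..t}. ennreal (d1 (the (x s)) (the (xs k (l k s))))) \<longlonglongrightarrow> 0"
          using c False t by (auto split: if_splits)
        have xt: "x t \<noteq> None" using D_exp_None_iff[OF x' t(1)] t(2) by (simp add: not_le)
        then obtain B where B: "\<forall>s\<in>{0..<t}. \<exists>a. x s = Some a \<and> g a \<le> B"
          using bounded_before_alive[OF x t(1)] by (auto simp: bounded_before_def)
        \<comment> \<open>\<open>bounded_before\<close> omits the endpoint t, so the height at t is
          included separately.\<close>
        let ?K = "{a \<in> topspace S. g a \<le> max B (g (the (x t)))}"
        have xK: "the (x s) \<in> ?K" if st: "s \<in> {0..t}" for s
        proof (cases "s = t")
          case True then show ?thesis using xt D_exp_Some_topspace[OF x' t(1)] by auto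
        next
          case False
          then obtain a where "x s = Some a" "g a \<le> B" using B st by fastforce
          then show ?thesis using D_exp_Some_topspace[OF x', of s a] st by auto
        qed
        show ?thesis
        proof (rule SUP_dist_change_metric[OF d1 d2 compactin_sublevel xK _ c'(2)])
          show "\<forall>\<^sub>F k in sequentially. \<forall>s\<in>{0..t}. the (xs k (l k s)) \<in> topspace S"
            using c'(1)
          proof eventually_elim
            fix k assume k: "ereal (l k t) < lifetime (xs k)"
            show "\<forall>s\<in>{0..t}. the (xs k (l k s)) \<in> topspace S"
            proof
              fix s assume s: "s \<in> {0..t}"
              then have "ereal (l k s) \<le> ereal (l k t)" using time_change_less[OF l, of s t k] by (cases "s = t") auto
              then have "ereal (l k s) < lifetime (xs k)" using k by (rule le_less_trans)
              then show "the (xs k (l k s)) \<in> topspace S" using in_S[OF l0[of s k], of k] s by auto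
            qed
          qed
        qed
      qed
      then show ?thesis using c False by (simp add: if_not_P del: not_less) 
    qed
  qed
qed

section \<open>Vanishing witnesses and convergence of paths\<close>

definition height_inv :: "'a option \<Rightarrow> real" where
  "height_inv p = (case p of None \<Rightarrow> 0 | Some a \<Rightarrow> 1 / (1 + g a))"

lemma cut_le_height_inv: "x \<in> D_exp S \<Longrightarrow> 0 \<le> t \<Longrightarrow> cut x t \<le> height_inv (x t)"
  by (auto simp: cut_def height_inv_def split: option.split)

text \<open>Together with \<Delta>, the sets where \<open>g\<close> exceeds a bound form a
  neighbourhood base of \<Delta>: sublevel sets of \<open>g\<close> are compact, and
  \<open>g\<close> is bounded on each compact set.\<close>

lemma limitin_None_iff:
  assumes f: "\<And>k. f k \<in> topspace (Alexandroff_compactification S)"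
  shows "limitin (Alexandroff_compactification S) f None F \<longleftrightarrow> (\<forall>e>0. \<forall>\<^sub>F k in F. height_inv (f k) \<le> e)"
proof
  assume L: "limitin (Alexandroff_compactification S) f None F"
  show "\<forall>e>0. \<forall>\<^sub>F k in F. height_inv (f k) \<le> e"
  proof (intro allI impI)
    fix e :: real assume e: "0 < e"
    let ?K = "{a \<in> topspace S. g a \<le> 1 / e}"
    have "closedin S ?K"
      using compactin_imp_closedin[OF M.Hausdorff_space_mtopology] compactin_sublevel by (simp add: mtopology_eq)
    then have "openin (Alexandroff_compactification S) (insert None (Some ` (topspace S - ?K)))"
      using compactin_sublevel unfolding openin_Alexandroff_compactification by blast
    then have "\<forall>\<^sub>F k in F. f k \<in> insert None (Some ` (topspace S - ?K))" using L unfolding limitin_def by blast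
    then show "\<forall>\<^sub>F k in F. height_inv (f k) \<le> e"
    proof eventually_elim
      fix k assume "f k \<in> insert None (Some ` (topspace S - ?K))"
      then consider "f k = None" | a where "f k = Some a" "a \<in> topspace S" "1 / e < g a" by force
      then show "height_inv (f k) \<le> e"
      proof cases
        case 2
        then have "1 / (1 + g a) \<le> 1 / (1 / e)" using e by (intro divide_left_mono mult_pos_pos) (auto intro: add_pos_nonneg height_nonneg)
        then show ?thesis using 2 by (simp add: height_inv_def)
      qed (use e in \<open>simp add: height_inv_def\<close>)
    qed
  qed
next
  assume *: "\<forall>e>0. \<forall>\<^sub>F k in F. height_inv (f k) \<le> e"
  show "limitin (Alexandroff_compactification S) f None F"
    unfolding limitin_def
  proof (intro conjI allI impI)
    fix U assume U: "openin (Alexandroff_compactification S) U \<and> None \<in> U"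
    then obtain C where C: "compactin S C" "U = insert None (Some ` (topspace S - C))"
      unfolding openin_Alexandroff_compactification by blast
    obtain B where B: "\<And>a. a \<in> C \<Longrightarrow> a \<in> topspace S \<and> g a \<le> B" using compactin_height_bound[OF C(1)] by blast
    have "\<forall>\<^sub>F k in F. height_inv (f k) \<le> 1 / (2 + \<bar>B\<bar>)" using * by (simp add: add_pos_nonneg)
    then show "\<forall>\<^sub>F k in F. f k \<in> U"
    proof eventually_elim
      fix k assume k: "height_inv (f k) \<le> 1 / (2 + \<bar>B\<bar>)"
      show "f k \<in> U"
      proof (cases "f k")
        case (Some a)
        then have aS: "a \<in> topspace S" using f[of k] by auto
        have "a \<notin> C"
        proof
          assume "a \<in> C"
          then have "1 + g a < 2 + \<bar>B\<bar>" using B[of a] by auto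
          then have "1 / (2 + \<bar>B\<bar>) < 1 / (1 + g a)"
            using height_nonneg[OF aS] by (intro divide_strict_left_mono mult_pos_pos) auto
          then show False using k Some by (simp add: height_inv_def)
        qed
        then show ?thesis using C aS Some by auto
      qed (use C in auto)
    qed
  qed auto
qed

lemma D_exp_in_Alexandroff: "x \<in> D_exp S \<Longrightarrow> 0 \<le> t \<Longrightarrow> x t \<in> topspace (Alexandroff_compactification S)"
  by (auto simp: D_exp_def PiE_def Pi_def)

text \<open>If y died before \<open>l t\<close>, surjectivity of \<open>l\<close> would make its
  life time an image \<open>l s\<close> with s < t, where y is alive.\<close>

lemma alive_imp_lifetime:
  assumes y: "y \<in> D_exp S" and l: "log_slopes_le e l" and t: "0 \<le> t"
    and al: "\<And>s. 0 \<le> s \<Longrightarrow> s < t \<Longrightarrow> y (l s) \<noteq> None"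
  shows "ereal (l t) \<le> lifetime y"
proof (rule ccontr)
  assume "\<not> ereal (l t) \<le> lifetime y"
  then have lt: "lifetime y < ereal (l t)" by simp
  then obtain v where v: "lifetime y = ereal v" "0 \<le> v" "v < l t" using lifetime_nonneg[of y] by (cases "lifetime y") auto
  obtain s where s: "0 \<le> s" "l s = v" using log_slopes_le_bij[OF l] v(2) by (metis atLeast_iff bij_betw_def imageE)
  have "s < t" using log_slopes_le_less_iff(1)[OF l s(1) t] s v by simp
  then have "y v \<noteq> None" using al s by auto
  then show False using D_exp_None_iff[OF y v(2)] v by simp
qed

lemma SUP_near_le:
  assumes "\<And>s. s \<in> I \<Longrightarrow> near e (x s) (y (l s))"
  shows "(SUP s\<in>I. ennreal (d (the (x s)) (the (y (l s))))) \<le> ennreal e"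
  using near_dist[OF assms] by (intro SUP_least ennreal_leI) auto

lemma ennreal_squeeze_0:
  assumes "\<forall>\<^sub>F k in sequentially. f k \<le> ennreal (e k)" "e \<longlonglongrightarrow> 0"
  shows "f \<longlonglongrightarrow> 0"
proof (rule tendsto_sandwich[OF _ assms(1) tendsto_const])
  show "(\<lambda>k. ennreal (e k)) \<longlonglongrightarrow> 0" using tendsto_ennrealI[OF assms(2)] by simp
qed simp

lemma witness_imp_convergent:
  assumes xs: "\<And>k. xs k \<in> D_loc S" and x: "x \<in> D_loc S"
    and w: "\<And>k. witness (e k) (l k) (u k) x (xs k)" and e: "e \<longlonglongrightarrow> 0"
  shows "local_Skorokhod_convergent S d xs x"
proof -
  note x' = D_loc_D_exp[OF x] and xs' = D_loc_D_exp[OF xs]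
  have e0: "0 \<le> e k" for k using witness_nonneg[OF x' w] .
  have norm: "(\<lambda>k. log_density_norm (l k) t) \<longlonglongrightarrow> 0" for t
    by (rule ennreal_squeeze_0[OF always_eventually e]) (use log_slopes_le_log_density_norm witnessD(2)[OF w] e0 in blast)
  have ev: "\<forall>\<^sub>F k in sequentially. e k < \<beta>" if "0 < \<beta>" for \<beta> using order_tendstoD(2)[OF e that] .
  show ?thesis
    unfolding local_Skorokhod_convergent_def
  proof (intro exI[of _ l] conjI allI)
    show "l k \<in> time_changes" for k using log_slopes_le_time_changes witnessD(2)[OF w] by blast
    show "if lifetime x < \<infinity> \<and> compactly_contained S (trajectory x)
       then let T = real_of_ereal (lifetime x) in
         (\<forall>\<^sub>F k in sequentially. ereal (l k T) \<le> lifetime (xs k)) \<and>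
         (\<lambda>k. SUP s\<in>{0..<T}. ennreal (d (the (x s)) (the (xs k (l k s))))) \<longlonglongrightarrow> 0 \<and>
         limitin (Alexandroff_compactification S) (\<lambda>k. xs k (l k T)) None sequentially \<and>
         (\<lambda>k. log_density_norm (l k) T) \<longlonglongrightarrow> 0
       else \<forall>t\<ge>0. ereal t < lifetime x \<longrightarrow>
         (\<forall>\<^sub>F k in sequentially. ereal (l k t) < lifetime (xs k)) \<and>
         (\<lambda>k. SUP s\<in>{0..t}. ennreal (d (the (x s)) (the (xs k (l k s))))) \<longlonglongrightarrow> 0 \<and>
         (\<lambda>k. log_density_norm (l k) t) \<longlonglongrightarrow> 0"
    proof (cases "lifetime x < \<infinity> \<and> compactly_contained S (trajectory x)")
      case True
      then obtain T where T: "lifetime x = ereal T" "0 \<le> T" using lifetime_nonneg[of x] by (cases "lifetime x") auto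
      have b: "bounded_before x T" using True bounded_before_lifetime[OF x' T(1)] by simp
      obtain \<beta> where \<beta>: "0 < \<beta>" "\<And>e l u y. witness e l u x y \<Longrightarrow> e < \<beta> \<Longrightarrow> T \<le> u"
        using witness_covers[OF x' b] by blast
      \<comment> \<open>A comparison beyond T would make x alive at T. With
        \<open>witness_covers\<close> the stopping time is eventually exactly the life time.\<close>
      have "u k \<le> T" for k
      proof (rule ccontr)
        assume "\<not> u k \<le> T"
        then have "x T \<noteq> None" using witnessD(3)[OF w T(2), of k] near_not_None by auto
        then show False using D_exp_None_iff[OF x' T(2)] T by simp
      qed
      then have uT: "\<forall>\<^sub>F k in sequentially. u k = T"
        using ev[OF \<beta>(1)] \<beta>(2)[OF w] by (auto elim!: eventually_mono intro: antisym)
      have "\<forall>\<^sub>F k in sequentially. ereal (l k T) \<le> lifetime (xs k)"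
        using uT
      proof eventually_elim
        fix k assume "u k = T"
        then show "ereal (l k T) \<le> lifetime (xs k)"
          using witnessD(3)[OF w, of _ k] near_not_None by (intro alive_imp_lifetime[OF xs' witnessD(2)[OF w] T(2)]) blast
      qed
      moreover have "(\<lambda>k. SUP s\<in>{0..<T}. ennreal (d (the (x s)) (the (xs k (l k s))))) \<longlonglongrightarrow> 0"
      proof (rule ennreal_squeeze_0[OF _ e])
        show "\<forall>\<^sub>F k in sequentially. (SUP s\<in>{0..<T}. ennreal (d (the (x s)) (the (xs k (l k s))))) \<le> ennreal (e k)"
          using uT by eventually_elim (intro SUP_near_le witnessD(3)[OF w], auto)
      qed
      moreover have "limitin (Alexandroff_compactification S) (\<lambda>k. xs k (l k T)) None sequentially"
      proof (subst limitin_None_iff)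
        show "xs k (l k T) \<in> topspace (Alexandroff_compactification S)" for k
          by (rule D_exp_in_Alexandroff[OF xs' log_slopes_le_nonneg[OF witnessD(2)[OF w] T(2)]])
        show "\<forall>e>0. \<forall>\<^sub>F k in sequentially. height_inv (xs k (l k T)) \<le> e"
        proof (intro allI impI)
          fix c :: real assume c: "0 < c"
          \<comment> \<open>A lower bound for the reciprocal time at \<open>l k T\<close> once e k <
            1. When e k is below it, the small cut at \<open>l k T\<close> can only come from the
            height, so the value approaches \<Delta>.\<close>
          let ?m = "1 / (1 + exp 1 * T)"
          have m: "0 < ?m" using T(2) by (simp add: add_pos_nonneg)
          show "\<forall>\<^sub>F k in sequentially. height_inv (xs k (l k T)) \<le> c"
            using uT ev[OF m] ev[OF c] ev[OF zero_less_one]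
          proof eventually_elim
            fix k assume k: "u k = T" "e k < ?m" "e k < c" "e k < 1"
            have lT: "0 \<le> l k T" using log_slopes_le_nonneg[OF witnessD(2)[OF w] T(2)] .
            have "l k T \<le> exp (e k) * T" using log_slopes_le_upper[OF witnessD(2)[OF w] T(2)] .
            also have "\<dots> \<le> exp 1 * T" using k T by (intro mult_right_mono) auto
            finally have "?m \<le> 1 / (1 + l k T)" using lT by (intro divide_left_mono mult_pos_pos) auto
            moreover have "cut (xs k) (l k T) \<le> e k" using witnessD(5)[OF w, of k] k by simp
            ultimately have "height_inv (xs k (l k T)) \<le> e k" using k e0[of k]
              by (auto simp: cut_def height_inv_def min_def split: option.splits if_splits)
            then show "height_inv (xs k (l k T)) \<le> c" using k by simp
          qed
        qed
      qed
      ultimately show ?thesis using True T norm by (simp add: Let_def)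
    next
      case False
      have "(\<forall>\<^sub>F k in sequentially. ereal (l k t) < lifetime (xs k)) \<and>
         (\<lambda>k. SUP s\<in>{0..t}. ennreal (d (the (x s)) (the (xs k (l k s))))) \<longlonglongrightarrow> 0"
        if t: "0 \<le> t" "ereal t < lifetime x" for t
      proof -
        have xt: "x t \<noteq> None" using D_exp_None_iff[OF x' t(1)] t(2) by (simp add: not_le)
        \<comment> \<open>The supremum includes s = t, while a witness compares only before its
          stopping time; hence the detour through t' > t.\<close>
        obtain t' where t': "t < t'" "bounded_before x t'" using alive_extend[OF x t(1) xt] by blast
        obtain \<beta> where \<beta>: "0 < \<beta>" "\<And>e l u y. witness e l u x y \<Longrightarrow> e < \<beta> \<Longrightarrow> t' \<le> u"
          using witness_covers[OF x' t'(2)] by blast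
        have u: "\<forall>\<^sub>F k in sequentially. t < u k"
          using ev[OF \<beta>(1)] by eventually_elim (use \<beta>(2)[OF w] t'(1) in \<open>auto intro: less_le_trans\<close>)
        have n: "\<forall>\<^sub>F k in sequentially. \<forall>s\<in>{0..t}. near (e k) (x s) (xs k (l k s))"
          using u by eventually_elim (auto intro: witnessD(3)[OF w])
        have "\<forall>\<^sub>F k in sequentially. ereal (l k t) < lifetime (xs k)"
          using n
        proof eventually_elim
          fix k assume "\<forall>s\<in>{0..t}. near (e k) (x s) (xs k (l k s))"
          then have "near (e k) (x t) (xs k (l k t))" using t(1) by auto
          then have "xs k (l k t) \<noteq> None" using near_not_None by blast
          then show "ereal (l k t) < lifetime (xs k)"
            using D_exp_None_iff[OF xs' log_slopes_le_nonneg[OF witnessD(2)[OF w] t(1)], of k k] by (simp add: not_le)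
        qed
        moreover have "(\<lambda>k. SUP s\<in>{0..t}. ennreal (d (the (x s)) (the (xs k (l k s))))) \<longlonglongrightarrow> 0"
          by (rule ennreal_squeeze_0[OF _ e]) (use n in \<open>eventually_elim, intro SUP_near_le, auto\<close>)
        ultimately show ?thesis ..
      qed
      then show ?thesis unfolding if_not_P[OF False] using norm by blast
    qed
  qed
qed

text \<open>This is the second case of the definition of convergence: x either lives forever, and
  time makes the cut small, or has unbounded heights before a finite death.\<close>

lemma alive_small_cut:
  assumes x': "x \<in> D_exp S" and nc: "\<not> (lifetime x < \<infinity> \<and> compactly_contained S (trajectory x))" and e: "0 < e"
  obtains t where "0 \<le> t" "x t \<noteq> None" "cut x t \<le> e"
proof (cases "lifetime x < \<infinity>")
  case True
  then have "\<not> compactly_contained S (trajectory x)" using nc by simp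
  then have "\<not> (\<exists>B. \<forall>a\<in>trajectory x. g a \<le> B)" using trajectory_subset[OF x'] by (simp add: compactly_contained_iff)
  then obtain a where "a \<in> trajectory x" "1 / e < g a" by (meson not_le)
  then obtain s where s: "0 \<le> s" "x s = Some a" by (auto simp: trajectory_eq[OF x'])
  have "0 \<le> g a" using height_nonneg D_exp_Some_topspace[OF x' s] by blast
  then have "1 / (1 + g a) \<le> 1 / (1 / e)" using \<open>1 / e < g a\<close> e
    by (intro divide_left_mono mult_pos_pos) auto
  then show ?thesis using that s by (simp add: cut_def)
next
  case inf: False
  have "cut x (1 / e) \<le> 1 / (1 + 1 / e)" using e by (intro cut_le_time) auto
  moreover have "1 / (1 + 1 / e) \<le> e" using e by (simp add: field_simps)
  moreover have "x (1 / e) \<noteq> None" using D_exp_None_iff[OF x', of "1/e"] inf e by auto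
  ultimately show ?thesis using that[of "1 / e"] e by auto
qed

lemma convergent_imp_witness:
  assumes xs: "\<And>k. xs k \<in> D_loc S" and x: "x \<in> D_loc S"
    and c: "local_Skorokhod_convergent S d xs x" and e: "0 < e"
  shows "\<forall>\<^sub>F k in sequentially. \<exists>m t. witness e m t x (xs k)"
proof -
  note x' = D_loc_D_exp[OF x] and xs' = D_loc_D_exp[OF xs]
  obtain l where l: "\<And>k. l k \<in> time_changes" and
    c: "if lifetime x < \<infinity> \<and> compactly_contained S (trajectory x)
       then let T = real_of_ereal (lifetime x) in
         (\<forall>\<^sub>F k in sequentially. ereal (l k T) \<le> lifetime (xs k)) \<and>
         (\<lambda>k. SUP s\<in>{0..<T}. ennreal (d (the (x s)) (the (xs k (l k s))))) \<longlonglongrightarrow> 0 \<and>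
         limitin (Alexandroff_compactification S) (\<lambda>k. xs k (l k T)) None sequentially \<and>
         (\<lambda>k. log_density_norm (l k) T) \<longlonglongrightarrow> 0
       else \<forall>t\<ge>0. ereal t < lifetime x \<longrightarrow>
         (\<forall>\<^sub>F k in sequentially. ereal (l k t) < lifetime (xs k)) \<and>
         (\<lambda>k. SUP s\<in>{0..t}. ennreal (d (the (x s)) (the (xs k (l k s))))) \<longlonglongrightarrow> 0 \<and>
         (\<lambda>k. log_density_norm (l k) t) \<longlonglongrightarrow> 0"
    using c unfolding local_Skorokhod_convergent_def by blast
  have l0: "0 \<le> l k s" if "0 \<le> s" for k s
    using time_change_less[OF l, of 0 s k] time_change_0[OF l] that by (cases "s = 0") (auto intro: less_imp_le)
  have nearI': "near \<delta> (x s) (xs k (l k s))"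
    if s: "0 \<le> s" "x s \<noteq> None" "ereal (l k s) < lifetime (xs k)" "s \<in> I"
      "(SUP s\<in>I. ennreal (d (the (x s)) (the (xs k (l k s))))) \<le> ennreal \<delta>" "0 < \<delta>" for k s \<delta> I
  proof (rule nearI[OF x' xs' s(1) l0[OF s(1)] s(2)])
    show "xs k (l k s) \<noteq> None" using D_exp_None_iff[OF xs' l0[OF s(1)], of k k] s(3) by (simp add: not_le)
    have "ennreal (d (the (x s)) (the (xs k (l k s)))) \<le> ennreal \<delta>" using s(4,5) by (meson SUP_upper order_trans)
    then show "d (the (x s)) (the (xs k (l k s))) \<le> \<delta>" using s(6) by (simp add: ennreal_le_iff)
  qed
  show ?thesis
  proof (cases "lifetime x < \<infinity> \<and> compactly_contained S (trajectory x)")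
    case True
    then obtain T where T: "lifetime x = ereal T" "0 \<le> T" using lifetime_nonneg[of x] by (cases "lifetime x") auto
    have c': "\<forall>\<^sub>F k in sequentially. ereal (l k T) \<le> lifetime (xs k)"
       "(\<lambda>k. SUP s\<in>{0..<T}. ennreal (d (the (x s)) (the (xs k (l k s))))) \<longlonglongrightarrow> 0"
       "limitin (Alexandroff_compactification S) (\<lambda>k. xs k (l k T)) None sequentially"
       "(\<lambda>k. log_density_norm (l k) T) \<longlonglongrightarrow> 0"
      using c True T by (auto simp: Let_def)
    have Al: "xs k (l k T) \<in> topspace (Alexandroff_compactification S)" for k
      by (rule D_exp_in_Alexandroff[OF xs' l0[OF T(2)]])
    have "\<forall>\<^sub>F k in sequentially. (SUP s\<in>{0..<T}. ennreal (d (the (x s)) (the (xs k (l k s))))) \<le> ennreal e"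
      "\<forall>\<^sub>F k in sequentially. log_density_norm (l k) T \<le> ennreal e"
      "\<forall>\<^sub>F k in sequentially. height_inv (xs k (l k T)) \<le> e"
      using c'(2,4) c'(3)[unfolded limitin_None_iff[of "\<lambda>k. xs k (l k T)", OF Al]] e unfolding ennreal_tendsto_0_iff by blast+
    with c'(1) show ?thesis
    proof eventually_elim
      fix k assume k: "ereal (l k T) \<le> lifetime (xs k)"
        "(SUP s\<in>{0..<T}. ennreal (d (the (x s)) (the (xs k (l k s))))) \<le> ennreal e"
        "log_density_norm (l k) T \<le> ennreal e" "height_inv (xs k (l k T)) \<le> e"
      obtain m where m: "log_slopes_le e m" "\<And>s. s \<le> T \<Longrightarrow> m s = l k s"
        using time_change_log_slopes_le[OF l less_imp_le[OF e] T(2) k(3)] by blast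
      have "near e (x s) (xs k (m s))" if s: "0 \<le> s" "s < T" for s
      proof -
        have "x s \<noteq> None" using D_exp_None_iff[OF x' s(1)] s(2) T(1) by simp
        moreover have "ereal (l k s) < lifetime (xs k)" using time_change_less[OF l s, of k] k(1) by (metis less_ereal.simps(1) less_le_trans)
        ultimately show ?thesis using nearI'[OF s(1) _ _ _ k(2) e] s m(2) by simp
      qed
      moreover have "cut x T \<le> e" using D_exp_None_iff[OF x' T(2)] T(1) e by (simp add: cut_None)
      moreover have "cut (xs k) (m T) \<le> e" using cut_le_height_inv[OF xs' l0[OF T(2)], of k k] k(4) m(2) by auto
      ultimately have "witness e m T x (xs k)" using T(2) m(1) by (auto simp: witness_def)
      then show "\<exists>m t. witness e m t x (xs k)" by blast
    qed
  next
    case False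
    \<comment> \<open>Half of e is kept for carrying the bound from x at t to the approximating path
      at \<open>m t\<close>.\<close>
    obtain t where t: "0 \<le> t" "x t \<noteq> None" "cut x t \<le> e / 2"
      using alive_small_cut[OF x' False, of "e/2"] e by auto
    have "ereal t < lifetime x" using D_exp_None_iff[OF x' t(1)] t(2) by (simp add: not_le)
    then have c': "\<forall>\<^sub>F k in sequentially. ereal (l k t) < lifetime (xs k)"
      "(\<lambda>k. SUP s\<in>{0..t}. ennreal (d (the (x s)) (the (xs k (l k s))))) \<longlonglongrightarrow> 0"
      "(\<lambda>k. log_density_norm (l k) t) \<longlonglongrightarrow> 0"
      using c[unfolded if_not_P[OF False]] t(1) by auto
    have e2: "0 < e / 2" using e by simp
    have "\<forall>\<^sub>F k in sequentially. (SUP s\<in>{0..t}. ennreal (d (the (x s)) (the (xs k (l k s))))) \<le> ennreal (e/2)"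
      "\<forall>\<^sub>F k in sequentially. log_density_norm (l k) t \<le> ennreal (e/2)"
      using c'(2,3) e2 unfolding ennreal_tendsto_0_iff by blast+
    with c'(1) show ?thesis
    proof eventually_elim
      fix k assume k: "ereal (l k t) < lifetime (xs k)"
        "(SUP s\<in>{0..t}. ennreal (d (the (x s)) (the (xs k (l k s))))) \<le> ennreal (e/2)"
        "log_density_norm (l k) t \<le> ennreal (e/2)"
      obtain m where m: "log_slopes_le (e/2) m" "\<And>s. s \<le> t \<Longrightarrow> m s = l k s"
        using time_change_log_slopes_le[OF l less_imp_le[OF e2] t(1) k(3)] by blast
      have n: "near (e/2) (x s) (xs k (m s))" if s: "0 \<le> s" "s \<le> t" for s
      proof -
        have "x s \<noteq> None" using D_exp_None_mono[OF x' s] t(2) by auto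
        moreover have "ereal (l k s) \<le> ereal (l k t)" using time_change_less[OF l s(1), of t k] s(2) by (cases "s = t") auto
        then have "ereal (l k s) < lifetime (xs k)" using k(1) by (rule le_less_trans)
        ultimately show ?thesis using nearI'[OF s(1) _ _ _ k(2) e2] s m(2) by simp
      qed
      have "cut (xs k) (m t) \<le> e" using cut_near[of "e/2" x t "xs k" m, OF n m(1) t(1)] t(1,3) by linarith
      then have "witness e m t x (xs k)"
        unfolding witness_def using t m n near_mono[of "e/2" _ _ e] log_slopes_le_mono[of "e/2" m e] e by auto
      then show "\<exists>m t. witness e m t x (xs k)" by blast
    qed
  qed
qed

lemma limitin_path_dist_iff:
  assumes xs: "\<And>k. xs k \<in> D_loc S" and x: "x \<in> D_loc S"
  shows "limitin P.mtopology xs x sequentially \<longleftrightarrow> local_Skorokhod_convergent S d xs x"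
proof
  assume L: "limitin P.mtopology xs x sequentially"
  \<comment> \<open>The slack is there because the infimum need not be attained.\<close>
  define e where "e k = path_dist x (xs k) + 1 / real (Suc k)" for k
  have "\<exists>l t. witness (e k) l t x (xs k)" for k
  proof -
    have "path_dist x (xs k) < e k" by (simp add: e_def)
    then show ?thesis using path_dist_less by blast
  qed
  then obtain l u where w: "\<And>k. witness (e k) (l k) (u k) x (xs k)" by metis
   have "e \<longlonglongrightarrow> 0 + 0"
    unfolding e_def
  proof (rule tendsto_add)
    show "(\<lambda>k. path_dist x (xs k)) \<longlonglongrightarrow> 0" using L xs by (simp add: P.limitin_metric_dist_null P.commute)
    show "(\<lambda>k. 1 / real (Suc k)) \<longlonglongrightarrow> 0" using LIMSEQ_inverse_real_of_nat by (simp add: field_simps)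
  qed
  then show "local_Skorokhod_convergent S d xs x" using witness_imp_convergent[OF xs x w] by simp
next
  assume c: "local_Skorokhod_convergent S d xs x"
  show "limitin P.mtopology xs x sequentially"
    unfolding P.limitin_metric
  proof (intro conjI allI impI x)
    fix e :: real assume e: "0 < e"
    have "\<forall>\<^sub>F k in sequentially. \<exists>m t. witness (e/2) m t x (xs k)" using convergent_imp_witness[OF xs x c] e by simp
    then show "\<forall>\<^sub>F k in sequentially. xs k \<in> D_loc S \<and> path_dist (xs k) x < e"
    proof eventually_elim
      fix k assume "\<exists>m t. witness (e/2) m t x (xs k)"
      then have "path_dist x (xs k) \<le> e/2" using path_dist_le e by (metis half_gt_zero less_imp_le)
      then show "xs k \<in> D_loc S \<and> path_dist (xs k) x < e" using e xs P.commute[of x "xs k"] by simp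
    qed
  qed
qed

end

section \<open>Completeness\<close>

text \<open>Carries the clock of the n-th path to that of the (n + j)-th; new factors are applied
  last.\<close>

primrec composed :: "(nat \<Rightarrow> real \<Rightarrow> real) \<Rightarrow> nat \<Rightarrow> nat \<Rightarrow> real \<Rightarrow> real" where
  "composed l n 0 = (\<lambda>s. s)"
| "composed l n (Suc j) = (\<lambda>s. l (n + j) (composed l n j s))"

text \<open>The first factor is split off instead of the last, which in the limit gives the
  recursion \<open>L (Suc n) (l n s) = L n s\<close>.\<close>

lemma composed_Suc: "composed l n (Suc j) s = composed l (Suc n) j (l n s)"
  by (induction j) auto

text \<open>The bound is the geometric sum of (1/2)^i over n \<le> i < n + j, in closed
  form.\<close>

lemma composed_slopes:
  assumes "\<And>k. log_slopes_le ((1/2)^k) (l k)"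
  shows "log_slopes_le (2 * (1/2)^n - 2 * (1/2)^(n + j)) (composed l n j)"
proof (induction j)
  case 0 then show ?case by (simp add: log_slopes_le_id)
next
  case (Suc j)
  show ?case using log_slopes_le_compose[OF Suc assms[of "n + j"]] by (simp add: algebra_simps)
qed

lemma composed_limit:
  assumes l: "\<And>k. log_slopes_le ((1/2)^k) (l k)"
  obtains L where "\<And>n. log_slopes_le (2 * (1/2)^n) (L n)" "\<And>n s. 0 \<le> s \<Longrightarrow> L (Suc n) (l n s) = L n s"
proof -
  have slopes: "log_slopes_le (2 * (1/2)^n) (composed l n j)" for n j
    using composed_slopes[OF l, of n j] by (rule log_slopes_le_mono) simp
  have conv: "convergent (\<lambda>j. composed l n j s)" if s: "0 \<le> s" for n s
  proof -
    let ?f = "\<lambda>j. composed l n j s"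
    \<comment> \<open>The logarithmic slopes sum to at most 2, so all compositions stay below exp 2
      * s; the next factor displaces by at most twice its own bound times this.\<close>
    have bound: "norm (?f (Suc j) - ?f j) \<le> 2 * (exp 2 * s) * (1/2)^j" for j
    proof -
      have f0: "0 \<le> ?f j" using log_slopes_le_nonneg[OF slopes s] .
      have "(1/2::real)^n \<le> 1" "(1/2::real)^j \<le> 1" by (auto intro: power_le_one)
      then have n1: "2 * (1/2::real)^n \<le> 2" "(1/2::real)^(n + j) \<le> (1/2)^j"
        by (auto simp: power_add mult_left_le_one_le)
      have "?f j \<le> exp (2 * (1/2)^n) * s" using log_slopes_le_upper[OF slopes s] .
      also have "\<dots> \<le> exp 2 * s" using n1 s by (intro mult_right_mono) auto
      finally have fj: "?f j \<le> exp 2 * s" .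
      have "\<bar>l (n + j) (?f j) - ?f j\<bar> \<le> 2 * (1/2)^(n + j) * ?f j"
        using f0 by (intro log_slopes_le_dist'[OF l]) (auto intro: power_le_one)
      also have "\<dots> \<le> 2 * (1/2)^j * (exp 2 * s)" using n1 f0 fj by (intro mult_mono) auto
      finally show ?thesis by (simp add: algebra_simps)
    qed
    have "summable (\<lambda>j. 2 * (exp 2 * s) * (1/2::real)^j)" by (intro summable_mult summable_geometric) simp
    then have "summable (\<lambda>j. ?f (Suc j) - ?f j)" using bound by (rule summable_comparison_test'[where N=0])
    then have "(\<lambda>m. \<Sum>j<m. ?f (Suc j) - ?f j) \<longlonglongrightarrow> (\<Sum>j. ?f (Suc j) - ?f j)" by (rule summable_LIMSEQ)
    then have "(\<lambda>m. ?f m - ?f 0) \<longlonglongrightarrow> (\<Sum>j. ?f (Suc j) - ?f j)" by (simp only: sum_lessThan_telescope[of ?f])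
    then have "(\<lambda>m. ?f m - ?f 0 + ?f 0) \<longlonglongrightarrow> (\<Sum>j. ?f (Suc j) - ?f j) + ?f 0" by (intro tendsto_add tendsto_const)
    then show ?thesis by (auto simp: convergent_def)
  qed
  define L where "L n s = lim (\<lambda>j. composed l n j s)" for n s
  have L: "(\<lambda>j. composed l n j s) \<longlonglongrightarrow> L n s" if "0 \<le> s" for n s
    using conv[OF that] by (simp add: L_def convergent_LIMSEQ_iff)
  show ?thesis
  proof (rule that[of L])
    show "log_slopes_le (2 * (1/2)^n) (L n)" for n using slopes L by (rule log_slopes_le_limit)
    fix n and s :: real assume s: "0 \<le> s"
    have "(\<lambda>j. composed l (Suc n) j (l n s)) \<longlonglongrightarrow> L n s"
      using LIMSEQ_Suc[OF L[OF s, of n]] by (simp only: composed_Suc)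
    then show "L (Suc n) (l n s) = L n s"
      using L[OF log_slopes_le_nonneg[OF l s]] LIMSEQ_unique by blast
  qed
qed

context proper_metric begin

text \<open>The factor 2 sums the geometric tail from m on; completeness of \<open>d\<close> gives
  the limit, and the closed bounds pass to it.\<close>

lemma near_tail_limit:
  assumes "\<And>m. n \<le> m \<Longrightarrow> near ((1/2)^m) (p m) (p (Suc m))"
  obtains b where "\<And>m. n \<le> m \<Longrightarrow> near (2 * (1/2)^m) (p m) (Some b)"
proof -
  have far: "near (2 * (1/2)^m) (p m) (p k)" if "n \<le> m" "m \<le> k" for m k
  proof -
    have "near (2 * (1/2)^m - 2 * (1/2)^k) (p m) (p k)"
      using that(2)
    proof (induction rule: dec_induct)
      case base
      show ?case using assms[OF that(1)] by (auto simp: near_def)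
    next
      case (step k)
      have "near (2 * (1/2)^m - 2 * (1/2)^k + (1/2)^k) (p m) (p (Suc k))"
        using near_trans[OF step(3) assms] step(1) that(1) by simp
      then show ?case by simp
    qed
    then show ?thesis by (rule near_mono) simp
  qed
  have pS: "the (p m) \<in> topspace S" "p m = Some (the (p m))" if "n \<le> m" for m
    using assms[OF that] by (auto simp: near_def)
  have small: "\<exists>N. 2 * (1/2::real)^N < e" if "0 < e" for e
    using real_arch_pow_inv[of "e/2" "1/2"] that by (auto simp: field_simps)
  have "M.MCauchy (\<lambda>j. the (p (n + j)))"
    unfolding M.MCauchy_def
  proof (intro conjI allI impI)
    fix e :: real assume "0 < e"
    then obtain N where N: "2 * (1/2::real)^N < e" using small by blast
    have *: "d (the (p (n + i))) (the (p (n + j))) < e" if "N \<le> i" "i \<le> j" for i j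
    proof -
      have "d (the (p (n + i))) (the (p (n + j))) \<le> 2 * (1/2)^(n + i)" using near_dist[OF far] that by simp
      also have "\<dots> \<le> 2 * (1/2)^N" using that by (intro mult_left_mono power_decreasing) auto
      finally show ?thesis using N by simp
    qed
    show "\<exists>N. \<forall>i j. N \<le> i \<longrightarrow> N \<le> j \<longrightarrow> d (the (p (n + i))) (the (p (n + j))) < e"
    proof (intro exI allI impI)
      fix i j assume "N \<le> i" "N \<le> j"
      then show "d (the (p (n + i))) (the (p (n + j))) < e"
        using *[of i j] *[of j i] M.commute by (cases "i \<le> j") auto
    qed
  qed (use pS in auto)
  then obtain b where b: "limitin M.mtopology (\<lambda>j. the (p (n + j))) b sequentially" using mcomplete by (auto simp: M.mcomplete_def)
  then have bS: "b \<in> topspace S" by (simp add: M.limitin_metric)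
  show ?thesis
  proof (rule that)
    fix m assume m: "n \<le> m"
    have "d (the (p m)) b \<le> 2 * (1/2)^m"
    proof (rule field_le_epsilon)
      fix e :: real assume "0 < e"
      then obtain N where "\<And>j. N \<le> j \<Longrightarrow> d (the (p (n + j))) b < e"
        using b unfolding M.limit_metric_sequentially by blast
      then have 1: "d (the (p (n + (N + m)))) b < e" by simp
      have "d (the (p m)) (the (p (n + (N + m)))) \<le> 2 * (1/2)^m" using near_dist[OF far[OF m, of "n + (N + m)"]] by simp
      then show "d (the (p m)) b \<le> 2 * (1/2)^m + e"
        using 1 M.triangle[of "the (p m)" "the (p (n + (N + m)))" b] pS(1)[OF m] pS(1)[of "n + (N + m)"] bS by simp
    qed
    then show "near (2 * (1/2)^m) (p m) (Some b)" using pS[OF m] bS unfolding near_def by metis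
  qed
qed

lemma fast_Cauchy_limit:
  assumes X: "\<And>k. X k \<in> D_loc S" and w: "\<And>k. witness ((1/2)^k) (l k) (t k) (X k) (X (Suc k))"
  obtains x where "x \<in> D_loc S" "\<And>n. \<exists>m u. witness (6 * (1/2)^n) m u (X n) x"
proof -
  define E where "E k = (1/2::real)^k" for k :: nat
  have E: "0 < E k" "E (Suc k) = E k / 2" for k by (auto simp: E_def)
  have E_anti: "E m \<le> E n" if "n \<le> m" for n m using that by (auto simp: E_def intro: power_decreasing)
  have small: "\<exists>N. \<forall>m\<ge>N. E m < e" if e: "0 < e" for e
  proof -
    obtain N where "E N < e" using real_arch_pow_inv[of e "1/2"] e by (auto simp: E_def)
    then show ?thesis using E_anti by (intro exI[of _ N]) (auto intro: le_less_trans)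
  qed
  note X' = D_loc_D_exp[OF X]
  note w = w[folded E_def]
  note W = witnessD[OF w]

  text \<open>The thresholds \<open>2 * E k\<close> drop by exactly the closeness \<open>E k\<close> of successive paths, so that \<open>l k\<close>
    maps the stopping time of \<open>X k\<close> below that of \<open>X (Suc k)\<close>.\<close>
  define A where "A k = {r. 0 \<le> r \<and> cut (X k) r \<le> 2 * E k}" for k
  define a where "a k = Inf (A k)" for k
  have tA: "t k \<in> A k" for k using W(1,4)[of k] E(1)[of k] by (auto simp: A_def)
  have bdd: "bdd_below (A k)" for k by (auto simp: A_def bdd_below_def)
  have a0: "0 \<le> a k" for k unfolding a_def using tA by (intro cInf_greatest) (auto simp: A_def)
  have a_lower: "a k \<le> r" if "r \<in> A k" for k r unfolding a_def using that bdd by (rule cInf_lower)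
  have a_t: "a k \<le> t k" for k using a_lower tA .
  have a_cut: "cut (X k) (a k) \<le> 2 * E k" for k
  proof (rule cut_right_le[OF X' a0])
    fix \<delta> :: real assume "0 < \<delta>"
    then have "Inf (A k) < a k + \<delta>" by (simp add: a_def)
    then obtain s where "s \<in> A k" "s < a k + \<delta>" using cInf_lessD[of "A k"] tA by blast
    then show "\<exists>s. a k \<le> s \<and> s < a k + \<delta> \<and> cut (X k) s \<le> 2 * E k" using a_lower by (auto simp: A_def)
  qed (use E(1)[of k] in simp)
  have step: "l k (a k) \<le> a (Suc k)" for k
    unfolding a_def[of "Suc k"]
  proof (rule cInf_greatest)
    show "A (Suc k) \<noteq> {}" using tA by blast
    fix r assume r: "r \<in> A (Suc k)"
    show "l k (a k) \<le> r"
    proof (rule ccontr)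
      assume "\<not> l k (a k) \<le> r"
      then have lt: "r < l k (a k)" by simp
      obtain s where s: "0 \<le> s" "l k s = r"
        using log_slopes_le_bij[OF W(2)] r unfolding bij_betw_def A_def by (metis (no_types, lifting) atLeast_iff imageE mem_Collect_eq)
      have sa: "s < a k" using log_slopes_le_less_iff(1)[OF W(2) s(1) a0] s(2) lt by blast
      have "\<bar>cut (X k) s - cut (X (Suc k)) r\<bar> \<le> E k"
        using witness_cut[OF X' X' w s(1)] sa a_t[of k] s(2) by auto
      moreover have "cut (X (Suc k)) r \<le> E k" using r E(2)[of k] by (simp add: A_def)
      ultimately have "s \<in> A k" using s(1) by (simp add: A_def)
      then show False using a_lower sa by fastforce
    qed
  qed

  obtain L where L: "\<And>n. log_slopes_le (2 * E n) (L n)" "\<And>n s. 0 \<le> s \<Longrightarrow> L (Suc n) (l n s) = L n s"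
    using composed_limit[of l] W(2) unfolding E_def by blast
  have "\<forall>n. \<exists>m. log_slopes_le (2 * E n) m \<and> (\<forall>s\<ge>0. m (L n s) = s) \<and> (\<forall>s\<ge>0. L n (m s) = s)"
    using log_slopes_le_inverse[OF L(1)] by metis
  then obtain K where "\<forall>n. log_slopes_le (2 * E n) (K n) \<and> (\<forall>s\<ge>0. K n (L n s) = s) \<and> (\<forall>s\<ge>0. L n (K n s) = s)"
    by metis
  then have K: "\<And>n. log_slopes_le (2 * E n) (K n)" "\<And>n s. 0 \<le> s \<Longrightarrow> K n (L n s) = s" "\<And>n s. 0 \<le> s \<Longrightarrow> L n (K n s) = s"
    by auto
  note K0 = log_slopes_le_nonneg[OF K(1)] and L0 = log_slopes_le_nonneg[OF L(1)]
  \<comment> \<open>The stopping time of \<open>X n\<close> in the common clock. It increases with n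
    by \<open>step\<close>, so once u < T n all later paths can be compared at u.\<close>
  define T where "T n = L n (a n)" for n
  have T0: "0 \<le> T n" for n unfolding T_def by (rule L0[OF a0])
  have KT: "K n (T n) = a n" for n unfolding T_def by (rule K(2)[OF a0])
  have "T n \<le> T (Suc n)" for n
  proof -
    have "T n = L (Suc n) (l n (a n))" unfolding T_def using L(2)[OF a0] by simp
    also have "\<dots> \<le> T (Suc n)"
      unfolding T_def using log_slopes_le_less_iff(2)[OF L(1) log_slopes_le_nonneg[OF W(2) a0] a0] step by simp
    finally show ?thesis .
  qed
  then have T_mono: "T n \<le> T m" if "n \<le> m" for n m using that by (rule lift_Suc_mono_le)
  have K_Suc: "K (Suc n) u = l n (K n u)" if u: "0 \<le> u" for n u
    using K(2)[OF log_slopes_le_nonneg[OF W(2) K0[OF u]], of "Suc n" n n] L(2)[OF K0[OF u], of n n] K(3)[OF u] by simp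
  have K_less: "K n u < a n \<longleftrightarrow> u < T n" "K n u \<le> a n \<longleftrightarrow> u \<le> T n" if u: "0 \<le> u" for n u
    using log_slopes_le_less_iff[OF K(1) u T0] KT by metis+
  have near_step: "near (E n) (X n (K n u)) (X (Suc n) (K (Suc n) u))" if u: "0 \<le> u" "u < T n" for n u
    using W(3)[OF K0[OF u(1)], of n] K_less(1)[OF u(1), of n] a_t[of n] u K_Suc by auto
  \<comment> \<open>Unlike closeness of the values, this bound includes u = T n; it carries the
    threshold at the stopping time to all later paths.\<close>
  have cut_far: "\<bar>cut (X n) (K n u) - cut (X m) (K m u)\<bar> \<le> 2 * E n - 2 * E m" if u: "0 \<le> u" "u \<le> T n" and "n \<le> m" for n m u
    using \<open>n \<le> m\<close>
  proof (induction rule: dec_induct)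
    case (step m)
    have "u \<le> T m" using u T_mono[OF step(1)] by simp
    then have "\<bar>cut (X m) (K m u) - cut (X (Suc m)) (l m (K m u))\<bar> \<le> E m"
      using K_less(2)[OF u(1), of m] a_t[of m] by (intro witness_cut[OF X' X' w K0[OF u(1)]]) auto
    then show ?case using step(3) E(2)[of m] K_Suc[OF u(1)] by simp
  qed simp
  have "\<exists>b. \<forall>m. u < T m \<longrightarrow> near (2 * E m) (X m (K m u)) (Some b)" if u: "0 \<le> u" for u
  proof (cases "\<exists>n. u < T n")
    case True
    \<comment> \<open>Starting at the first index with u < T n makes a single limit point serve
      every admissible m.\<close>
    define n where "n = (LEAST n. u < T n)"
    have n: "u < T n" unfolding n_def using True by (auto intro: LeastI_ex)
    have least: "n \<le> m" if "u < T m" for m unfolding n_def using that by (rule Least_le)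
    have "near ((1/2)^m) (X m (K m u)) (X (Suc m) (K (Suc m) u))" if "n \<le> m" for m
      using near_step[OF u, of m] n T_mono[OF that] by (simp add: E_def)
    then obtain b where "\<And>m. n \<le> m \<Longrightarrow> near (2 * (1/2)^m) (X m (K m u)) (Some b)"
      using near_tail_limit[of n "\<lambda>m. X m (K m u)"] by blast
    then show ?thesis using least by (auto simp: E_def)
  qed auto
  then obtain f where f: "\<And>u m. 0 \<le> u \<Longrightarrow> u < T m \<Longrightarrow> near (2 * E m) (X m (K m u)) (Some (f u))"
    by metis
  define Z where "Z = (SUP n. ereal (T n))"
  have Z: "ereal u < Z \<longleftrightarrow> (\<exists>n. u < T n)" for u by (simp add: Z_def less_SUP_iff)
  have TZ: "ereal (T n) \<le> Z" for n unfolding Z_def by (rule SUP_upper) simp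
  have Z0: "0 \<le> Z" using TZ[of 0] T0[of 0] by (metis ereal_less_eq(5) order_trans)
  define x where "x = killed_path Z f"
  have x: "x u = Some (f u)" if "0 \<le> u" "u < T n" for u n using that Z by (auto simp: x_def killed_path_eq)
  \<comment> \<open>The threshold at \<open>a n\<close> is 2 * E n, the passage to
    \<open>X m\<close> costs at most 2 * E n more, and the passage to x at most 2 * E m; hence 6. If
    \<open>T n\<close> equals the supremum Z, then x is dead there.\<close>
  have cut_x: "cut x (T n) \<le> 6 * E n" for n
  proof (cases "ereal (T n) < Z")
    case True
    then obtain m where m: "T n < T m" using Z by blast
    then have nm: "n \<le> m" using T_mono[of m n] by (cases "n \<le> m") auto
    have "cut (X m) (K m (T n)) \<le> 4 * E n"
      using cut_far[OF T0 order_refl nm, of] KT[of n] a_cut[of n] E(1)[of m] by simp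
    moreover have "\<bar>cut (X m) (K m (T n)) - cut x (L m (K m (T n)))\<bar> \<le> 2 * E m"
    proof (rule cut_near[OF _ L(1) K0[OF T0]])
      show "near (2 * E m) (X m (K m (T n))) (x (L m (K m (T n))))"
        using f[OF T0 m] x[OF T0 m] K(3)[OF T0] by simp
    qed
    ultimately show ?thesis using K(3)[OF T0] E_anti[OF nm] by simp
  next
    case False
    then show ?thesis using T0 E(1)[of n] by (simp add: x_def killed_path_eq cut_None)
  qed
  have "x \<in> D_loc S"
    unfolding x_def
  proof (rule killed_path_D_loc[OF Z0])
    show "f s \<in> topspace S" if "0 \<le> s" "ereal s < Z" for s
      using that Z f by (auto simp: near_def)
  next
    fix r e :: real assume r: "0 \<le> r" "ereal r < Z" and e: "0 < e"
    obtain n0 where n0: "r < T n0" using r Z by blast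
    obtain N where N: "\<And>m. N \<le> m \<Longrightarrow> E m < e / 8" using small[of "e/8"] e by auto
    define m where "m = max n0 N"
    have m: "r < T m" "2 * E m < e / 4" using n0 T_mono[of n0 m] N[of m] by (auto simp: m_def)
    have al: "X m (K m r) \<noteq> None" using f[OF r(1) m(1)] near_not_None by blast
    obtain \<delta> where \<delta>: "0 < \<delta>" "\<And>s. K m r \<le> s \<Longrightarrow> s < K m r + \<delta> \<Longrightarrow> near (e/4) (X m (K m r)) (X m s)"
      using D_exp_right[OF X' K0[OF r(1)] al, of "e/4"] e by auto
    \<comment> \<open>\<open>K m\<close> has slopes at most \<open>exp (2 * E m)\<close>, so this
      keeps the images within the right neighbourhood found for \<open>X m\<close>.\<close>
    let ?\<delta> = "min (T m - r) (\<delta> / exp (2 * E m))"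
    have "d (f s) (f r) < e" if s: "r < s" "s < r + ?\<delta>" for s
    proof -
      have s0: "0 \<le> s" "s < T m" using s r by auto
      have "K m s - K m r \<le> exp (2 * E m) * (s - r)" using log_slopes_leD(3)[OF K(1) r(1)] s by simp
      also have "s - r < \<delta> / exp (2 * E m)" using s by simp
      then have "exp (2 * E m) * (s - r) < \<delta>" by (simp add: field_simps)
      finally have "near (e/4) (X m (K m r)) (X m (K m s))"
        using log_slopes_le_less_iff(2)[OF K(1) r(1) s0(1)] s by (intro \<delta>(2)) auto
      from near_trans[OF near_trans[OF near_sym[OF f[OF s0]] near_sym[OF this]] f[OF r(1) m(1)]]
      have "near (2 * E m + e/4 + 2 * E m) (Some (f s)) (Some (f r))" .
      then show ?thesis using near_dist[of _ "Some (f s)" "Some (f r)"] m(2) e by force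
    qed
    moreover have "0 < ?\<delta>" using m \<delta> by simp
    ultimately show "\<exists>\<delta>>0. \<forall>s. r < s \<longrightarrow> s < r + \<delta> \<longrightarrow> ereal s < Z \<longrightarrow> d (f s) (f r) < e" by blast
  next
    fix r e :: real
    assume r: "0 < r" "ereal r < Z \<or> ereal r = Z \<and> (\<exists>B. \<forall>s. 0 \<le> s \<longrightarrow> s < r \<longrightarrow> g (f s) \<le> B)" and e: "0 < e"
    have r0: "0 \<le> r" using r by simp
    obtain N where N: "\<And>m. N \<le> m \<Longrightarrow> E m < e / 8" using small[of "e/8"] e by auto
    \<comment> \<open>f inherits its behaviour to the left of r from a single \<open>X m\<close>
      that is compared all the way up to r and has a left limit at \<open>K m r\<close>.\<close>
    obtain m where m: "N \<le> m" "r \<le> T m" "X m (K m r) \<noteq> None \<or> bounded_before (X m) (K m r)"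
    proof (cases "ereal r < Z")
      case True
      then obtain n0 where n0: "r < T n0" using Z by blast
      have "r < T (max n0 N)" using n0 T_mono[of n0 "max n0 N"] by simp
      then show ?thesis using that[of "max n0 N"] f[OF r0] near_not_None by force
    next
      case False
      then obtain B where rZ: "ereal r = Z" and B: "\<And>s. 0 \<le> s \<Longrightarrow> s < r \<Longrightarrow> g (f s) \<le> B" using r by auto
      have Tr: "T n \<le> r" for n using TZ[of n] rZ by (metis ereal_less_eq(3))
      \<comment> \<open>If the limit path dies in a compact set, the stopping times must attain
        their supremum: otherwise x would be alive at each \<open>T n\<close> with
        \<open>cut\<close> bounded below by b, against the bound 6 * E n. This provides the single
        \<open>X m\<close> that covers the whole interval up to r.\<close>
      have "\<exists>n. T n = r"
      proof (rule ccontr)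
        assume "\<nexists>n. T n = r"
        then have lt: "T n < r" for n using Tr[of n] by (metis order_le_less)
        define b where "b = 1 / (1 + max 0 (max B r))"
        have b: "0 < b" by (simp add: b_def add_pos_nonneg)
        obtain n where "E n < b / 6" using small[of "b / 6"] b by auto
        then have n: "6 * E n < b" by linarith
        obtain k where k: "T n < T k" using lt[of n] Z[of "T n"] rZ by auto
        have xT: "x (T n) = Some (f (T n))" using x[OF T0 k] .
        have fS: "f (T n) \<in> topspace S" using f[OF T0 k] by (auto simp: near_def)
        have "b \<le> 1 / (1 + g (f (T n)))" using B[OF T0[of n] lt[of n]] height_nonneg[OF fS] unfolding b_def by (intro divide_left_mono mult_pos_pos) auto
        moreover have "b \<le> 1 / (1 + T n)" using Tr[of n] T0[of n] unfolding b_def by (intro divide_left_mono mult_pos_pos) auto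
        ultimately show False using cut_x[of n] n xT by (simp add: cut_def)
      qed
      then obtain n where n: "T n = r" by blast
      define m where "m = max n N"
      have Tm: "T m = r" using n T_mono[of n m] Tr[of m] by (simp add: m_def)
      have "\<exists>b. X m s = Some b \<and> g b \<le> B + 2 * E m" if s: "0 \<le> s" "s < a m" for s
      proof -
        have lt: "L m s < T m" unfolding T_def using log_slopes_le_less_iff(1)[OF L(1) s(1) a0] s by simp
        have "near (2 * E m) (X m s) (Some (f (L m s)))" using f[OF L0[OF s(1)] lt] K(2)[OF s(1)] by simp
        from near_sym[OF this] obtain b where b: "X m s = Some b" "near (2 * E m) (Some (f (L m s))) (Some b)" by (auto simp: near_def)
        then show ?thesis using near_height[OF b(2)] B[OF L0[OF s(1)]] lt Tm by force
      qed
      then have "bounded_before (X m) (a m)" unfolding bounded_before_def by (meson atLeastLessThan_iff)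
      then have "bounded_before (X m) (K m r)" using KT[of m] Tm by simp
      then show ?thesis using that[of m] Tm by (simp add: m_def)
    qed
    have Kr: "0 < K m r" using log_slopes_le_less_iff(1)[OF K(1) order_refl r0] log_slopes_leD(1)[OF K(1)] r(1) by simp
    have e4: "0 < e/4" using e by simp
    obtain \<delta> where \<delta>: "0 < \<delta>" "\<delta> \<le> K m r"
      "\<And>p s. K m r - \<delta> \<le> p \<Longrightarrow> p < K m r \<Longrightarrow> K m r - \<delta> \<le> s \<Longrightarrow> s < K m r \<Longrightarrow> near (e/4) (X m p) (X m s)"
    proof (rule D_loc_left[OF X[of m] Kr m(3) e4])
      fix \<delta> assume "0 < \<delta>" "\<delta> \<le> K m r"
        "\<And>p s. K m r - \<delta> \<le> p \<Longrightarrow> p < K m r \<Longrightarrow> K m r - \<delta> \<le> s \<Longrightarrow> s < K m r \<Longrightarrow> near (e/4) (X m p) (X m s)"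
      then show ?thesis by (rule that)
    qed
    have Kn: "K m r - \<delta> \<le> K m s \<and> K m s < K m r" if s: "0 \<le> s" "r - \<delta> / exp (2 * E m) < s" "s < r" for s
    proof -
      have "K m r - K m s \<le> exp (2 * E m) * (r - s)" using log_slopes_leD(3)[OF K(1) s(1)] s by simp
      also have "\<dots> < \<delta>" using s(2) by (auto simp: field_simps)
      finally show ?thesis using log_slopes_le_less_iff(1)[OF K(1) s(1) r0] s by simp
    qed
    have "d (f p) (f s) < e"
      if "0 \<le> p" "r - \<delta> / exp (2 * E m) < p" "p < r" "0 \<le> s" "r - \<delta> / exp (2 * E m) < s" "s < r" for p s
    proof -
      have "near (e/4) (X m (K m p)) (X m (K m s))" using \<delta>(3) Kn[of p] Kn[of s] that by simp
      moreover have "near (2 * E m) (Some (f p)) (X m (K m p))" "near (2 * E m) (X m (K m s)) (Some (f s))"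
        using f near_sym that m(2) by (meson less_le_trans)+
      ultimately have "near (2 * E m + e/4 + 2 * E m) (Some (f p)) (Some (f s))" by (blast intro: near_trans)
      then show ?thesis using near_dist[of _ "Some (f p)" "Some (f s)"] N[OF m(1)] e by force
    qed
    moreover have "0 < \<delta> / exp (2 * E m)" using \<delta>(1) by simp
    ultimately show "\<exists>\<delta>>0. \<forall>p s. 0 \<le> p \<longrightarrow> r - \<delta> < p \<longrightarrow> p < r \<longrightarrow> 0 \<le> s \<longrightarrow> r - \<delta> < s \<longrightarrow> s < r \<longrightarrow> d (f p) (f s) < e"
      by blast
  qed
  moreover have "witness (6 * E n) (L n) (a n) (X n) x" for n
    unfolding witness_def
  proof (intro conjI allI impI a0)
    show "log_slopes_le (6 * E n) (L n)" using L(1) by (rule log_slopes_le_mono) (use E(1)[of n] in simp)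
    show "cut (X n) (a n) \<le> 6 * E n" using a_cut[of n] E(1)[of n] by simp
    show "cut x (L n (a n)) \<le> 6 * E n" using cut_x[of n] by (simp add: T_def)
    fix s assume s: "0 \<le> s" "s < a n"
    have lt: "L n s < T n" unfolding T_def using log_slopes_le_less_iff(1)[OF L(1) s(1) a0] s by simp
    have "near (2 * E n) (X n s) (x (L n s))" using f[OF L0[OF s(1)] lt] x[OF L0[OF s(1)] lt] K(2)[OF s(1)] by simp
    then show "near (6 * E n) (X n s) (x (L n s))" by (rule near_mono) (use E(1)[of n] in simp)
  qed
  ultimately show ?thesis using that unfolding E_def by blast
qed

lemma mcomplete_path_dist: "P.mcomplete"
  unfolding P.mcomplete_def
proof (intro allI impI)
  fix \<sigma> assume \<sigma>: "P.MCauchy \<sigma>"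
  have \<sigma>D: "\<sigma> n \<in> D_loc S" for n using \<sigma> by (auto simp: P.MCauchy_def)
  have "\<exists>N. \<forall>n n'. N \<le> n \<longrightarrow> N \<le> n' \<longrightarrow> path_dist (\<sigma> n) (\<sigma> n') < (1/2)^k" for k
    using \<sigma> by (simp add: P.MCauchy_def)
  then obtain N where N: "\<And>k n n'. N k \<le> n \<Longrightarrow> N k \<le> n' \<Longrightarrow> path_dist (\<sigma> n) (\<sigma> n') < (1/2)^k" by metis
  obtain r where r: "\<And>k. N k \<le> r k" "\<And>k. r k < r (Suc k)"
  proof -
    have "\<exists>m. N (Suc k) \<le> m \<and> n < m" for k n by (intro exI[of _ "max (N (Suc k)) (Suc n)"]) auto
    then show ?thesis using dependent_nat_choice[of "\<lambda>k n. N k \<le> n" "\<lambda>k n m. n < m"] that by blast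
  qed
  have mono: "strict_mono r" using r(2) by (simp add: strict_mono_Suc_iff)
  have "\<exists>l t. witness ((1/2)^k) l t (\<sigma> (r k)) (\<sigma> (r (Suc k)))" for k
  proof -
    have "path_dist (\<sigma> (r k)) (\<sigma> (r (Suc k))) < (1/2)^k" using N[OF r(1), of k "r (Suc k)"] r(1)[of k] r(2)[of k] by simp
    then show ?thesis using path_dist_less by blast
  qed
  then obtain l t where "\<And>k. witness ((1/2)^k) (l k) (t k) (\<sigma> (r k)) (\<sigma> (r (Suc k)))" by metis
  from fast_Cauchy_limit[of "\<lambda>k. \<sigma> (r k)", OF \<sigma>D this] obtain x
    where x: "x \<in> D_loc S" "\<And>n. \<exists>m u. witness (6 * (1/2)^n) m u (\<sigma> (r n)) x" by blast
  have "limitin P.mtopology (\<sigma> \<circ> r) x sequentially"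
    unfolding P.limitin_metric_dist_null
  proof (intro conjI x always_eventually allI)
    show "(\<sigma> \<circ> r) n \<in> D_loc S" for n using \<sigma>D by simp
    show "(\<lambda>n. path_dist ((\<sigma> \<circ> r) n) x) \<longlonglongrightarrow> 0"
    proof (rule tendsto_sandwich[OF _ _ tendsto_const])
      have "path_dist ((\<sigma> \<circ> r) n) x \<le> 6 * (1/2)^n" for n using x(2)[of n] path_dist_le[of "6 * (1/2)^n"] by auto
      then show "\<forall>\<^sub>F n in sequentially. path_dist ((\<sigma> \<circ> r) n) x \<le> 6 * (1/2)^n" by simp
      have "(\<lambda>n. 6 * (1/2::real)^n) \<longlonglongrightarrow> 6 * 0" by (intro tendsto_mult tendsto_const LIMSEQ_realpow_zero) auto
      then show "(\<lambda>n. 6 * (1/2::real)^n) \<longlonglongrightarrow> 0" by simp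
    qed (simp add: path_dist_nonneg)
  qed
  then show "\<exists>x. limitin P.mtopology \<sigma> x sequentially" using P.MCauchy_convergent_subsequence[OF \<sigma> mono] by blast
qed

end

section \<open>Discretisation and separability\<close>

text \<open>Balls around anything outside S are empty, so this form of density also covers the empty
  space, where \<open>q\<close> has no values in S.\<close>

locale separable_proper_metric = proper_metric +
  fixes q :: "nat \<Rightarrow> 'a"
  assumes dense: "\<And>a e. a \<in> topspace S \<Longrightarrow> 0 < e \<Longrightarrow> \<exists>j. a \<in> M.mball (q j) e"
begin

text \<open>The first dense point within e, not a closest one: the choice is then decided by
  finitely many open balls, which makes it measurable.\<close>

definition nearest :: "real \<Rightarrow> 'a \<Rightarrow> nat" where
  "nearest e a = (LEAST j. a \<in> M.mball (q j) e)"

lemma nearest: "a \<in> topspace S \<Longrightarrow> 0 < e \<Longrightarrow> a \<in> M.mball (q (nearest e a)) e"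
  unfolding nearest_def using LeastI_ex[OF dense] .

lemma nearest_eq_iff:
  assumes "a \<in> topspace S" "0 < e"
  shows "nearest e a = j \<longleftrightarrow> a \<in> M.mball (q j) e \<and> (\<forall>i<j. a \<notin> M.mball (q i) e)"
proof
  assume "nearest e a = j"
  then show "a \<in> M.mball (q j) e \<and> (\<forall>i<j. a \<notin> M.mball (q i) e)"
    using nearest[OF assms] not_less_Least[of _ "\<lambda>j. a \<in> M.mball (q j) e"] unfolding nearest_def by blast
next
  assume "a \<in> M.mball (q j) e \<and> (\<forall>i<j. a \<notin> M.mball (q i) e)"
  then show "nearest e a = j" unfolding nearest_def by (intro Least_equality) (auto simp: not_less[symmetric] simp del: M.in_mball)
qed

text \<open>The mesh is 1 / (n + 1) and there are (n + 1)^2 sampling times, so the horizon n + 1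
  grows as the mesh shrinks. The codes lie in a countable type.\<close>

definition grid_code :: "nat \<Rightarrow> (real \<Rightarrow> 'a option) \<Rightarrow> nat option list" where
  "grid_code n x = map (\<lambda>i. map_option (nearest (1 / real (Suc n))) (x (real i / real (Suc n)))) [0..<Suc n * Suc n]"

definition grid_path :: "nat \<Rightarrow> nat option list \<Rightarrow> real \<Rightarrow> 'a option" where
  "grid_path n ws = (\<lambda>t\<in>{0..}. let i = nat \<lfloor>real (Suc n) * t\<rfloor> in if i < length ws then map_option q (ws ! i) else None)"

definition discretize :: "nat \<Rightarrow> (real \<Rightarrow> 'a option) \<Rightarrow> real \<Rightarrow> 'a option" where
  "discretize n x = grid_path n (grid_code n x)"

lemma discretize_eq:
  assumes "0 \<le> t"
  shows "discretize n x t = (let i = nat \<lfloor>real (Suc n) * t\<rfloor> in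
    if i < Suc n * Suc n then map_option (\<lambda>a. q (nearest (1 / real (Suc n)) a)) (x (real i / real (Suc n))) else None)"
  using assms unfolding discretize_def grid_path_def grid_code_def
  by (auto simp: Let_def option.map_comp comp_def simp del: upt_Suc mult_Suc mult_Suc_right)

lemma discretize_near:
  assumes x: "x \<in> D_exp S" and t: "0 \<le> t" and al: "x (real (nat \<lfloor>real (Suc n) * t\<rfloor>) / real (Suc n)) \<noteq> None"
    and i: "nat \<lfloor>real (Suc n) * t\<rfloor> < Suc n * Suc n"
  shows "near (1 / real (Suc n)) (x (real (nat \<lfloor>real (Suc n) * t\<rfloor>) / real (Suc n))) (discretize n x t)"
proof -
  let ?r = "real (nat \<lfloor>real (Suc n) * t\<rfloor>) / real (Suc n)"
  obtain a where a: "x ?r = Some a" using al by blast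
  have aS: "a \<in> topspace S" using D_exp_Some_topspace[OF x _ a] by simp
  have "a \<in> M.mball (q (nearest (1 / real (Suc n)) a)) (1 / real (Suc n))" by (rule nearest[OF aS]) simp
  moreover have "discretize n x t = Some (q (nearest (1 / real (Suc n)) a))"
    unfolding discretize_eq[OF t] Let_def if_P[OF i] a by simp
  ultimately show ?thesis using a by (auto simp: near_def M.commute)
qed

lemma discretize_D_loc:
  assumes x: "x \<in> D_exp S"
  shows "discretize n x \<in> D_loc S"
proof -
  define N where "N = real (Suc n)"
  have N: "0 < N" by (simp add: N_def)
  \<comment> \<open>The first index that is dead or beyond the horizon. As death is absorbing, the
    living samples are exactly those before \<open>i0\<close>, so the step path has life time i0 /
    N.\<close>
  define i0 where "i0 = (LEAST i. Suc n * Suc n \<le> i \<or> x (real i / N) = None)"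
  have ex: "\<exists>i. Suc n * Suc n \<le> i \<or> x (real i / N) = None" by blast
  have i0: "Suc n * Suc n \<le> i0 \<or> x (real i0 / N) = None" unfolding i0_def by (rule LeastI_ex[OF ex])
  have lt: "i < Suc n * Suc n \<and> x (real i / N) \<noteq> None \<longleftrightarrow> i < i0" for i
  proof
    show "i < i0 \<Longrightarrow> i < Suc n * Suc n \<and> x (real i / N) \<noteq> None"
      using not_less_Least[of i "\<lambda>i. Suc n * Suc n \<le> i \<or> x (real i / N) = None"] by (auto simp: i0_def[symmetric] simp del: mult_Suc mult_Suc_right)
    assume i: "i < Suc n * Suc n \<and> x (real i / N) \<noteq> None"
    show "i < i0"
    proof (rule ccontr)
      assume "\<not> i < i0"
      then have le: "i0 \<le> i" by simp
      then have "x (real i0 / N) = None" using i0 i by linarith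
      moreover have "real i0 / N \<le> real i / N" using N le by (intro divide_right_mono) auto
      ultimately have "x (real i / N) = None" using D_exp_None_mono[OF x, of "real i0 / N"] N by simp
      then show False using i by simp
    qed
  qed
  define f where "f t = q (nearest (1 / N) (the (x (real (nat \<lfloor>N * t\<rfloor>) / N))))" for t
  have idx: "nat \<lfloor>N * t\<rfloor> < i0 \<longleftrightarrow> t < real i0 / N" if "0 \<le> t" for t
  proof -
    have "nat \<lfloor>N * t\<rfloor> < i0 \<longleftrightarrow> N * t < real i0"
      using that N by (simp add: nat_less_iff floor_less_iff)
    then show ?thesis using N by (simp add: field_simps)
  qed
  have eq: "discretize n x = killed_path (ereal (real i0 / N)) f"
  proof
    fix t
    show "discretize n x t = killed_path (ereal (real i0 / N)) f t"
    proof (cases "0 \<le> t")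
      case True
      let ?i = "nat \<lfloor>N * t\<rfloor>"
      show ?thesis
      proof (cases "?i < i0")
        case lt': True
        then obtain a where "?i < Suc n * Suc n" "x (real ?i / N) = Some a" using lt by blast
        then show ?thesis using lt' idx[OF True] True
          by (simp add: discretize_eq[OF True, of n, folded N_def] killed_path_eq Let_def f_def del: mult_Suc mult_Suc_right)
      next
        case False
        then have "\<not> ?i < Suc n * Suc n \<or> x (real ?i / N) = None" using lt by blast
        then show ?thesis using False idx[OF True] True
          by (auto simp: discretize_eq[OF True, of n, folded N_def] killed_path_eq Let_def simp del: mult_Suc mult_Suc_right)
      qed
    qed (simp add: discretize_def grid_path_def killed_path_def)
  qed
  have fS: "f s \<in> topspace S" if s: "0 \<le> s" "s < real i0 / N" for s
  proof -
    obtain a where a: "x (real (nat \<lfloor>N * s\<rfloor>) / N) = Some a" using s idx lt by blast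
    have "a \<in> topspace S" using D_exp_Some_topspace[OF x _ a] N by simp
    then show ?thesis using nearest[of a "1/N"] a N by (simp add: f_def)
  qed
  show ?thesis
    unfolding eq
  proof (rule killed_path_D_loc)
    show "0 \<le> ereal (real i0 / N)" using N by simp
    show "f s \<in> topspace S" if "0 \<le> s" "ereal s < ereal (real i0 / N)" for s using fS that by simp
  next
    fix t e :: real assume t: "0 \<le> t" "ereal t < ereal (real i0 / N)" and e: "0 < e"
    let ?\<delta> = "(of_int \<lfloor>N * t\<rfloor> + 1) / N - t"
    have "N * t < of_int \<lfloor>N * t\<rfloor> + 1" by linarith
    then have "0 < ?\<delta>" using N by (simp add: field_simps)
    moreover have "d (f s) (f t) < e" if s: "t < s" "s < t + ?\<delta>" for s
    proof -
      have "N * t < N * s" "N * s < of_int \<lfloor>N * t\<rfloor> + 1" using s N by (auto simp: field_simps)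
      then have "\<lfloor>N * s\<rfloor> = \<lfloor>N * t\<rfloor>" by linarith
      then have "f s = f t" by (simp add: f_def)
      then show ?thesis using fS t e by simp
    qed
    ultimately show "\<exists>\<delta>>0. \<forall>s. t < s \<longrightarrow> s < t + \<delta> \<longrightarrow> ereal s < ereal (real i0 / N) \<longrightarrow> d (f s) (f t) < e" by blast
  next
    fix t e :: real
    assume t: "0 < t" "ereal t < ereal (real i0 / N) \<or> ereal t = ereal (real i0 / N) \<and> (\<exists>B. \<forall>s. 0 \<le> s \<longrightarrow> s < t \<longrightarrow> g (f s) \<le> B)" and e: "0 < e"
    \<comment> \<open>The cell to the left of t has index \<open>\<lceil>N * t\<rceil> - 1\<close>;
      the floor would name the wrong cell when t is a grid point.\<close>
    let ?\<delta> = "t - (of_int \<lceil>N * t\<rceil> - 1) / N"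
    have "of_int \<lceil>N * t\<rceil> - 1 < N * t" by linarith
    then have "0 < ?\<delta>" using N by (simp add: field_simps)
    moreover have "d (f r) (f s) < e" if s: "0 \<le> r" "t - ?\<delta> < r" "r < t" "0 \<le> s" "t - ?\<delta> < s" "s < t" for r s
    proof -
      have "of_int \<lceil>N * t\<rceil> - 1 < N * r" "N * r < N * t" "of_int \<lceil>N * t\<rceil> - 1 < N * s" "N * s < N * t" using s N by (auto simp: field_simps)
      moreover from this have "N * s < of_int \<lceil>N * t\<rceil>" "N * r < of_int \<lceil>N * t\<rceil>"
        using le_of_int_ceiling[of "N * t"] by linarith+
      ultimately have "\<lfloor>N * s\<rfloor> = \<lceil>N * t\<rceil> - 1" "\<lfloor>N * r\<rfloor> = \<lceil>N * t\<rceil> - 1"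
        by (auto intro!: floor_unique)
      then have "\<lfloor>N * s\<rfloor> = \<lfloor>N * r\<rfloor>" by simp
      then have "f s = f r" by (simp add: f_def)
      moreover have "s < real i0 / N" using t s by auto
      ultimately show ?thesis using fS[of s] s e by simp
    qed
    ultimately show "\<exists>\<delta>>0. \<forall>r s. 0 \<le> r \<longrightarrow> t - \<delta> < r \<longrightarrow> r < t \<longrightarrow> 0 \<le> s \<longrightarrow> t - \<delta> < s \<longrightarrow> s < t \<longrightarrow> d (f r) (f s) < e" by blast
  qed
qed

lemma eventually_inverse_Suc: "0 < c \<Longrightarrow> \<forall>\<^sub>F n in sequentially. 1 / real (Suc n) < c"
  using order_tendstoD(2)[OF LIMSEQ_inverse_real_of_nat, of c] by (simp add: inverse_eq_divide)

text \<open>The time change moves the partition points of a nearly constant subdivision of \<open>x\<close> to the next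
  grid point, so that between two of them only values of \<open>x\<close> from the same piece are sampled.\<close>

lemma grid_time_change:
  assumes x: "x \<in> D_loc S" and t: "0 \<le> t" "x t \<noteq> None \<or> bounded_before x t" and e: "0 < e"
  shows "\<forall>\<^sub>F n in sequentially. \<exists>l. log_slopes_le e l \<and> l t = of_int \<lceil>real (Suc n) * t\<rceil> / real (Suc n) \<and>
    (\<forall>s. 0 \<le> s \<longrightarrow> s < t \<longrightarrow> real (nat \<lfloor>real (Suc n) * l s\<rfloor>) / real (Suc n) < t \<and>
      near e (x s) (x (real (nat \<lfloor>real (Suc n) * l s\<rfloor>) / real (Suc n))))"
proof (rule cadlag_induct[OF x e t])
  show "\<forall>\<^sub>F n in sequentially. \<exists>l. log_slopes_le e l \<and> l 0 = of_int \<lceil>real (Suc n) * 0\<rceil> / real (Suc n) \<and>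
    (\<forall>s. 0 \<le> s \<longrightarrow> s < 0 \<longrightarrow> real (nat \<lfloor>real (Suc n) * l s\<rfloor>) / real (Suc n) < 0 \<and>
      near e (x s) (x (real (nat \<lfloor>real (Suc n) * l s\<rfloor>) / real (Suc n))))"
    by (intro always_eventually allI exI[of _ "\<lambda>s. s"]) (use e in \<open>auto simp: log_slopes_le_id\<close>)
next
  fix u v :: real
  assume uv: "0 \<le> u" "u < v" "v \<le> t"
    and P: "\<forall>\<^sub>F n in sequentially. \<exists>l. log_slopes_le e l \<and> l u = of_int \<lceil>real (Suc n) * u\<rceil> / real (Suc n) \<and>
      (\<forall>s. 0 \<le> s \<longrightarrow> s < u \<longrightarrow> real (nat \<lfloor>real (Suc n) * l s\<rfloor>) / real (Suc n) < u \<and>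
        near e (x s) (x (real (nat \<lfloor>real (Suc n) * l s\<rfloor>) / real (Suc n))))"
    and osc: "\<And>r s. u \<le> r \<Longrightarrow> r < v \<Longrightarrow> u \<le> s \<Longrightarrow> s < v \<Longrightarrow> near e (x r) (x s)"
  \<comment> \<open>Relative slope errors up to c are admissible on both sides, as 1 - c = exp (-e)
    and 1 + c \<le> exp e. Rounding up both ends of a piece changes its length by less than one mesh
    width, which is below c * (v - u) for large n.\<close>
  define c where "c = 1 - exp (-e)"
  have c: "0 < c" "exp (-e) = 1 - c" "1 + c \<le> exp e"
  proof -
    have "1 - e \<le> exp (-e)" "1 + e \<le> exp e" using exp_ge_add_one_self[of "-e"] exp_ge_add_one_self[of e] by auto
    then show "1 + c \<le> exp e" unfolding c_def by linarith
  qed (use e in \<open>auto simp: c_def\<close>)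
  have "\<forall>\<^sub>F n in sequentially. 1 / real (Suc n) < c * (v - u)" using c uv by (intro eventually_inverse_Suc) simp
  with P show "\<forall>\<^sub>F n in sequentially. \<exists>l. log_slopes_le e l \<and> l v = of_int \<lceil>real (Suc n) * v\<rceil> / real (Suc n) \<and>
      (\<forall>s. 0 \<le> s \<longrightarrow> s < v \<longrightarrow> real (nat \<lfloor>real (Suc n) * l s\<rfloor>) / real (Suc n) < v \<and>
        near e (x s) (x (real (nat \<lfloor>real (Suc n) * l s\<rfloor>) / real (Suc n))))"
  proof eventually_elim
    fix n
    define N where "N = real (Suc n)"
    have N: "0 < N" by (simp add: N_def)
    assume "\<exists>l. log_slopes_le e l \<and> l u = of_int \<lceil>real (Suc n) * u\<rceil> / real (Suc n) \<and>
      (\<forall>s. 0 \<le> s \<longrightarrow> s < u \<longrightarrow> real (nat \<lfloor>real (Suc n) * l s\<rfloor>) / real (Suc n) < u \<and>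
        near e (x s) (x (real (nat \<lfloor>real (Suc n) * l s\<rfloor>) / real (Suc n))))"
    then obtain l where l: "log_slopes_le e l" "l u = of_int \<lceil>N * u\<rceil> / N"
      "\<And>s. 0 \<le> s \<Longrightarrow> s < u \<Longrightarrow> real (nat \<lfloor>N * l s\<rfloor>) / N < u \<and> near e (x s) (x (real (nat \<lfloor>N * l s\<rfloor>) / N))"
      unfolding N_def by blast
    assume "1 / real (Suc n) < c * (v - u)"
    then have Nc: "1 < c * (N * (v - u))" unfolding N_def[symmetric] using N by (simp add: field_simps)
    define p where "p = (of_int \<lceil>N * v\<rceil> - of_int \<lceil>N * u\<rceil>) / (N * (v - u))"
    have pos: "0 < N * (v - u)" using N uv by simp
    have vu: "N * v - N * u = N * (v - u)" by (simp add: right_diff_distrib)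
    have 1: "(of_int \<lceil>N * v\<rceil> - of_int \<lceil>N * u\<rceil> :: real) \<le> N * (v - u) + 1" using vu by linarith
    have 2: "N * (v - u) - 1 \<le> (of_int \<lceil>N * v\<rceil> - of_int \<lceil>N * u\<rceil> :: real)" using vu by linarith
    have 3: "(1 - c) * (N * (v - u)) \<le> N * (v - u) - 1" "N * (v - u) + 1 \<le> (1 + c) * (N * (v - u))"
      using Nc by (auto simp: algebra_simps)
    have "(1 - c) * (N * (v - u)) \<le> (of_int \<lceil>N * v\<rceil> - of_int \<lceil>N * u\<rceil> :: real)" using 2 3(1) by (rule order_trans[rotated])
    moreover have "(of_int \<lceil>N * v\<rceil> - of_int \<lceil>N * u\<rceil> :: real) \<le> (1 + c) * (N * (v - u))" using 1 3(2) by (rule order_trans)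
    ultimately have "1 - c \<le> p" "p \<le> 1 + c"
      unfolding p_def le_divide_eq divide_le_eq using pos by auto
    then have p: "exp (-e) \<le> p" "p \<le> exp e" using c(2,3) by linarith+
    define l' where "l' = (\<lambda>s. if s \<le> u then l s else l u + p * (s - u))"
    have slopes: "log_slopes_le e l'"
      unfolding l'_def using log_slopes_leD[OF l(1)] uv p by (intro log_slopes_le_extend) auto
    have "p * (v - u) = (of_int \<lceil>N * v\<rceil> - of_int \<lceil>N * u\<rceil>) / N" using uv N by (simp add: p_def)
    then have lv: "l' v = of_int \<lceil>N * v\<rceil> / N"
      using uv l(2) by (simp add: l'_def diff_divide_distrib)
    have "real (nat \<lfloor>N * l' s\<rfloor>) / N < v \<and> near e (x s) (x (real (nat \<lfloor>N * l' s\<rfloor>) / N))"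
      if s: "0 \<le> s" "s < v" for s
    proof (cases "s < u")
      case True then show ?thesis using l(3)[OF s(1)] uv by (auto simp: l'_def)
    next
      case False
      then have us: "u \<le> s" by simp
      have "l' u \<le> l' s" "l' s < l' v"
        using log_slopes_le_less_iff(2)[OF slopes uv(1) s(1)] log_slopes_le_less_iff(1)[OF slopes s(1), of v] us s uv by auto
      then have "of_int \<lceil>N * u\<rceil> / N \<le> l' s" "l' s < of_int \<lceil>N * v\<rceil> / N" using l(2) lv by (simp_all add: l'_def)
      then have "of_int \<lceil>N * u\<rceil> \<le> N * l' s" "N * l' s < of_int \<lceil>N * v\<rceil>" using N by (simp_all add: field_simps)
      then have fl: "\<lceil>N * u\<rceil> \<le> \<lfloor>N * l' s\<rfloor>" "\<lfloor>N * l' s\<rfloor> < \<lceil>N * v\<rceil>" by linarith+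
      have nu: "0 \<le> N * u" using N uv by simp
      have i: "real (nat \<lfloor>N * l' s\<rfloor>) = of_int \<lfloor>N * l' s\<rfloor>" using fl(1) nu by linarith
      have "N * u \<le> of_int \<lfloor>N * l' s\<rfloor>" "of_int \<lfloor>N * l' s\<rfloor> < N * v" using fl by linarith+
      then have "u \<le> real (nat \<lfloor>N * l' s\<rfloor>) / N" "real (nat \<lfloor>N * l' s\<rfloor>) / N < v"
        unfolding i using N by (simp_all add: field_simps)
      then show ?thesis using osc us s by blast
    qed
    then show "\<exists>l. log_slopes_le e l \<and> l v = of_int \<lceil>real (Suc n) * v\<rceil> / real (Suc n) \<and>
      (\<forall>s. 0 \<le> s \<longrightarrow> s < v \<longrightarrow> real (nat \<lfloor>real (Suc n) * l s\<rfloor>) / real (Suc n) < v \<and>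
        near e (x s) (x (real (nat \<lfloor>real (Suc n) * l s\<rfloor>) / real (Suc n))))"
      unfolding N_def[symmetric] using slopes lv by blast
  qed
qed

text \<open>Either case of the definition of convergence provides a stopping time up to which
  \<open>cadlag_induct\<close>, and so \<open>grid_time_change\<close>, applies.\<close>

lemma small_cut:
  assumes x: "x \<in> D_exp S" and e: "0 < e"
  obtains t where "0 \<le> t" "cut x t \<le> e" "x t \<noteq> None \<or> bounded_before x t"
proof (cases "lifetime x < \<infinity> \<and> compactly_contained S (trajectory x)")
  case True
  then obtain T where T: "lifetime x = ereal T" "0 \<le> T" using lifetime_nonneg[of x] by (cases "lifetime x") auto
  then have "x T = None" using D_exp_None_iff[OF x] by simp
  then show ?thesis using that[of T] T True bounded_before_lifetime[OF x T(1)] e by (simp add: cut_None)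
next
  case False
  show ?thesis
  proof (rule alive_small_cut[OF x False e])
    fix t assume "0 \<le> t" "x t \<noteq> None" "cut x t \<le> e"
    then show ?thesis using that[of t] by blast
  qed
qed

lemma discretize_witness:
  assumes x: "x \<in> D_loc S" and e: "0 < e"
  shows "\<forall>\<^sub>F n in sequentially. \<exists>l t. witness e l t x (discretize n x)"
proof -
  note x' = D_loc_D_exp[OF x]
  have e4: "0 < e / 4" using e by simp
  obtain t where t: "0 \<le> t" "cut x t \<le> e / 4" "x t \<noteq> None \<or> bounded_before x t" using small_cut[OF x' e4] .
  have alive: "x s \<noteq> None" if "0 \<le> s" "s < t" for s
    using t(3) that D_exp_None_mono[OF x' that(1) less_imp_le[OF that(2)]] by (force simp: bounded_before_def)
  \<comment> \<open>At the stopping time the step path shows x at the next grid point, at or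
    slightly after t; this neighbourhood controls that value if x is alive at t.\<close>
  have "\<exists>\<delta>>0. x t \<noteq> None \<longrightarrow> (\<forall>s. t \<le> s \<longrightarrow> s < t + \<delta> \<longrightarrow> near (e/4) (x t) (x s))"
    using D_exp_right[OF x' t(1) _ e4] zero_less_one by metis
  then obtain \<delta> where \<delta>: "0 < \<delta>" "x t \<noteq> None \<Longrightarrow> t \<le> s \<Longrightarrow> s < t + \<delta> \<Longrightarrow> near (e/4) (x t) (x s)" for s by blast
  have "\<forall>\<^sub>F n in sequentially. 1 / real (Suc n) < e / 4" "\<forall>\<^sub>F n in sequentially. 1 / real (Suc n) < \<delta>"
    "\<forall>\<^sub>F n in sequentially. 1 / real (Suc n) < 1 / (1 + t)"
    by (rule eventually_inverse_Suc, use e \<delta>(1) t(1) in simp)+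
  with grid_time_change[OF x t(1,3) e4] show ?thesis
  proof eventually_elim
    fix n
    define N where "N = real (Suc n)"
    have N: "0 < N" by (simp add: N_def)
    let ?y = "discretize n x"
    assume "\<exists>l. log_slopes_le (e/4) l \<and> l t = of_int \<lceil>real (Suc n) * t\<rceil> / real (Suc n) \<and>
      (\<forall>s. 0 \<le> s \<longrightarrow> s < t \<longrightarrow> real (nat \<lfloor>real (Suc n) * l s\<rfloor>) / real (Suc n) < t \<and>
        near (e/4) (x s) (x (real (nat \<lfloor>real (Suc n) * l s\<rfloor>) / real (Suc n))))"
    then obtain l where l: "log_slopes_le (e/4) l" "l t = of_int \<lceil>N * t\<rceil> / N"
      "\<And>s. 0 \<le> s \<Longrightarrow> s < t \<Longrightarrow> real (nat \<lfloor>N * l s\<rfloor>) / N < t \<and> near (e/4) (x s) (x (real (nat \<lfloor>N * l s\<rfloor>) / N))"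
      unfolding N_def by blast
    assume small: "1 / real (Suc n) < e / 4" "1 / real (Suc n) < \<delta>" "1 / real (Suc n) < 1 / (1 + t)"
    \<comment> \<open>The horizon of the grid lies beyond t, so all samples before t are
      recorded.\<close>
    have tN: "t < N" using small(3)[folded N_def] t(1) N by (simp add: field_simps)
    have "near e (x s) (?y (l s))" if s: "0 \<le> s" "s < t" for s
    proof -
      let ?i = "nat \<lfloor>N * l s\<rfloor>"
      have i: "real ?i / N < t" "near (e/4) (x s) (x (real ?i / N))" using l(3)[OF s] by auto
      have "real ?i < N * N" using i(1) tN N by (simp add: field_simps) (meson less_trans mult_strict_left_mono)
      then have "?i < Suc n * Suc n" unfolding N_def by (metis of_nat_less_iff of_nat_mult)
      then have "near (1 / N) (x (real ?i / N)) (?y (l s))"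
        using discretize_near[OF x' log_slopes_le_nonneg[OF l(1) s(1)], of n, folded N_def] near_not_None[OF i(2)] by blast
      then have "near (e/4 + 1 / N) (x s) (?y (l s))" using near_trans[OF i(2)] by blast
      then show ?thesis by (rule near_mono) (use small(1)[folded N_def] e in linarith)
    qed
    \<comment> \<open>A living sample at or after t means that x is alive at t, and right-continuity
      applies; a dead one has cut 0.\<close>
    moreover have "cut ?y (l t) \<le> e"
    proof (cases "?y (l t) = None")
      case False
      have lt0: "0 \<le> l t" using log_slopes_le_nonneg[OF l(1) t(1)] .
      have fl: "\<lfloor>N * l t\<rfloor> = \<lceil>N * t\<rceil>" using l(2) N by simp
      let ?i = "nat \<lfloor>N * l t\<rfloor>"
      have "0 \<le> N * t" using N t(1) by simp
      then have ri: "real ?i = of_int \<lceil>N * t\<rceil>" unfolding fl by linarith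
      have i: "?i < Suc n * Suc n" and al: "x (real ?i / N) \<noteq> None"
        using False by (auto simp: discretize_eq[OF lt0, of n, folded N_def] Let_def simp del: mult_Suc mult_Suc_right split: if_splits)
      have b: "N * t \<le> real ?i" "real ?i < N * t + 1" unfolding ri by linarith+
      then have "t \<le> real ?i / N" "real ?i / N < t + 1 / N" using N by (simp_all add: field_simps)
      then have ti: "t \<le> real ?i / N" "real ?i / N < t + \<delta>" using small(2) unfolding N_def by linarith+
      have "x t \<noteq> None" using al D_exp_None_mono[OF x' t(1) ti(1)] by metis
      then have "near (e/4) (x t) (x (real ?i / N))" using \<delta>(2) ti by blast
      moreover have "near (1 / N) (x (real ?i / N)) (?y (l t))"
        using discretize_near[OF x' lt0, of n, folded N_def, OF al i] .
      ultimately have "near (e/4 + 1 / N) (x t) (?y (l t))" by (rule near_trans)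
      then have "near (e/2) (x t) (?y (l t))" by (rule near_mono) (use small(1)[folded N_def] e in linarith)
      moreover have "log_slopes_le (e/2) l" using l(1) by (rule log_slopes_le_mono) (use e in simp)
      ultimately have "\<bar>cut x t - cut ?y (l t)\<bar> \<le> e/2" using t(1) by (rule cut_near)
      then show ?thesis using t(2) e by linarith
    qed (use e in \<open>simp add: cut_None\<close>)
    ultimately have "witness e l t x ?y"
      unfolding witness_def using t(1,2) e log_slopes_le_mono[OF l(1), of e] by auto
    then show "\<exists>l t. witness e l t x ?y" by blast
  qed
qed

lemma discretize_eventually_close:
  assumes x: "x \<in> D_loc S" and e: "0 < e"
  shows "\<forall>\<^sub>F n in sequentially. path_dist x (discretize n x) < e"
proof -
  have "\<forall>\<^sub>F n in sequentially. \<exists>l t. witness (e/2) l t x (discretize n x)" using discretize_witness[OF x] e by simp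
  then show ?thesis
  proof eventually_elim
    fix n assume "\<exists>l t. witness (e/2) l t x (discretize n x)"
    then have "path_dist x (discretize n x) \<le> e/2" using path_dist_le[of "e/2"] e by auto
    then show "path_dist x (discretize n x) < e" using e by simp
  qed
qed

lemma separable_path_space: "separable_space P.mtopology"
  unfolding separable_space_def
proof (intro exI conjI)
  let ?C = "\<Union>n. grid_path n ` grid_code n ` D_loc S"
  show "countable ?C" by (intro countable_UN countable_image countableI_type)
  have C: "?C = {discretize n x |n x. x \<in> D_loc S}" by (auto simp: discretize_def)
  show "?C \<subseteq> topspace P.mtopology" unfolding C using discretize_D_loc D_loc_D_exp by auto
  show "P.mtopology closure_of ?C = topspace P.mtopology"
    unfolding P.metric_closure_of
  proof (intro equalityI subsetI)
    fix x assume "x \<in> topspace P.mtopology"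
    then have x: "x \<in> D_loc S" by simp
    have "\<exists>y\<in>?C. y \<in> P.mball x r" if r: "0 < r" for r
    proof -
      obtain n where "path_dist x (discretize n x) < r"
        using discretize_eventually_close[OF x r] by (auto simp: eventually_sequentially)
      then show ?thesis unfolding C using x discretize_D_loc[OF D_loc_D_exp[OF x], of n] by auto
    qed
    then show "x \<in> {x \<in> D_loc S. \<forall>r>0. \<exists>y\<in>?C. y \<in> P.mball x r}" using x by blast
  qed auto
qed

end

section \<open>Borel sets\<close>

lemma Borel_sets_openin: "openin T U \<Longrightarrow> U \<in> Borel_sets T"
  by (simp add: Borel_sets_def sigma_sets.Basic)

lemma sigma_algebra_Borel_sets: "sigma_algebra (topspace T) (Borel_sets T)"
  unfolding Borel_sets_def by (rule sigma_algebra_sigma_sets) (auto dest: openin_subset)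

lemma Borel_sets_closedin:
  assumes "closedin T C" shows "C \<in> Borel_sets T"
proof -
  interpret sigma_algebra "topspace T" "Borel_sets T" by (rule sigma_algebra_Borel_sets)
  have "topspace T - C \<in> Borel_sets T" using assms by (intro Borel_sets_openin) auto
  then have "topspace T - (topspace T - C) \<in> Borel_sets T" by (rule compl_sets)
  then show ?thesis using closedin_subset[OF assms] by (simp add: double_diff)
qed

lemma sigma_algebra_canonical: "sigma_algebra (D_loc S) (canonical_sigma_algebra S)"
  unfolding canonical_sigma_algebra_def by (rule sigma_algebra_sigma_sets) auto

lemma eval_canonical:
  "0 \<le> s \<Longrightarrow> A \<in> Borel_sets (Alexandroff_compactification S) \<Longrightarrow> {x \<in> D_loc S. x s \<in> A} \<in> canonical_sigma_algebra S"
  unfolding canonical_sigma_algebra_def by (rule sigma_sets.Basic) blast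

context separable_proper_metric begin

interpretation F: sigma_algebra "D_loc S" "canonical_sigma_algebra S"
  by (rule sigma_algebra_canonical)

interpretation B: sigma_algebra "D_loc S" "Borel_sets P.mtopology"
  using sigma_algebra_Borel_sets[of P.mtopology] by simp

section \<open>Open sets of paths belong to the sigma-algebra of the evaluations\<close>

lemma eval_open_canonical: "0 \<le> s \<Longrightarrow> openin S U \<Longrightarrow> {x \<in> D_loc S. x s \<in> Some ` U} \<in> canonical_sigma_algebra S"
  by (intro eval_canonical Borel_sets_openin) simp_all

lemma nearest_canonical:
  assumes s: "0 \<le> s" and e: "0 < e"
  shows "{x \<in> D_loc S. map_option (nearest e) (x s) = w} \<in> canonical_sigma_algebra S"
proof (cases w)
  case None
  have "{x \<in> D_loc S. map_option (nearest e) (x s) = w} = {x \<in> D_loc S. \<not> x s \<in> Some ` topspace S}"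
  proof (intro Collect_cong conj_cong refl)
    fix x assume "x \<in> D_loc S"
    then show "map_option (nearest e) (x s) = w \<longleftrightarrow> \<not> x s \<in> Some ` topspace S"
      using None D_exp_Some_topspace[OF D_loc_D_exp[of x S] s] by (cases "x s") auto
  qed
  then show ?thesis using F.sets_Collect_neg[OF eval_open_canonical[OF s openin_topspace]] by simp
next
  case (Some j)
  have "{x \<in> D_loc S. map_option (nearest e) (x s) = w} =
    {x \<in> D_loc S. x s \<in> Some ` M.mball (q j) e \<and> (\<forall>i\<in>{..<j}. \<not> x s \<in> Some ` M.mball (q i) e)}"
  proof (intro Collect_cong conj_cong refl)
    fix x assume x: "x \<in> D_loc S"
    show "map_option (nearest e) (x s) = w \<longleftrightarrow>
      x s \<in> Some ` M.mball (q j) e \<and> (\<forall>i\<in>{..<j}. \<not> x s \<in> Some ` M.mball (q i) e)"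
    proof (cases "x s")
      case (Some a)
      then show ?thesis
        using \<open>w = Some j\<close> nearest_eq_iff[OF D_exp_Some_topspace[OF D_loc_D_exp[OF x] s Some] e, of j]
        by (simp add: inj_image_mem_iff del: M.in_mball) blast
    qed (use \<open>w = Some j\<close> in auto)
  qed
  moreover have "openin S (M.mball (q i) e)" for i using M.openin_mball mtopology_eq by metis
  ultimately show ?thesis
    by (simp only:) (intro F.sets_Collect_conj F.sets_Collect_finite_All F.sets_Collect_neg eval_open_canonical s; simp)
qed

text \<open>The set C is arbitrary: the step paths come from countably many codes, and each code is
  an event on finitely many coordinates.\<close>

lemma discretize_canonical: "{x \<in> D_loc S. discretize n x \<in> C} \<in> canonical_sigma_algebra S"
proof -
  let ?m = "Suc n * Suc n"
  have code: "{x \<in> D_loc S. grid_code n x = ws} \<in> canonical_sigma_algebra S" for ws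
  proof (cases "length ws = ?m")
    case True
    then have "{x \<in> D_loc S. grid_code n x = ws} =
      {x \<in> D_loc S. \<forall>i\<in>{..<?m}. map_option (nearest (1 / real (Suc n))) (x (real i / real (Suc n))) = ws ! i}"
      unfolding grid_code_def list_eq_iff_nth_eq by (auto simp del: mult_Suc mult_Suc_right upt_Suc of_nat_Suc)
    then show ?thesis
      by (simp only:) (intro F.sets_Collect_finite_All nearest_canonical; simp)
  next
    case False
    then have "{x \<in> D_loc S. grid_code n x = ws} = {}"
      unfolding grid_code_def by (auto simp del: mult_Suc mult_Suc_right upt_Suc)
    then show ?thesis by (simp only: F.empty_sets)
  qed
  have "{x \<in> D_loc S. discretize n x \<in> C} = {x \<in> D_loc S. \<exists>ws. grid_path n ws \<in> C \<and> grid_code n x = ws}"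
    by (auto simp: discretize_def)
  then show ?thesis
    by (simp only:) (intro F.sets_Collect_countable_Ex F.sets_Collect_conj F.sets_Collect_const code)
qed

text \<open>A path lies in U exactly when, for some m, its step approximations eventually have their
  balls of radius 1 / (m + 1) inside U. This margin keeps the limit in U, and the sets
  \<open>?C m\<close> enter only through \<open>discretize_canonical\<close>.\<close>

lemma openin_canonical:
  assumes U: "openin P.mtopology U"
  shows "U \<in> canonical_sigma_algebra S"
proof -
  let ?C = "\<lambda>m. {y \<in> D_loc S. P.mball y (1 / real (Suc m)) \<subseteq> U}"
  have UD: "U \<subseteq> D_loc S" using openin_subset[OF U] by simp
  have "U = {x \<in> D_loc S. \<exists>m n0. \<forall>n. n0 \<le> n \<longrightarrow> discretize n x \<in> ?C m}"
  proof (intro equalityI subsetI)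
    fix x assume xU: "x \<in> U"
    then have x: "x \<in> D_loc S" using UD by blast
    obtain r where r: "0 < r" "P.mball x r \<subseteq> U" using U xU by (auto simp: P.openin_mtopology)
    obtain m where m: "1 / real (Suc m) < r / 2"
      using eventually_inverse_Suc[of "r/2"] r(1) by (auto simp: eventually_sequentially simp del: of_nat_Suc)
    obtain n0 where n0: "\<And>n. n0 \<le> n \<Longrightarrow> path_dist x (discretize n x) < r / 2"
      using discretize_eventually_close[OF x, of "r/2"] r(1) by (auto simp: eventually_sequentially)
    have "discretize n x \<in> ?C m" if "n0 \<le> n" for n
    proof -
      have D: "discretize n x \<in> D_loc S" using discretize_D_loc[OF D_loc_D_exp[OF x]] .
      have "P.mball (discretize n x) (1 / real (Suc m)) \<subseteq> P.mball x r"
      proof (rule P.mball_subset[OF _ x])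
        show "path_dist (discretize n x) x + 1 / real (Suc m) \<le> r"
          using n0[OF that] m P.commute[of x "discretize n x"] by linarith
      qed
      then show ?thesis using D r(2) by blast
    qed
    then show "x \<in> {x \<in> D_loc S. \<exists>m n0. \<forall>n. n0 \<le> n \<longrightarrow> discretize n x \<in> ?C m}" using x by blast
  next
    fix x assume "x \<in> {x \<in> D_loc S. \<exists>m n0. \<forall>n. n0 \<le> n \<longrightarrow> discretize n x \<in> ?C m}"
    then obtain m n0 where x: "x \<in> D_loc S" and n0: "\<And>n. n0 \<le> n \<Longrightarrow> discretize n x \<in> ?C m" by blast
    have "0 < 1 / real (Suc m)" by simp
    from discretize_eventually_close[OF x this] obtain n1 where "\<And>n. n1 \<le> n \<Longrightarrow> path_dist x (discretize n x) < 1 / real (Suc m)"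
      unfolding eventually_sequentially by blast
    then have "path_dist (discretize (max n0 n1) x) x < 1 / real (Suc m)" by (simp add: P.commute del: of_nat_Suc)
    moreover have "discretize (max n0 n1) x \<in> ?C m" using n0 by simp
    ultimately show "x \<in> U" using x by (auto simp del: of_nat_Suc)
  qed
  also have "\<dots> \<in> canonical_sigma_algebra S"
    by (intro F.sets_Collect_countable_Ex F.sets_Collect_countable_All F.sets_Collect_imp F.sets_Collect_const discretize_canonical)
  finally show ?thesis .
qed

section \<open>Evaluations are Borel\<close>

lemma limit_witness:
  assumes "range \<sigma> \<subseteq> D_loc S" "limitin P.mtopology \<sigma> x sequentially" "0 < e"
  obtains n l u where "witness e l u x (\<sigma> n)"
proof -
  obtain n where "path_dist (\<sigma> n) x < e" using assms(2,3) unfolding P.limit_metric_sequentially by blast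
  then show ?thesis using path_dist_less[of x "\<sigma> n" e] that P.commute by metis
qed

text \<open>Life at s extends to a later t, so a nearby path is alive at the image of the midpoint,
  which lies at or after s; a path dead at s cannot be.\<close>

lemma closedin_dead:
  assumes s: "0 \<le> s"
  shows "closedin P.mtopology {x \<in> D_loc S. x s = None}"
  unfolding P.metric_closedin_iff_sequentially_closed
proof (intro conjI allI impI)
  fix \<sigma> x assume "range \<sigma> \<subseteq> {x \<in> D_loc S. x s = None} \<and> limitin P.mtopology \<sigma> x sequentially"
  then have \<sigma>: "\<And>n. \<sigma> n \<in> D_loc S" "\<And>n. \<sigma> n s = None" and L: "limitin P.mtopology \<sigma> x sequentially" by auto
  have x: "x \<in> D_loc S" using L by (simp add: P.limitin_metric)
  have "x s = None"
  proof (rule ccontr)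
    assume al: "x s \<noteq> None"
    obtain t where t: "s < t" "x t \<noteq> None" using alive_extend[OF x s al] by blast
    have c: "0 < (t - s) / 2" using t by simp
    obtain e where e: "0 < e" "\<And>l u y. witness e l u x y \<Longrightarrow>
        \<bar>l ((s + t) / 2) - (s + t) / 2\<bar> \<le> (t - s) / 2 \<and> near ((t - s) / 2) (x ((s + t) / 2)) (y (l ((s + t) / 2)))"
      using witness_follow[OF x t(2) _ _ c, of "(s + t) / 2"] s t by auto
    obtain n l u where w: "witness e l u x (\<sigma> n)" using limit_witness[OF _ L e(1)] \<sigma>(1) by blast
    have "s \<le> l ((s + t) / 2)" using e(2)[OF w] by (auto simp: abs_le_iff field_simps)
    moreover have "\<sigma> n (l ((s + t) / 2)) \<noteq> None" using e(2)[OF w] near_not_None by blast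
    ultimately show False using D_exp_None_mono[OF D_loc_D_exp[OF \<sigma>(1)] s _ \<sigma>(2)] by metis
  qed
  then show "x \<in> {x \<in> D_loc S. x s = None}" using x by simp
qed auto

text \<open>Evaluation at a fixed time is not continuous, since a time change can carry s across a
  jump. Confinement to a closed set throughout an open time interval survives small displacements of
  time.\<close>

lemma closedin_confined:
  assumes s: "0 \<le> s" and C: "closedin S C"
  shows "closedin P.mtopology {x \<in> D_loc S. \<forall>u. s < u \<longrightarrow> u < v \<longrightarrow> x u \<in> insert None (Some ` C)}"
  unfolding P.metric_closedin_iff_sequentially_closed
proof (intro conjI allI impI)
  fix \<sigma> x
  assume A: "range \<sigma> \<subseteq> {x \<in> D_loc S. \<forall>u. s < u \<longrightarrow> u < v \<longrightarrow> x u \<in> insert None (Some ` C)} \<and>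
    limitin P.mtopology \<sigma> x sequentially"
  then have \<sigma>: "range \<sigma> \<subseteq> D_loc S" "\<And>n u. s < u \<Longrightarrow> u < v \<Longrightarrow> \<sigma> n u \<in> insert None (Some ` C)" by blast+
  have L: "limitin P.mtopology \<sigma> x sequentially" using A by blast
  have x: "x \<in> D_loc S" using L by (simp add: P.limitin_metric)
  have "x u \<in> insert None (Some ` C)" if u: "s < u" "u < v" for u
  proof (cases "x u")
    case (Some a)
    have u0: "0 \<le> u" using s u by simp
    have aS: "a \<in> topspace S" using D_exp_Some_topspace[OF D_loc_D_exp[OF x] u0 Some] .
    obtain t where t: "u < t" "x t \<noteq> None" using alive_extend[OF x u0] Some by blast
    have "a \<in> C"
    proof (rule ccontr)
      assume "a \<notin> C"
      then obtain r where r: "0 < r" "disjnt C (M.mball a r)"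
        using C aS M.closedin_metric[of C] unfolding mtopology_eq by blast
      \<comment> \<open>Small enough that the image of u remains between s and v and the value there
        remains in a ball around a that misses C.\<close>
      define c where "c = min (r / 2) (min ((u - s) / 2) ((v - u) / 2))"
      have c: "0 < c" "c < r" "c < u - s" "c < v - u" unfolding c_def using r u by (auto simp: min_less_iff_disj)
      obtain e where e: "0 < e" "\<And>l w y. witness e l w x y \<Longrightarrow> \<bar>l u - u\<bar> \<le> c \<and> near c (x u) (y (l u))"
        using witness_follow[OF x t(2) u0 t(1) c(1)] by blast
      obtain n l w where w: "witness e l w x (\<sigma> n)" using limit_witness[OF \<sigma>(1) L e(1)] by blast
      have n: "near c (Some a) (\<sigma> n (l u))" and lu: "\<bar>l u - u\<bar> \<le> c" using e(2)[OF w] Some by auto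
      have "s < l u" "l u < v" using lu c by (auto simp: abs_le_iff)
      then have "\<sigma> n (l u) \<in> insert None (Some ` C)" by (rule \<sigma>(2))
      then obtain b where b: "b \<in> C" "\<sigma> n (l u) = Some b" using near_not_None[OF n] by auto
      have "b \<in> M.mball a r" using n b c(2) by (auto simp: near_def)
      then show False using b r(2) by (auto simp: disjnt_iff)
    qed
    then show ?thesis using Some by simp
  qed simp
  then show "x \<in> {x \<in> D_loc S. \<forall>u. s < u \<longrightarrow> u < v \<longrightarrow> x u \<in> insert None (Some ` C)}" using x by blast
qed auto

text \<open>By right-continuity the value at s is decided by confinement just after s, with
  countably many closed balls and interval lengths. Admitting \<Delta> there fits
  \<open>closedin_confined\<close>; life at s is a separate clause.\<close>

lemma eval_open_iff:
  assumes x: "x \<in> D_loc S" and s: "0 \<le> s" and U: "openin S U"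
  shows "x s \<in> Some ` U \<longleftrightarrow> x s \<noteq> None \<and> (\<exists>j m k. M.mcball (q j) (1 / real (Suc m)) \<subseteq> U \<and>
    (\<forall>u. s < u \<longrightarrow> u < s + 1 / real (Suc k) \<longrightarrow> x u \<in> insert None (Some ` M.mcball (q j) (1 / real (Suc m)))))"
proof
  assume "x s \<in> Some ` U"
  then obtain a where a: "x s = Some a" "a \<in> U" by blast
  have aS: "a \<in> topspace S" using openin_subset[OF U] a(2) by blast
  obtain r where r: "0 < r" "M.mball a r \<subseteq> U" using U a(2) M.openin_mtopology[of U] unfolding mtopology_eq by blast
  obtain m where m: "1 / real (Suc m) < r / 2"
    using eventually_inverse_Suc[of "r/2"] r(1) by (auto simp: eventually_sequentially simp del: of_nat_Suc)
  define c where "c = 1 / real (Suc m)"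
  have c: "0 < c" "c < r / 2" using m by (simp_all add: c_def)
  \<comment> \<open>Some dense point is within c / 2 of a, and x moves by at most c / 2 just after
    s; so x stays in the closed ball of radius c, which lies in U because c < r / 2.\<close>
  obtain j where j: "a \<in> M.mball (q j) (c / 2)" using dense[OF aS, of "c/2"] c(1) by auto
  have sub: "M.mcball (q j) c \<subseteq> U"
  proof -
    have "M.mcball (q j) c \<subseteq> M.mball a r"
      using j c aS by (intro M.mcball_subset_mball) (auto simp: M.commute)
    then show ?thesis using r(2) by blast
  qed
  have c2: "0 < c / 2" using c(1) by simp
  have al: "x s \<noteq> None" using a by simp
  obtain \<delta> where \<delta>: "0 < \<delta>" "\<And>u. s \<le> u \<Longrightarrow> u < s + \<delta> \<Longrightarrow> near (c / 2) (x s) (x u)"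
    using D_exp_right[OF D_loc_D_exp[OF x] s al c2] by blast
  obtain k where k: "1 / real (Suc k) < \<delta>"
    using eventually_inverse_Suc[OF \<delta>(1)] by (auto simp: eventually_sequentially simp del: of_nat_Suc)
  have "x u \<in> insert None (Some ` M.mcball (q j) c)" if u: "s < u" "u < s + 1 / real (Suc k)" for u
  proof -
    have "near (c / 2) (Some a) (x u)" using \<delta>(2)[of u] u k a(1) by auto
    then obtain b where b: "x u = Some b" "b \<in> topspace S" "d a b \<le> c / 2" by (auto simp: near_def)
    have "d (q j) b \<le> d (q j) a + d a b" using j b(2) aS by (intro M.triangle) auto
    then show ?thesis using j b by auto
  qed
  then show "x s \<noteq> None \<and> (\<exists>j m k. M.mcball (q j) (1 / real (Suc m)) \<subseteq> U \<and>
    (\<forall>u. s < u \<longrightarrow> u < s + 1 / real (Suc k) \<longrightarrow> x u \<in> insert None (Some ` M.mcball (q j) (1 / real (Suc m)))))"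
    using al sub unfolding c_def by blast
next
  assume A: "x s \<noteq> None \<and> (\<exists>j m k. M.mcball (q j) (1 / real (Suc m)) \<subseteq> U \<and>
    (\<forall>u. s < u \<longrightarrow> u < s + 1 / real (Suc k) \<longrightarrow> x u \<in> insert None (Some ` M.mcball (q j) (1 / real (Suc m)))))"
  then obtain a where a: "x s = Some a" by blast
  obtain j m k where sub: "M.mcball (q j) (1 / real (Suc m)) \<subseteq> U"
    and conf: "\<And>u. s < u \<Longrightarrow> u < s + 1 / real (Suc k) \<Longrightarrow> x u \<in> insert None (Some ` M.mcball (q j) (1 / real (Suc m)))"
    using A by blast
  let ?c = "1 / real (Suc m)"
  have aS: "a \<in> topspace S" using D_exp_Some_topspace[OF D_loc_D_exp[OF x] s a] .
  have close: "\<exists>b. b \<in> M.mcball (q j) ?c \<and> b \<in> topspace S \<and> d a b \<le> e" if e: "0 < e" for e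
  proof -
    have al: "x s \<noteq> None" using a by simp
    obtain \<delta> where \<delta>: "0 < \<delta>" "\<And>u. s \<le> u \<Longrightarrow> u < s + \<delta> \<Longrightarrow> near e (x s) (x u)"
      using D_exp_right[OF D_loc_D_exp[OF x] s al e] by blast
    define \<eta> where "\<eta> = min \<delta> (1 / real (Suc k))"
    have \<eta>: "0 < \<eta>" "\<eta> \<le> \<delta>" "\<eta> \<le> 1 / real (Suc k)" using \<delta>(1) by (simp_all add: \<eta>_def)
    define u where "u = s + \<eta> / 2"
    have u: "s < u" "u < s + \<delta>" "u < s + 1 / real (Suc k)" unfolding u_def using \<eta> by linarith+
    have n: "near e (Some a) (x u)" using \<delta>(2)[of u] u a by simp
    then obtain b where "x u = Some b" "b \<in> M.mcball (q j) ?c" using conf[OF u(1,3)] near_not_None[OF n] by auto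
    then show ?thesis using n by (auto simp: near_def)
  qed
  have qS: "q j \<in> topspace S" using close[OF zero_less_one] by auto
  have "d (q j) a \<le> ?c"
  proof (rule field_le_epsilon)
    fix e :: real assume "0 < e"
    from close[OF this] obtain b where b: "b \<in> M.mcball (q j) ?c" "b \<in> topspace S" "d a b \<le> e" by blast
    have "d (q j) a \<le> d (q j) b + d a b" using M.triangle'[OF qS b(2) aS] M.triangle[OF qS b(2) aS] M.commute[of a b] by simp
    then show "d (q j) a \<le> ?c + e" using b by (auto simp del: of_nat_Suc)
  qed
  then have "a \<in> M.mcball (q j) ?c" using qS aS by simp
  then show "x s \<in> Some ` U" using a sub by blast
qed

lemma eval_open_Borel:
  assumes s: "0 \<le> s" and U: "openin S U"
  shows "{x \<in> D_loc S. x s \<in> Some ` U} \<in> Borel_sets P.mtopology"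
proof -
  have closed: "closedin S (M.mcball a r)" for a r using M.closedin_mcball mtopology_eq by metis
  have "{x \<in> D_loc S. x s \<in> Some ` U} = {x \<in> D_loc S. \<not> x s = None \<and> (\<exists>j m k. M.mcball (q j) (1 / real (Suc m)) \<subseteq> U \<and>
    (\<forall>u. s < u \<longrightarrow> u < s + 1 / real (Suc k) \<longrightarrow> x u \<in> insert None (Some ` M.mcball (q j) (1 / real (Suc m)))))}"
    by (intro Collect_cong conj_cong refl) (rule eval_open_iff[OF _ s U])
  also have "\<dots> \<in> Borel_sets P.mtopology"
    by (intro B.sets_Collect_conj B.sets_Collect_neg B.sets_Collect_countable_Ex B.sets_Collect_const
        Borel_sets_closedin closedin_dead closedin_confined closed s)
  finally show ?thesis .
qed

lemma eval_Borel:
  assumes s: "0 \<le> s" and A: "A \<in> Borel_sets (Alexandroff_compactification S)"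
  shows "{x \<in> D_loc S. x s \<in> A} \<in> Borel_sets P.mtopology"
  using A unfolding Borel_sets_def[of "Alexandroff_compactification S"]
proof induction
  case (Basic U)
  then consider V where "openin S V" "U = Some ` V"
    | C where "closedin S C" "U = insert None (Some ` (topspace S - C))"
    unfolding openin_Alexandroff_compactification by auto
  then show ?case
  proof cases
    case 1
    then show ?thesis using eval_open_Borel[OF s] by simp
  next
    case 2
    have "{x \<in> D_loc S. x s \<in> U} = {x \<in> D_loc S. x s = None \<or> x s \<in> Some ` (topspace S - C)}" using 2 by auto
    moreover have "openin S (topspace S - C)" using 2 by auto
    ultimately show ?thesis
      by (simp only:) (intro B.sets_Collect_disj Borel_sets_closedin closedin_dead eval_open_Borel s)
  qed
next
  case (Compl A)
  have "{x \<in> D_loc S. x s \<in> topspace (Alexandroff_compactification S) - A} = {x \<in> D_loc S. \<not> x s \<in> A}"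
    using D_exp_in_Alexandroff[OF D_loc_D_exp s] by auto
  then show ?case using B.sets_Collect_neg[OF Compl.IH] by simp
next
  case (Union A)
  have "{x \<in> D_loc S. x s \<in> (\<Union>i. A i)} = {x \<in> D_loc S. \<exists>i. x s \<in> A i}" by auto
  then show ?case using B.sets_Collect_countable_Ex[OF Union.IH] by simp
qed simp

lemma Borel_sets_path_space: "Borel_sets P.mtopology = canonical_sigma_algebra S"
proof
  show "Borel_sets P.mtopology \<subseteq> canonical_sigma_algebra S"
    unfolding Borel_sets_def P.topspace_mtopology by (rule F.sigma_sets_subset) (use openin_canonical in blast)
  show "canonical_sigma_algebra S \<subseteq> Borel_sets P.mtopology"
    unfolding canonical_sigma_algebra_def by (rule B.sigma_sets_subset) (use eval_Borel in blast)
qed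

end

section \<open>Existence of a proper metric\<close>

lemma weighted_sum_bounds:
  fixes f :: "nat \<Rightarrow> real"
  assumes "\<And>i. 0 \<le> f i" "\<And>i. f i \<le> C"
  shows "summable (\<lambda>i. (1/2)^Suc i * f i)" "(\<Sum>i. (1/2)^Suc i * f i) \<le> C"
proof -
  have s: "(\<lambda>i. (1/2)^Suc i * C) sums (1 * C)" by (intro sums_mult2 power_half_series)
  show sum: "summable (\<lambda>i. (1/2)^Suc i * f i)"
  proof (rule summable_comparison_test'[where N=0])
    show "summable (\<lambda>i. (1/2)^Suc i * C)" using s by (simp only: sums_iff)
    show "norm ((1/2)^Suc i * f i) \<le> (1/2)^Suc i * C" for i
      using assms[of i] by (simp add: abs_mult mult_left_mono)
  qed
  have "(\<Sum>i. (1/2)^Suc i * f i) \<le> (\<Sum>i. (1/2)^Suc i * C)"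
    using s assms(2) by (intro suminf_le sum) (auto simp: sums_iff)
  then show "(\<Sum>i. (1/2)^Suc i * f i) \<le> C" using s by (simp only: sums_iff mult_1)
qed

text \<open>The exhaustion function \<open>h\<close> is a weighted sum of the tents over countably many balls with compact
  closure. Adding \<open>\<bar>1 / h a - 1 / h b\<bar>\<close> to the metric makes bounded sets relatively compact.\<close>

lemma separable_proper_metric_exists:
  fixes S :: "'a topology"
  assumes lc: "locally_compact_space S" and sc: "second_countable S" and d: "metric_induces d S"
  shows "\<exists>d' g q. separable_proper_metric S d' g q"
proof (cases "topspace S = {}")
  case True
  have "separable_proper_metric S d (\<lambda>_. 0) (\<lambda>_. undefined)"
    by (unfold_locales) (use True d in auto)
  then show ?thesis by blast
next
  case False
  interpret M: Metric_space "topspace S" d using d by (simp add: metric_induces_def)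
  have MS: "M.mtopology = S" using d by (simp add: metric_induces_def)
  obtain C where C: "countable C" "C \<subseteq> topspace S" "S closure_of C = topspace S"
    using second_countable_imp_separable_space[OF sc] by (auto simp: separable_space_def)
  have Cne: "C \<noteq> {}" using C(3) False by (metis closure_of_empty)
  define q where "q = from_nat_into C"
  have rq: "range q = C" unfolding q_def by (rule range_from_nat_into[OF Cne C(1)])
  have dense: "\<exists>j. a \<in> M.mball (q j) e" if a: "a \<in> topspace S" and e: "0 < e" for a e
  proof -
    have "a \<in> M.mtopology closure_of C" using a C(3) MS by simp
    then obtain y where "y \<in> C" "y \<in> M.mball a e" unfolding M.metric_closure_of using e by blast
    then show ?thesis using rq by (auto simp: M.commute)
  qed
  \<comment> \<open>Radius 0 discards a closed ball that is not compact: its tent vanishes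
    identically.\<close>
  define \<rho> where "\<rho> j k = (if compactin S (M.mcball (q j) (1 / real (Suc k))) then 1 / real (Suc k) else 0)" for j k
  define c where "c i = q (fst (prod_decode i))" for i
  define r where "r i = \<rho> (fst (prod_decode i)) (snd (prod_decode i))" for i
  have r01: "0 \<le> r i" "r i \<le> 1" for i by (auto simp: r_def \<rho>_def)
  have rcomp: "compactin S (M.mcball (c i) (r i))" if "0 < r i" for i
    using that by (auto simp: r_def \<rho>_def c_def split: if_splits)
  have cS: "c i \<in> topspace S" for i using rq C(2) by (auto simp: c_def)
  have cover: "\<exists>i. a \<in> M.mball (c i) (r i)" if a: "a \<in> topspace S" for a
  proof -
    obtain U K where UK: "openin S U" "compactin S K" "a \<in> U" "U \<subseteq> K" using lc a unfolding locally_compact_space_def by blast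
    obtain e where e: "0 < e" "M.mball a e \<subseteq> U" using UK(1,3) M.openin_mtopology[of U] unfolding MS by blast
    obtain k where k: "1 / real (Suc k) < e / 2"
      using reals_Archimedean[of "e/2"] e(1) by (auto simp: inverse_eq_divide)
    obtain j where j: "a \<in> M.mball (q j) (1 / real (Suc k))" using dense[OF a, of "1 / real (Suc k)"] by auto
    have "M.mcball (q j) (1 / real (Suc k)) \<subseteq> M.mball a e"
    proof (rule M.mcball_subset_mball[OF _ a])
      have "d (q j) a < 1 / real (Suc k)" using j by simp
      then show "d (q j) a + 1 / real (Suc k) < e" using k by linarith
    qed
    then have "compactin S (M.mcball (q j) (1 / real (Suc k)))"
      using UK e(2) M.closedin_mcball unfolding MS by (intro closed_compactin[OF UK(2)]) auto
    then have "r (prod_encode (j, k)) = 1 / real (Suc k)" by (simp add: r_def \<rho>_def)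
    then show ?thesis using j by (intro exI[of _ "prod_encode (j, k)"]) (simp add: c_def)
  qed
  define \<phi> where "\<phi> i a = max 0 (r i - d (c i) a)" for i a
  have \<phi>01: "0 \<le> \<phi> i a" "\<phi> i a \<le> 1" for i a
    unfolding \<phi>_def using r01[of i] M.nonneg[of "c i" a] by linarith+
  have \<phi>L: "\<bar>\<phi> i a - \<phi> i b\<bar> \<le> d a b" if "a \<in> topspace S" "b \<in> topspace S" for i a b
    using M.triangle[OF cS that(1,2), of i] M.triangle[OF cS that(2,1), of i] M.commute[of a b] M.nonneg[of a b]
    unfolding \<phi>_def by linarith
  define h where "h a = (\<Sum>i. (1/2)^Suc i * \<phi> i a)" for a
  note h_sum = weighted_sum_bounds(1)[of "\<lambda>i. \<phi> i a" 1 for a, OF \<phi>01]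
  have hL: "\<bar>h a - h b\<bar> \<le> d a b" if ab: "a \<in> topspace S" "b \<in> topspace S" for a b
  proof -
    note ws = weighted_sum_bounds[of "\<lambda>i. \<bar>\<phi> i a - \<phi> i b\<bar>" "d a b", OF abs_ge_zero \<phi>L[OF ab]]
    have eq: "\<bar>(1/2)^Suc i * \<phi> i a - (1/2)^Suc i * \<phi> i b\<bar> = (1/2)^Suc i * \<bar>\<phi> i a - \<phi> i b\<bar>" for i
      unfolding right_diff_distrib[symmetric] abs_mult by simp
    have "\<bar>h a - h b\<bar> = \<bar>\<Sum>i. (1/2)^Suc i * \<phi> i a - (1/2)^Suc i * \<phi> i b\<bar>"
      unfolding h_def by (subst suminf_diff[OF h_sum h_sum]) simp
    also have "\<dots> \<le> (\<Sum>i. \<bar>(1/2)^Suc i * \<phi> i a - (1/2)^Suc i * \<phi> i b\<bar>)"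
      by (rule summable_rabs) (simp only: eq ws(1))
    also have "\<dots> \<le> d a b" using ws(2) by (simp only: eq)
    finally show ?thesis .
  qed
  have hpos: "0 < h a" if a: "a \<in> topspace S" for a
  proof -
    obtain i where "a \<in> M.mball (c i) (r i)" using cover[OF a] by blast
    then have "0 < (1/2)^Suc i * \<phi> i a" by (simp add: \<phi>_def)
    then show ?thesis unfolding h_def using \<phi>01(1) by (intro suminf_pos2[OF h_sum]) auto
  qed
  have hcomp: "compactin S {a \<in> topspace S. e \<le> h a}" if e: "0 < e" for e
  proof -
    \<comment> \<open>The tents from index n on contribute at most (1/2)^n. So e \<le> h a forces
      one of the first n tents to be positive at a, and a lies in one of finitely many compact
      balls.\<close>
    obtain n where n: "(1/2::real)^n < e" using real_arch_pow_inv[OF e, of "1/2"] by auto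
    let ?K = "\<Union>i\<in>{i\<in>{..<n}. 0 < r i}. M.mcball (c i) (r i)"
    have "compactin S ?K" by (intro compactin_Union) (auto intro: rcomp)
    moreover have "{a \<in> topspace S. e \<le> h a} \<subseteq> ?K"
    proof
      fix a assume a: "a \<in> {a \<in> topspace S. e \<le> h a}"
      show "a \<in> ?K"
      proof (rule ccontr)
        assume nK: "a \<notin> ?K"
        have z: "\<phi> i a = 0" if "i < n" for i
        proof (cases "0 < r i")
          case True
          then have "a \<notin> M.mcball (c i) (r i)" using nK that by blast
          then show ?thesis using a cS by (simp add: \<phi>_def)
        next
          case False
          then show ?thesis using M.nonneg[of "c i" a] unfolding \<phi>_def by linarith
        qed
        have "h a = (\<Sum>i. (1/2)^Suc (i + n) * \<phi> (i + n) a) + (\<Sum>i<n. (1/2)^Suc i * \<phi> i a)"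
          unfolding h_def by (rule suminf_split_initial_segment[OF h_sum])
        also have "(\<Sum>i<n. (1/2)^Suc i * \<phi> i a) = 0" using z by (intro sum.neutral) simp
        also have "(\<lambda>i. (1/2)^Suc (i + n) * \<phi> (i + n) a) = (\<lambda>i. (1/2)^n * ((1/2)^Suc i * \<phi> (i + n) a))"
          by (simp add: power_add mult_ac)
        also have "(\<Sum>i. (1/2)^n * ((1/2)^Suc i * \<phi> (i + n) a)) = (1/2)^n * (\<Sum>i. (1/2)^Suc i * \<phi> (i + n) a)"
          by (rule suminf_mult) (rule weighted_sum_bounds(1)[OF \<phi>01])
        also have "(1/2)^n * (\<Sum>i. (1/2)^Suc i * \<phi> (i + n) a) \<le> (1/2)^n * 1"
          by (intro mult_left_mono weighted_sum_bounds(2)[OF \<phi>01]) auto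
        finally show False using a n by simp
      qed
    qed
    moreover have "closedin M.mtopology {a \<in> topspace S. e \<le> h a}"
      unfolding M.closedin_metric
    proof (intro conjI allI impI)
      fix a assume a: "a \<in> topspace S - {a \<in> topspace S. e \<le> h a}"
      have "disjnt {a \<in> topspace S. e \<le> h a} (M.mball a (e - h a))"
        unfolding disjnt_iff using hL a by (fastforce simp: abs_le_iff)
      then show "\<exists>r>0. disjnt {a \<in> topspace S. e \<le> h a} (M.mball a r)" using a by (intro exI[of _ "e - h a"]) auto
    qed auto
    ultimately show ?thesis unfolding MS by (rule closed_compactin)
  qed
  \<comment> \<open>Sublevel sets of the reciprocal at positive levels are the compact superlevel
    sets of \<open>h\<close>.\<close>
  define g where "g a = 1 / h a" for a
  define d' where "d' a b = d a b + \<bar>g a - g b\<bar>" for a b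
  interpret N: Metric_space "topspace S" d'
  proof
    show "0 \<le> d' a b" "d' a b = d' b a" for a b by (auto simp: d'_def M.commute abs_minus_commute)
    show "d' a b = 0 \<longleftrightarrow> a = b" if "a \<in> topspace S" "b \<in> topspace S" for a b
    proof
      assume "d' a b = 0"
      then have "d a b = 0" using M.nonneg[of a b] unfolding d'_def by linarith
      then show "a = b" using M.zero[OF that] by simp
    qed (use that in \<open>simp add: d'_def\<close>)
    show "d' a b \<le> d' a y + d' y b" if "a \<in> topspace S" "y \<in> topspace S" "b \<in> topspace S" for a b y
      using M.triangle[OF that] by (simp add: d'_def)
  qed
  have small: "\<exists>\<delta>>0. M.mball a \<delta> \<subseteq> N.mball a e" if a: "a \<in> topspace S" and e: "0 < e" for a e
  proof -
    have ha: "0 < h a" using hpos[OF a] .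
    \<comment> \<open>The first bound keeps h b at least h a / 2, so the last one limits the change
      of 1 / h to e / 2; the middle one bounds the contribution of \<open>d\<close>.\<close>
    define \<delta> where "\<delta> = min (h a / 2) (min (e / 2) (e / 2 * (h a * h a / 2)))"
    have \<delta>: "0 < \<delta>" "\<delta> \<le> h a / 2" "\<delta> \<le> e / 2" "\<delta> \<le> e / 2 * (h a * h a / 2)" using ha e by (auto simp: \<delta>_def)
    have "d' a b < e" if b: "b \<in> topspace S" "d a b < \<delta>" for b
    proof -
      have hb: "h a / 2 \<le> h b" using hL[OF a b(1)] b(2) \<delta>(2) by linarith
      have "\<bar>g a - g b\<bar> = \<bar>h b - h a\<bar> / (h a * h b)" using ha hpos[OF b(1)] by (simp add: g_def diff_divide_eq_iff divide_diff_eq_iff abs_mult)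
      also have "\<dots> \<le> \<delta> / (h a * (h a / 2))"
        using hL[OF a b(1)] b(2) ha hb \<delta>(1) by (intro frac_le mult_left_mono) auto
      also have "\<dots> \<le> e / 2" using \<delta>(4) ha by (simp add: divide_le_eq)
      finally show ?thesis using b(2) \<delta>(3) by (simp add: d'_def)
    qed
    then show ?thesis using \<delta>(1) a by (intro exI[of _ \<delta>]) auto
  qed
  have "N.mtopology = M.mtopology"
    unfolding topology_eq
  proof (intro allI iffI)
    fix U assume U: "openin M.mtopology U"
    have "N.mball a e \<subseteq> M.mball a e" for a e by (auto simp: d'_def)
    then show "openin N.mtopology U" using U unfolding M.openin_mtopology N.openin_mtopology by (meson order_trans)
  next
    fix U assume U: "openin N.mtopology U"
    then show "openin M.mtopology U" unfolding M.openin_mtopology N.openin_mtopology using small by (meson order_trans subsetD)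
  qed
  then have d': "metric_induces d' S" using MS N.Metric_space_axioms by (simp add: metric_induces_def)
  have "separable_proper_metric S d' g q"
  proof (unfold_locales)
    show "metric_induces d' S" by (rule d')
    show "0 \<le> g a" if "a \<in> topspace S" for a using hpos[OF that] by (simp add: g_def)
    show "\<bar>g a - g b\<bar> \<le> d' a b" for a b by (simp add: d'_def)
    show "compactin S {a \<in> topspace S. g a \<le> B}" for B
    proof (cases "0 < B")
      case True
      have "g a \<le> B \<longleftrightarrow> 1 / B \<le> h a" if "a \<in> topspace S" for a
        using hpos[OF that] True by (simp add: g_def field_simps)
      then have "{a \<in> topspace S. g a \<le> B} = {a \<in> topspace S. 1 / B \<le> h a}" by auto
      then show ?thesis using hcomp[of "1 / B"] True by simp
    next
      case False
      have "0 < g a" if "a \<in> topspace S" for a using hpos[OF that] by (simp add: g_def)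
      then have "{a \<in> topspace S. g a \<le> B} = {}" using False by (fastforce simp: not_less)
      then show ?thesis by (metis compactin_empty)
    qed
    fix a e assume a: "a \<in> topspace S" and e: "(0::real) < e"
    obtain \<delta> where \<delta>: "0 < \<delta>" "M.mball a \<delta> \<subseteq> N.mball a e" using small[OF a e] by blast
    obtain j where "a \<in> M.mball (q j) \<delta>" using dense[OF a \<delta>(1)] by blast
    then have "q j \<in> M.mball a \<delta>" by (simp add: M.commute)
    then have "q j \<in> N.mball a e" using \<delta>(2) by blast
    then show "\<exists>j. a \<in> Metric_space.mball (topspace S) d' (q j) e" by (auto simp: N.commute)
  qed
  then show ?thesis by blast
qed

section \<open>The local Skorokhod topology\<close>

text \<open>Closed sets of a metrizable space are the sequentially closed ones, so convergence of
  sequences determines the topology.\<close>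

lemma metrizable_topology_eqI:
  assumes X: "completely_metrizable_space X" and Y: "completely_metrizable_space Y"
    and top: "topspace X = topspace Y"
    and lim: "\<And>\<sigma> l. range \<sigma> \<subseteq> topspace X \<Longrightarrow> l \<in> topspace X \<Longrightarrow> limitin X \<sigma> l sequentially \<longleftrightarrow> limitin Y \<sigma> l sequentially"
  shows "X = Y"
proof -
  obtain d where d: "Metric_space (topspace X) d" "X = Metric_space.mtopology (topspace X) d"
    using X unfolding completely_metrizable_space_def by (metis Metric_space.topspace_mtopology)
  obtain d' where d': "Metric_space (topspace X) d'" "Y = Metric_space.mtopology (topspace X) d'"
    using Y top unfolding completely_metrizable_space_def by (metis Metric_space.topspace_mtopology)
  have seq: "closedin X C \<longleftrightarrow> C \<subseteq> topspace X \<and> (\<forall>\<sigma> l. range \<sigma> \<subseteq> C \<and> limitin X \<sigma> l sequentially \<longrightarrow> l \<in> C)"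
    "closedin Y C \<longleftrightarrow> C \<subseteq> topspace X \<and> (\<forall>\<sigma> l. range \<sigma> \<subseteq> C \<and> limitin Y \<sigma> l sequentially \<longrightarrow> l \<in> C)" for C
    using Metric_space.metric_closedin_iff_sequentially_closed[OF d(1), of C]
      Metric_space.metric_closedin_iff_sequentially_closed[OF d'(1), of C]
    unfolding d(2)[symmetric] d'(2)[symmetric] by blast+
  have "limitin X \<sigma> l sequentially \<longleftrightarrow> limitin Y \<sigma> l sequentially" if "range \<sigma> \<subseteq> topspace X" for \<sigma> l
    using lim[OF that, of l] top limitin_topspace by metis
  then have "closedin X C \<longleftrightarrow> closedin Y C" for C
    unfolding seq by (meson order_trans)
  then show ?thesis unfolding topology_eq openin_closedin_eq top by simp
qed

theorem theorem2p6:
  fixes S :: "'a topology" and d :: "'a \<Rightarrow> 'a \<Rightarrow> real"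
  assumes "locally_compact_space S" and "Hausdorff_space S" and "second_countable S"
    and "metric_induces d S"
  shows "(\<exists>!T. is_local_Skorokhod_topology S d T) \<and>
    (\<forall>d'. metric_induces d' S \<longrightarrow> local_Skorokhod_topology S d' = local_Skorokhod_topology S d) \<and>
    Borel_sets (local_Skorokhod_topology S d) = canonical_sigma_algebra S"
proof -
  obtain d0 g q where "separable_proper_metric S d0 g q"
    using separable_proper_metric_exists assms(1,3,4) by blast
  then interpret separable_proper_metric S d0 g q .
  have polish: "Polish_space P.mtopology"
    unfolding Polish_space_def completely_metrizable_space_def
    using separable_path_space P.Metric_space_axioms mcomplete_path_dist by blast
  have ex: "is_local_Skorokhod_topology S d' P.mtopology" if d': "metric_induces d' S" for d'
    unfolding is_local_Skorokhod_topology_def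
  proof (intro conjI allI impI polish)
    fix xs :: "nat \<Rightarrow> real \<Rightarrow> 'a option" and x assume "(\<forall>k. xs k \<in> D_loc S) \<and> x \<in> D_loc S"
    then have xs: "\<And>k. xs k \<in> D_loc S" and x: "x \<in> D_loc S" by auto
    \<comment> \<open>\<open>path_dist\<close> is built from the proper metric \<open>d0\<close>;
      convergence for \<open>d0\<close> and for an arbitrary d' imply each other.\<close>
    show "limitin P.mtopology xs x sequentially \<longleftrightarrow> local_Skorokhod_convergent S d' xs x"
      unfolding limitin_path_dist_iff[OF xs x]
      using local_Skorokhod_convergent_change_metric[of xs x, OF xs x metric d']
        local_Skorokhod_convergent_change_metric[of xs x, OF xs x d' metric] by blast
  qed simp
  have unique: "T = P.mtopology" if d': "metric_induces d' S" and T: "is_local_Skorokhod_topology S d' T" for d' T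
  proof (rule metrizable_topology_eqI)
    show "completely_metrizable_space T" "completely_metrizable_space P.mtopology"
      using T polish by (auto simp: is_local_Skorokhod_topology_def Polish_space_def)
    show "topspace T = topspace P.mtopology" using T by (simp add: is_local_Skorokhod_topology_def)
    show "limitin T \<sigma> l sequentially \<longleftrightarrow> limitin P.mtopology \<sigma> l sequentially"
      if \<sigma>: "range \<sigma> \<subseteq> topspace T" "l \<in> topspace T" for \<sigma> l
    proof -
      have "(\<forall>k. \<sigma> k \<in> D_loc S) \<and> l \<in> D_loc S" using \<sigma> T by (auto simp: is_local_Skorokhod_topology_def)
      then show ?thesis using T ex[OF d'] by (simp add: is_local_Skorokhod_topology_def)
    qed
  qed
  have eq: "local_Skorokhod_topology S d' = P.mtopology" if "metric_induces d' S" for d'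
    unfolding local_Skorokhod_topology_def by (rule the_equality) (use ex unique that in blast)+
  show ?thesis
  proof (intro conjI allI impI ex1I[of _ P.mtopology])
    show "is_local_Skorokhod_topology S d P.mtopology" by (rule ex[OF assms(4)])
    show "T = P.mtopology" if "is_local_Skorokhod_topology S d T" for T using unique[OF assms(4) that] .
    show "local_Skorokhod_topology S d' = local_Skorokhod_topology S d" if "metric_induces d' S" for d'
      using eq[OF that] eq[OF assms(4)] by simp
    show "Borel_sets (local_Skorokhod_topology S d) = canonical_sigma_algebra S"
      using eq[OF assms(4)] Borel_sets_path_space by simp
  qed
qed

end
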